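(* Let $G$ and $H$ be upward bipolar plane graphs with the same number $n$ of edges, let $\phi\colon\{1,\dots,n\}\to E(G)$ and $\psi\colon\{1,\dots,n\}\to E(H)$ be bijections, let $\mathbf A=(A;+)$ be an Abelian group and $b\in A$. Let $P=\mathrm{Problem}(G,H,\phi,\psi,\mathbf A,b)$ and let $P^\ast=\mathrm{Problem}(H^\ast,G^\ast,\psi^\ast,\phi^\ast,\mathbf A,b)$ be its dual problem. Then an $n$-tuple $\vec a\in A^n$ is a solution of $P$ if and only if it is a solution of $P^\ast$.
   Context: All graphs are finite directed graphs (parallel edges allowed); each edge $e$ goes from its tail $t(e)$ to its head $h(e)$. A graph is acyclic if it has no directed cycle. A source (sink) is a vertex with no incoming (outgoing) edges. A bipolar graph is an acyclic digraph with at least two vertices, exactly one source $s_G$ and exactly one sink $t_G$; every maximal directed path in it goes from $s_G$ to $t_G$. Paired-bipolar-graphs problem: $G,H$ bipolar graphs with $n$ edges each, bijections $\phi\colon\{1,\dots,n\}\to E(G)$, $\psi\colon\{1,\dots,n\}\to E(H)$; write $e_i=\phi(i)$, $e'_i=\psi(i)$; $\mathbf A=(A;+)$ an Abelian group, $b\in A$. This data is denoted $\mathrm{Problem}(G,H,\phi,\psi,\mathbf A,b)$. For $\vec a=(a_1,\dots,a_n)\in A^n$ and $X\subseteq\{1,\dots,n\}$ define $\mathrm{Eff}_{\vec a}(X)\colon V(G)\to A$ by $\mathrm{Eff}_{\vec a}(X)(v)=\sum_{i\in X,\,h(e_i)=v}a_i-\sum_{i\in X,\,t(e_i)=v}a_i$.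 Define $\mathrm{Tr}_b\colon V(G)\to A$ by $\mathrm{Tr}_b(s_G)=-b$, $\mathrm{Tr}_b(t_G)=b$, and $\mathrm{Tr}_b(v)=0$ otherwise. The tuple $\vec a$ is a solution of the problem if for every maximal directed path of $H$, with edge set $\{e'_j:j\in X\}$, we have $\mathrm{Eff}_{\vec a}(X)=\mathrm{Tr}_b$. A plane graph has vertices that are points of $\mathbb R^2$ and edges that are oriented Jordan arcs between their endpoints, with arcs meeting only at common endpoints. An upward bipolar plane graph is a bipolar plane graph $G$ such that $s_G$ and $t_G$ both lie on the boundary of the unbounded region (the outer face). Facets of such $G$: the bounded regions (inner facets) together with the two parts into which the unbounded region is cut by a curve inside it joining $s_G$ to $t_G$ through the point at infinity (the two outer facets). The dual $G^\ast$ has the facets of $G$ as vertices and, for each edge $e\in E(G)$, a dual edge $e^\ast$ going from the facet lying to the left of $e$ (when walking along $e$ from $t(e)$ to $h(e)$) to the facet lying to its right; $G^\ast$ is a bipolar graph whose source and sink are the two outer facets. The dual problem of $P=\mathrm{Problem}(G,H,\phi,\psi,\mathbf A,b)$ is $P^\ast=\mathrm{Problem}(H^\ast,G^\ast,\psi^\ast,\phi^\ast,\mathbf A,b)$, where $\psi^\ast(i)=(e'_i)^\ast$ and $\phi^\ast(i)=(e_i)^\ast$ (so the roles of the two graphs are interchanged and both are dualized). *)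

theory Defs
  imports "HOL-Complex_Analysis.Winding_Numbers"
begin

definition dpath :: "'e set \<Rightarrow> ('e \<Rightarrow> 'v) \<Rightarrow> ('e \<Rightarrow> 'v) \<Rightarrow> 'e list \<Rightarrow> bool" where
  "dpath E src tgt p \<longleftrightarrow> p \<noteq> [] \<and> set p \<subseteq> E \<and>
     (\<forall>i. Suc i < length p \<longrightarrow> tgt (p ! i) = src (p ! Suc i))"

definition acyclic_dg :: "'e set \<Rightarrow> ('e \<Rightarrow> 'v) \<Rightarrow> ('e \<Rightarrow> 'v) \<Rightarrow> bool" where
  "acyclic_dg E src tgt \<longleftrightarrow> \<not> (\<exists>p. dpath E src tgt p \<and> tgt (last p) = src (hd p))"

definition is_source :: "'v set \<Rightarrow> 'e set \<Rightarrow> ('e \<Rightarrow> 'v) \<Rightarrow> 'v \<Rightarrow> bool" where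
  "is_source V E tgt v \<longleftrightarrow> v \<in> V \<and> \<not> (\<exists>e\<in>E. tgt e = v)"

definition is_sink :: "'v set \<Rightarrow> 'e set \<Rightarrow> ('e \<Rightarrow> 'v) \<Rightarrow> 'v \<Rightarrow> bool" where
  "is_sink V E src v \<longleftrightarrow> v \<in> V \<and> \<not> (\<exists>e\<in>E. src e = v)"

definition the_source :: "'v set \<Rightarrow> 'e set \<Rightarrow> ('e \<Rightarrow> 'v) \<Rightarrow> 'v" where
  "the_source V E tgt = (THE v. is_source V E tgt v)"

definition the_sink :: "'v set \<Rightarrow> 'e set \<Rightarrow> ('e \<Rightarrow> 'v) \<Rightarrow> 'v" where
  "the_sink V E src = (THE v. is_sink V E src v)"

definition bipolar :: "'v set \<Rightarrow> 'e set \<Rightarrow> ('e \<Rightarrow> 'v) \<Rightarrow> ('e \<Rightarrow> 'v) \<Rightarrow> bool" where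
  "bipolar V E src tgt \<longleftrightarrow> finite V \<and> finite E \<and>
     (\<forall>e\<in>E. src e \<in> V \<and> tgt e \<in> V) \<and> acyclic_dg E src tgt \<and> card V \<ge> 2 \<and>
     (\<exists>!v. is_source V E tgt v) \<and> (\<exists>!v. is_sink V E src v)"

text \<open>A maximal directed path: it cannot be extended at either end
  (in an acyclic digraph, a path can be extended iff its first vertex has an
  incoming edge or its last vertex has an outgoing edge).\<close>

definition max_dpath :: "'e set \<Rightarrow> ('e \<Rightarrow> 'v) \<Rightarrow> ('e \<Rightarrow> 'v) \<Rightarrow> 'e list \<Rightarrow> bool" where
  "max_dpath E src tgt p \<longleftrightarrow> dpath E src tgt p \<and>
     \<not> (\<exists>e\<in>E. tgt e = src (hd p)) \<and> \<not> (\<exists>e\<in>E. src e = tgt (last p))"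

definition Eff :: "(nat \<Rightarrow> 'e) \<Rightarrow> ('e \<Rightarrow> 'v) \<Rightarrow> ('e \<Rightarrow> 'v) \<Rightarrow> (nat \<Rightarrow> 'a::ab_group_add)
    \<Rightarrow> nat set \<Rightarrow> 'v \<Rightarrow> 'a" where
  "Eff \<phi> src tgt a X v =
     (\<Sum>i\<in>{i\<in>X. tgt (\<phi> i) = v}. a i) - (\<Sum>i\<in>{i\<in>X. src (\<phi> i) = v}. a i)"

definition Tr :: "'v set \<Rightarrow> 'e set \<Rightarrow> ('e \<Rightarrow> 'v) \<Rightarrow> ('e \<Rightarrow> 'v) \<Rightarrow> 'a::ab_group_add \<Rightarrow> 'v \<Rightarrow> 'a" where
  "Tr V E src tgt b v =
     (if v = the_source V E tgt then - b else if v = the_sink V E src then b else 0)"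

definition is_solution ::
  "'v set \<Rightarrow> 'e set \<Rightarrow> ('e \<Rightarrow> 'v) \<Rightarrow> ('e \<Rightarrow> 'v) \<Rightarrow>
   'f set \<Rightarrow> ('f \<Rightarrow> 'w) \<Rightarrow> ('f \<Rightarrow> 'w) \<Rightarrow>
   (nat \<Rightarrow> 'e) \<Rightarrow> (nat \<Rightarrow> 'f) \<Rightarrow> nat \<Rightarrow> 'a::ab_group_add \<Rightarrow> (nat \<Rightarrow> 'a) \<Rightarrow> bool" where
  "is_solution VG EG srcG tgtG EH srcH tgtH \<phi> \<psi> n b a \<longleftrightarrow>
     (\<forall>p. max_dpath EH srcH tgtH p \<longrightarrow>
        (\<forall>v\<in>VG. Eff \<phi> srcG tgtG a {j\<in>{1..n}. \<psi> j \<in> set p} v = Tr VG EG srcG tgtG b v))"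

definition ptail :: "('e \<Rightarrow> real \<Rightarrow> complex) \<Rightarrow> 'e \<Rightarrow> complex" where
  "ptail c e = pathstart (c e)"

definition phead :: "('e \<Rightarrow> real \<Rightarrow> complex) \<Rightarrow> 'e \<Rightarrow> complex" where
  "phead c e = pathfinish (c e)"

definition drawing :: "complex set \<Rightarrow> 'e set \<Rightarrow> ('e \<Rightarrow> real \<Rightarrow> complex) \<Rightarrow> complex set" where
  "drawing V E c = V \<union> (\<Union>e\<in>E. path_image (c e))"

definition plane_graph :: "complex set \<Rightarrow> 'e set \<Rightarrow> ('e \<Rightarrow> real \<Rightarrow> complex) \<Rightarrow> bool" where
  "plane_graph V E c \<longleftrightarrow> finite V \<and> finite E \<and>
     (\<forall>e\<in>E. arc (c e) \<and> pathstart (c e) \<in> V \<and> pathfinish (c e) \<in> V) \<and>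
     (\<forall>e\<in>E. \<forall>v\<in>V. v \<in> path_image (c e) \<longrightarrow> v = pathstart (c e) \<or> v = pathfinish (c e)) \<and>
     (\<forall>e\<in>E. \<forall>e'\<in>E. e \<noteq> e' \<longrightarrow>
        path_image (c e) \<inter> path_image (c e') \<subseteq>
          {pathstart (c e), pathfinish (c e)} \<inter> {pathstart (c e'), pathfinish (c e')})"

definition upward_bipolar_plane :: "complex set \<Rightarrow> 'e set \<Rightarrow> ('e \<Rightarrow> real \<Rightarrow> complex) \<Rightarrow> bool" where
  "upward_bipolar_plane V E c \<longleftrightarrow> plane_graph V E c \<and> bipolar V E (ptail c) (phead c) \<and>
     the_source V E (phead c) \<in> frontier (outside (drawing V E c)) \<and>
     the_sink V E (ptail c) \<in> frontier (outside (drawing V E c))"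

text \<open>A curve in the unbounded region joining the source to the sink through the
  point at infinity: two disjoint proper rays, one starting at the source and one
  at the sink, both escaping to infinity and otherwise lying in the unbounded region.\<close>

definition escaping_ray :: "complex set \<Rightarrow> complex \<Rightarrow> (real \<Rightarrow> complex) \<Rightarrow> bool" where
  "escaping_ray U x \<gamma> \<longleftrightarrow> continuous_on {0..} \<gamma> \<and> inj_on \<gamma> {0..} \<and> \<gamma> 0 = x \<and>
     filterlim (\<lambda>r. norm (\<gamma> r)) at_top at_top \<and> \<gamma> ` {0<..} \<subseteq> U"

definition is_cut :: "complex set \<Rightarrow> 'e set \<Rightarrow> ('e \<Rightarrow> real \<Rightarrow> complex) \<Rightarrow>
    (real \<Rightarrow> complex) \<Rightarrow> (real \<Rightarrow> complex) \<Rightarrow> bool" where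
  "is_cut V E c \<gamma>1 \<gamma>2 \<longleftrightarrow>
     escaping_ray (outside (drawing V E c)) (the_source V E (phead c)) \<gamma>1 \<and>
     escaping_ray (outside (drawing V E c)) (the_sink V E (ptail c)) \<gamma>2 \<and>
     \<gamma>1 ` {0..} \<inter> \<gamma>2 ` {0..} = {}"

definition facets :: "complex set \<Rightarrow> 'e set \<Rightarrow> ('e \<Rightarrow> real \<Rightarrow> complex) \<Rightarrow>
    (real \<Rightarrow> complex) \<Rightarrow> (real \<Rightarrow> complex) \<Rightarrow> complex set set" where
  "facets V E c \<gamma>1 \<gamma>2 =
     {C \<in> components (- drawing V E c). bounded C} \<union>
     components (outside (drawing V E c) - (\<gamma>1 ` {0..} \<union> \<gamma>2 ` {0..}))"

text \<open>Side of an oriented arc g: facet F lies on side k of g (k = 1: left, k = -1: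
  right) if some sub-arc of g from g u to g w, closed up by an arc running back
  through F, forms a closed curve of winding number k (counterclockwise = +1).\<close>

definition on_side :: "(real \<Rightarrow> complex) \<Rightarrow> complex set \<Rightarrow> complex \<Rightarrow> bool" where
  "on_side g F k \<longleftrightarrow> (\<exists>u w \<beta>. 0 < u \<and> u < w \<and> w < 1 \<and> arc \<beta> \<and>
     pathstart \<beta> = g w \<and> pathfinish \<beta> = g u \<and> path_image \<beta> - {g u, g w} \<subseteq> F \<and>
     (\<exists>z. z \<notin> path_image (subpath u w g +++ \<beta>) \<and>
          winding_number (subpath u w g +++ \<beta>) z = k))"

text \<open>The dual graph: vertices are the facets; the dual edge e* (identified with
  the index e) goes from the facet to the left of e to the facet to the right.\<close>

definition dual_tail :: "complex set \<Rightarrow> 'e set \<Rightarrow> ('e \<Rightarrow> real \<Rightarrow> complex) \<Rightarrow>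
    (real \<Rightarrow> complex) \<Rightarrow> (real \<Rightarrow> complex) \<Rightarrow> 'e \<Rightarrow> complex set" where
  "dual_tail V E c \<gamma>1 \<gamma>2 e = (THE F. F \<in> facets V E c \<gamma>1 \<gamma>2 \<and> on_side (c e) F 1)"

definition dual_head :: "complex set \<Rightarrow> 'e set \<Rightarrow> ('e \<Rightarrow> real \<Rightarrow> complex) \<Rightarrow>
    (real \<Rightarrow> complex) \<Rightarrow> (real \<Rightarrow> complex) \<Rightarrow> 'e \<Rightarrow> complex set" where
  "dual_head V E c \<gamma>1 \<gamma>2 e = (THE F. F \<in> facets V E c \<gamma>1 \<gamma>2 \<and> on_side (c e) F (-1))"

end

(*
  Both problems are equivalent to one self-dual condition: for every source-sink path X of H and
  every source-sink path Y of the dual of G, the entries a_i with e'_i in X and e*_i in Y sum to b.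
  In one direction, Y crosses every source-sink path of G exactly once, so it is a directed cut of G
  and a flow of value b in G sums to b along it.  Conversely the star of a vertex of G is an
  integer combination of source-sink paths of the dual, with coefficient sum 1, -1 or 0.

  For this one needs that the boundary of every facet is an integer combination of source-sink paths.
  Together with the two cutting rays, a path X is a line with a left and a right side; it is the
  cut between the facets on its two sides.  Every integer function on the edges agrees off a
  tree T (one incoming edge for each inner vertex) with a combination of paths.  Applied to the
  jumps of the indicator of a facet, the difference of that indicator and the combination of the
  left sides jumps only across T.  As T and the rays do not separate the plane, it is constant.

  Topologically, the plane is inverted at a point of a facet.  The rays become an arc through 0, the
  lines become Jordan curves, and Janiszewski's theorem gives that exactly two facets, one on
  each side, touch an edge.
*)
theory Submission
  imports Defs "HOL-Real_Asymp.Real_Asymp"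
begin

subsection \<open>Paths in bipolar digraphs\<close>

text \<open>The dual graph is not assumed to be bipolar, nor is its dual identified with the given
  graph. The topology yields only the facts about sides and jumps collected in
  \<open>dual_pair\<close>; acyclicity of the dual and uniqueness of its source and sink are deduced
  from them. Likewise, expanding a vertex star into dual paths takes no second topological argument:
  the star of a vertex pairs to zero with the stars of inner facets, so it is a flow in the dual,
  and every integer flow in a bipolar digraph is a combination of paths. Coefficients must be
  integers because the solution lives in an arbitrary Abelian group. The delicate point is
  orientation. The side of an edge is defined by the winding number of a small closed curve, whereas
  the side of a path comes from a Jordan curve in the inverted plane that may enclose either of its
  sides. The two are compared through the jump of a winding number across the edge, which does not
  depend on which side is bounded. Inversion respects such jumps, since it changes the winding
  number of a path by a term that does not depend on the point.\<close>

lemma dpath_Cons: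
  "dpath E src tgt (e # p) \<longleftrightarrow>
     e \<in> E \<and> (p = [] \<or> dpath E src tgt p \<and> tgt e = src (hd p))"
proof (cases p)
  case (Cons a q)
  have "(\<forall>i. Suc i < length (e # p) \<longrightarrow> tgt ((e # p) ! i) = src ((e # p) ! Suc i)) \<longleftrightarrow>
    tgt e = src (hd p) \<and> (\<forall>i. Suc i < length p \<longrightarrow> tgt (p ! i) = src (p ! Suc i))"
    (is "?l \<longleftrightarrow> ?r")
  proof
    assume l: ?l
    have "tgt e = src (hd p)" using l[rule_format, of 0] by (simp add: Cons)
    moreover have "tgt (p ! i) = src (p ! Suc i)" if "Suc i < length p" for i
      using l[rule_format, of "Suc i"] that by simp
    ultimately show ?r by blast
  next
    assume r: ?r
    show ?l
    proof (intro allI impI)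
      fix i assume "Suc i < length (e # p)"
      then show "tgt ((e # p) ! i) = src ((e # p) ! Suc i)"
        using r by (cases i) (auto simp: Cons)
    qed
  qed
  then show ?thesis by (auto simp: dpath_def Cons)
qed (simp add: dpath_def)

lemma dpath_append:
  assumes "p \<noteq> []" "q \<noteq> []"
  shows "dpath E src tgt (p @ q) \<longleftrightarrow>
    dpath E src tgt p \<and> dpath E src tgt q \<and> tgt (last p) = src (hd q)"
  using assms
proof (induction p)
  case (Cons e p)
  show ?case
  proof (cases "p = []")
    case False
    then have "hd (p @ q) = hd p" by simp
    then show ?thesis using Cons False by (auto simp: dpath_Cons)
  qed (use Cons in \<open>auto simp: dpath_Cons\<close>)
qed simp

lemma dpath_subset: "dpath E src tgt p \<Longrightarrow> set p \<subseteq> E"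
  by (simp add: dpath_def)

lemma dpath_nonempty: "dpath E src tgt p \<Longrightarrow> p \<noteq> []"
  by (simp add: dpath_def)

lemma dpath_comp_inj:
  assumes "inj_on f V" "\<forall>e\<in>E. src e \<in> V \<and> tgt e \<in> V"
  shows "dpath E (\<lambda>e. f (src e)) (\<lambda>e. f (tgt e)) p \<longleftrightarrow> dpath E src tgt p"
proof -
  have "f (tgt (p ! i)) = f (src (p ! Suc i)) \<longleftrightarrow> tgt (p ! i) = src (p ! Suc i)"
    if "set p \<subseteq> E" "Suc i < length p" for i
  proof -
    have "p ! i \<in> E" "p ! Suc i \<in> E" using that by (auto simp: subset_iff)
    then show ?thesis using assms by (auto simp: inj_on_eq_iff)
  qed
  then show ?thesis by (auto simp: dpath_def)
qed

locale bipolar_digraph =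
  fixes V :: "'v set" and E :: "'e set" and src tgt :: "'e \<Rightarrow> 'v"
  assumes bipolar: "bipolar V E src tgt"
begin

abbreviation "source \<equiv> the_source V E tgt"
abbreviation "sink \<equiv> the_sink V E src"
abbreviation "walk \<equiv> dpath E src tgt"
abbreviation "stpath \<equiv> max_dpath E src tgt"

lemma finite_V [simp]: "finite V" and finite_E [simp]: "finite E"
  and src_in [simp]: "e \<in> E \<Longrightarrow> src e \<in> V" and tgt_in [simp]: "e \<in> E \<Longrightarrow> tgt e \<in> V"
  using bipolar by (auto simp: bipolar_def)

lemma source_iff: "v \<in> V \<Longrightarrow> (\<exists>e\<in>E. tgt e = v) \<longleftrightarrow> v \<noteq> source"
  and source_in [simp]: "source \<in> V"
proof -
  have ex: "\<exists>!v. is_source V E tgt v" using bipolar by (simp add: bipolar_def)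
  then have *: "is_source V E tgt source" unfolding the_source_def by (rule theI')
  then show "source \<in> V" by (simp add: is_source_def)
  show "v \<in> V \<Longrightarrow> (\<exists>e\<in>E. tgt e = v) \<longleftrightarrow> v \<noteq> source"
    using * ex by (metis is_source_def)
qed

lemma sink_iff: "v \<in> V \<Longrightarrow> (\<exists>e\<in>E. src e = v) \<longleftrightarrow> v \<noteq> sink"
  and sink_in [simp]: "sink \<in> V"
proof -
  have ex: "\<exists>!v. is_sink V E src v" using bipolar by (simp add: bipolar_def)
  then have *: "is_sink V E src sink" unfolding the_sink_def by (rule theI')
  then show "sink \<in> V" by (simp add: is_sink_def)
  show "v \<in> V \<Longrightarrow> (\<exists>e\<in>E. src e = v) \<longleftrightarrow> v \<noteq> sink"
    using * ex by (metis is_sink_def)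
qed

lemma tgt_neq_source [simp]: "e \<in> E \<Longrightarrow> tgt e \<noteq> source"
  using source_iff tgt_in by blast

lemma src_neq_sink [simp]: "e \<in> E \<Longrightarrow> src e \<noteq> sink"
  using sink_iff src_in by blast

abbreviation "arcs \<equiv> (\<lambda>e. (src e, tgt e)) ` E"

lemma trancl_arcs_walk:
  "(u, v) \<in> arcs\<^sup>+ \<Longrightarrow> \<exists>p. walk p \<and> src (hd p) = u \<and> tgt (last p) = v"
proof (induction rule: trancl_induct)
  case (base y)
  then obtain e where "e \<in> E" "src e = u" "tgt e = y" by auto
  then show ?case by (intro exI[of _ "[e]"]) (auto simp: dpath_Cons)
next
  case (step y z)
  then obtain p e where "walk p" "src (hd p) = u" "tgt (last p) = y"
    "e \<in> E" "src e = y" "tgt e = z" by auto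
  then show ?case
    by (intro exI[of _ "p @ [e]"]) (auto simp: dpath_append dpath_Cons dpath_nonempty)
qed

lemma acyclic_arcs: "acyclic arcs"
proof -
  have "acyclic_dg E src tgt" using bipolar by (simp add: bipolar_def)
  then show ?thesis
    unfolding acyclic_def acyclic_dg_def using trancl_arcs_walk by metis
qed

text \<open>Counts proper ancestors. It is a topological ranking of the vertices and the induction
  measure for all arguments along or against the edges.\<close>

definition level :: "'v \<Rightarrow> nat" where
  "level v = card {u. (u, v) \<in> arcs\<^sup>+}"

text \<open>Ancestors of the tail are ancestors of the head, and the tail itself is one more: by
  acyclicity it is not its own ancestor.\<close>

lemma level_less [simp]: "e \<in> E \<Longrightarrow> level (src e) < level (tgt e)"
proof -
  assume e: "e \<in> E"
  have "{u. (u, tgt e) \<in> arcs\<^sup>+} \<subseteq> fst ` arcs"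
    using trancl_domain[of arcs] by (force simp: Domain_fst)
  then have "finite {u. (u, tgt e) \<in> arcs\<^sup>+}" by (rule finite_subset) simp
  moreover have "(src e, tgt e) \<in> arcs" using e by simp
  then have "(src e, tgt e) \<in> arcs\<^sup>+" "(src e, src e) \<notin> arcs\<^sup>+"
    using acyclic_arcs unfolding acyclic_def by blast+
  then have "{u. (u, src e) \<in> arcs\<^sup>+} \<subset> {u. (u, tgt e) \<in> arcs\<^sup>+}"
    using trancl_trans[of _ "src e" arcs "tgt e"] by blast
  ultimately show ?thesis unfolding level_def by (rule psubset_card_mono)
qed

text \<open>Otherwise every vertex except the source has an outgoing edge, and its head is again not
  the source. Following such edges raises the level without bound in a finite graph.\<close>

lemma source_neq_sink [simp]: "source \<noteq> sink"
proof
  assume eq: "source = sink"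
  have "\<exists>v\<in>V. v \<noteq> source"
  proof (rule ccontr)
    assume "\<not> ?thesis"
    then have "V \<subseteq> {source}" by auto
    then have "card V \<le> card {source}" by (intro card_mono) auto
    then show False using bipolar by (simp add: bipolar_def)
  qed
  then obtain v where v: "v \<in> V" "v \<noteq> source" by blast
  have "\<exists>u\<in>V. u \<noteq> source \<and> level u > n" for n
  proof (induction n)
    case 0
    then obtain e where "e \<in> E" "tgt e = v" using v source_iff by blast
    then show ?case using v level_less[of e] by (intro bexI[of _ v]) auto
  next
    case (Suc n)
    then obtain u where u: "u \<in> V" "u \<noteq> source" "level u > n" by blast
    then obtain e where "e \<in> E" "src e = u" using sink_iff eq by metis
    then show ?case using u level_less[of e] by (intro bexI[of _ "tgt e"]) auto
  qed
  then obtain u where "u \<in> V" "level u > Max (level ` V)" by blast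
  moreover have "level u \<le> Max (level ` V)" using \<open>u \<in> V\<close> by (intro Max_ge) auto
  ultimately show False by simp
qed

lemma sink_neq_source [simp]: "sink \<noteq> source"
  using source_neq_sink by metis

lemma walk_level: "walk p \<Longrightarrow> e \<in> set p \<Longrightarrow>
    level (src (hd p)) \<le> level (src e) \<and> level (tgt e) \<le> level (tgt (last p))"
proof (induction p arbitrary: e)
  case (Cons a p)
  then have a: "a \<in> E" by (simp add: dpath_Cons)
  show ?case
  proof (cases "p = []")
    case False
    then have p: "walk p" "tgt a = src (hd p)" using Cons by (auto simp: dpath_Cons)
    have "level (src (hd p)) \<le> level (src (hd p)) \<and> level (tgt (hd p)) \<le> level (tgt (last p))"
      using Cons.IH[OF p(1), of "hd p"] False by simp
    moreover have "level (src (hd p)) < level (tgt (hd p))"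
      using p dpath_subset False by (intro level_less) fastforce
    moreover have "level (src a) < level (src (hd p))" using level_less[OF a] p by simp
    moreover have "e = a \<or> e \<in> set p" using Cons.prems by auto
    ultimately show ?thesis using Cons.IH[OF p(1), of e] p(2) False by auto
  qed (use Cons in auto)
qed simp

lemma walk_distinct: "walk p \<Longrightarrow> distinct p"
proof (induction p)
  case (Cons a p)
  then have "a \<in> E" "p = [] \<or> walk p \<and> tgt a = src (hd p)" by (auto simp: dpath_Cons)
  moreover have "level (src a) < level (tgt a)" using \<open>a \<in> E\<close> by (rule level_less)
  ultimately have "a \<notin> set p" using walk_level[of p a] by (metis leD empty_iff list.set(1))
  then show ?case using Cons by (auto simp: dpath_Cons)
qed simp

lemma walk_from_source:
  "v \<in> V \<Longrightarrow> v \<noteq> source \<Longrightarrow> \<exists>p. walk p \<and> src (hd p) = source \<and> tgt (last p) = v"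
proof (induction "level v" arbitrary: v rule: less_induct)
  case less
  then obtain e where e: "e \<in> E" "tgt e = v" using source_iff by blast
  show ?case
  proof (cases "src e = source")
    case True
    then show ?thesis using e by (intro exI[of _ "[e]"]) (simp add: dpath_Cons)
  next
    case False
    then obtain p where "walk p" "src (hd p) = source" "tgt (last p) = src e"
      using less.hyps[of "src e"] e by auto
    then show ?thesis using e
      by (intro exI[of _ "p @ [e]"]) (auto simp: dpath_append dpath_Cons dpath_nonempty)
  qed
qed

lemma walk_to_sink:
  "v \<in> V \<Longrightarrow> v \<noteq> sink \<Longrightarrow> \<exists>p. walk p \<and> src (hd p) = v \<and> tgt (last p) = sink"
proof (induction "Max (level ` V) - level v" arbitrary: v rule: less_induct)
  case less
  then obtain e where e: "e \<in> E" "src e = v" using sink_iff by blast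
  have "level (tgt e) \<le> Max (level ` V)" using e by (intro Max_ge) auto
  moreover have "level v < level (tgt e)" using level_less[OF e(1)] e(2) by simp
  ultimately have lt: "Max (level ` V) - level (tgt e) < Max (level ` V) - level v"
    by linarith
  show ?case
  proof (cases "tgt e = sink")
    case True
    then show ?thesis using e by (intro exI[of _ "[e]"]) (simp add: dpath_Cons)
  next
    case False
    then obtain p where "walk p" "src (hd p) = tgt e" "tgt (last p) = sink"
      using less.hyps[OF lt] e by auto
    then show ?thesis using e
      by (intro exI[of _ "e # p"]) (auto simp: dpath_Cons dpath_nonempty)
  qed
qed

lemma stpath_iff: "stpath p \<longleftrightarrow> walk p \<and> src (hd p) = source \<and> tgt (last p) = sink"
proof -
  have "src (hd p) \<in> V" "tgt (last p) \<in> V" if "walk p"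
    using that dpath_subset[OF that] dpath_nonempty[OF that] by (auto simp: subset_iff)
  then show ?thesis using source_iff sink_iff unfolding max_dpath_def by blast
qed

lemma walk_extend_right:
  assumes "walk p" obtains q where "walk (p @ q)" "tgt (last (p @ q)) = sink"
proof (cases "tgt (last p) = sink")
  case False
  have "tgt (last p) \<in> V"
    using dpath_subset[OF assms] dpath_nonempty[OF assms] by (auto simp: subset_iff)
  then obtain q where "walk q" "src (hd q) = tgt (last p)" "tgt (last q) = sink"
    using walk_to_sink False by blast
  then show ?thesis
    using that[of q] assms by (auto simp: dpath_append dpath_nonempty)
qed (use that[of "[]"] assms in auto)

lemma walk_extend_left:
  assumes "walk p" obtains q where "walk (q @ p)" "src (hd (q @ p)) = source"
proof (cases "src (hd p) = source")
  case False
  have "src (hd p) \<in> V"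
    using dpath_subset[OF assms] dpath_nonempty[OF assms] by (auto simp: subset_iff)
  then obtain q where "walk q" "src (hd q) = source" "tgt (last q) = src (hd p)"
    using walk_from_source False by blast
  then show ?thesis
    using that[of q] assms by (auto simp: dpath_append dpath_nonempty)
qed (use that[of "[]"] assms in auto)

lemma walk_in_stpath:
  assumes "walk p" obtains q r where "stpath (q @ p @ r)"
proof -
  obtain r where r: "walk (p @ r)" "tgt (last (p @ r)) = sink"
    using walk_extend_right[OF assms] .
  obtain q where q: "walk (q @ p @ r)" "src (hd (q @ p @ r)) = source"
    using walk_extend_left[OF r(1)] .
  have "stpath (q @ p @ r)"
    using r q dpath_nonempty[OF assms] by (auto simp: stpath_iff)
  then show ?thesis by (rule that)
qed

lemma edge_in_stpath:
  assumes "e \<in> E" obtains p where "stpath p" "e \<in> set p"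
proof -
  have "walk [e]" using assms by (simp add: dpath_Cons)
  then obtain q r where "stpath (q @ [e] @ r)" by (rule walk_in_stpath)
  then show ?thesis using that by force
qed

end

subsection \<open>Path combinations and flows\<close>

text \<open>The integer multiple \<open>k x\<close> in an Abelian group. One of the two sums is
  empty, depending on the sign of \<open>k\<close>.\<close>

definition zmul :: "int \<Rightarrow> 'a::ab_group_add \<Rightarrow> 'a" where
  "zmul k x = (\<Sum>i<nat k. x) - (\<Sum>i<nat (- k). x)"

lemma zmul_diff_nat: "zmul (int m - int n) x = (\<Sum>i<m. x) - (\<Sum>i<n. x)"
proof -
  have add: "(\<Sum>i<k + l. x) = (\<Sum>i<k. x) + (\<Sum>i<l. x)" for k l :: nat
    by (induction l) (simp_all add: add.assoc)
  show ?thesis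
  proof (cases "m \<le> n")
    case True
    then obtain d where "n = m + d" using le_Suc_ex by blast
    then show ?thesis by (simp add: zmul_def add)
  next
    case False
    then obtain d where "m = n + d" by (metis le_Suc_ex linear)
    then show ?thesis by (simp add: zmul_def add)
  qed
qed

lemma zmul_add: "zmul (j + k) x = zmul j x + zmul k x"
proof -
  obtain a b where "j = int a - int b" by (metis int_diff_cases)
  moreover obtain c d where "k = int c - int d" by (metis int_diff_cases)
  moreover have "(\<Sum>i<k + l. x) = (\<Sum>i<k. x) + (\<Sum>i<l. x)" for k l :: nat
    by (induction l) (simp_all add: add.assoc)
  moreover have "int a - int b + (int c - int d) = int (a + c) - int (b + d)" by simp
  ultimately show ?thesis by (simp only: zmul_diff_nat) simp
qed

lemma zmul_simps [simp]: "zmul 0 x = 0" "zmul 1 x = x" "zmul (-1) x = - x"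
  by (simp_all add: zmul_def)

lemma zmul_diff: "zmul (j - k) x = zmul j x - zmul k x"
  using zmul_add[of "j - k" k x] by (simp add: algebra_simps)

lemma zmul_of_bool: "zmul (of_bool P) x = (if P then x else 0)"
  by simp

context bipolar_digraph begin

definition net :: "('e \<Rightarrow> 'a::ab_group_add) \<Rightarrow> 'v \<Rightarrow> 'a" where
  "net m v = (\<Sum>e\<in>{e\<in>E. tgt e = v}. m e) - (\<Sum>e\<in>{e\<in>E. src e = v}. m e)"

lemma net_alt: "net m v = (\<Sum>e\<in>E. (if tgt e = v then m e else 0) - (if src e = v then m e else 0))"
  unfolding net_def by (simp add: sum_subtractf sum.inter_filter)

text \<open>Outgoing edges count positively, opposite to \<open>net\<close>. With this sign the star
  of the source becomes a combination of dual paths with coefficient sum 1.\<close>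

definition star :: "'v \<Rightarrow> 'e \<Rightarrow> int" where
  "star v e = of_bool (src e = v) - of_bool (tgt e = v)"

lemma net_star: "net m v = - (\<Sum>e\<in>E. zmul (star v e) (m e))"
  unfolding net_alt star_def zmul_diff zmul_of_bool sum_negf[symmetric] by simp

lemma net_int: "net z v = - (\<Sum>e\<in>E. star v e * z e)" for z :: "'e \<Rightarrow> int"
  unfolding net_alt star_def sum_negf[symmetric] by (intro sum.cong) (auto simp: algebra_simps)

text \<open>Integer combinations of indicator functions of source-sink paths. The second argument
  records the sum of the coefficients, which is what multiplies \<open>b\<close> when every path has
  weight \<open>b\<close>.\<close>

inductive path_span :: "('e \<Rightarrow> int) \<Rightarrow> int \<Rightarrow> bool" where
  zero: "path_span (\<lambda>e. 0) 0"
| add: "path_span z k \<Longrightarrow> stpath p \<Longrightarrow> path_span (\<lambda>e. z e + of_bool (e \<in> set p)) (k + 1)"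
| sub: "path_span z k \<Longrightarrow> stpath p \<Longrightarrow> path_span (\<lambda>e. z e - of_bool (e \<in> set p)) (k - 1)"

lemma path_span_add_multiple:
  assumes "path_span z k" "stpath p"
  shows "path_span (\<lambda>e. z e + j * of_bool (e \<in> set p)) (k + j)"
proof (induction j rule: int_induct[where k = 0])
  case base
  then show ?case using assms by simp
next
  case (step1 i)
  from path_span.add[OF step1(2) assms(2)] show ?case by (simp add: algebra_simps)
next
  case (step2 i)
  from path_span.sub[OF step2(2) assms(2)] show ?case by (simp add: algebra_simps)
qed

lemma path_span_eval:
  fixes m :: "'e \<Rightarrow> 'a::ab_group_add"
  assumes "path_span z k" "\<And>p. stpath p \<Longrightarrow> (\<Sum>e\<in>set p. m e) = b"
  shows "(\<Sum>e\<in>E. zmul (z e) (m e)) = zmul k b"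
proof -
  have path: "(\<Sum>e\<in>E. if e \<in> set p then m e else 0) = b" if "stpath p" for p
  proof -
    have "E \<inter> set p = set p" using that by (auto simp: max_dpath_def dpath_def)
    then show ?thesis using assms(2)[OF that] by (simp add: sum.inter_restrict[symmetric])
  qed
  show ?thesis using assms(1)
    by induction (simp_all only: zmul_add zmul_diff zmul_of_bool zmul_simps sum.distrib sum_subtractf path sum.neutral_const)
qed

lemma walk_telescope:
  fixes v :: 'v
  shows "walk p \<Longrightarrow> (\<Sum>e\<in>set p. star v e) = of_bool (src (hd p) = v) - of_bool (tgt (last p) = v)"
proof (induction p)
  case (Cons e p)
  show ?case
  proof (cases "p = []")
    case False
    then have "walk p" "tgt e = src (hd p)" "e \<notin> set p"
      using Cons.prems walk_distinct[OF Cons.prems] by (auto simp: dpath_Cons)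
    then show ?thesis using Cons.IH False by (simp add: star_def)
  qed (simp add: star_def)
qed (simp add: dpath_def)

text \<open>A path leaves an inner vertex as often as it enters it, so only its two ends contribute,
  once for each unit of the coefficient sum.\<close>

lemma path_span_star:
  assumes "path_span z k"
  shows "(\<Sum>e\<in>E. star v e * z e) = k * (of_bool (v = source) - of_bool (v = sink))"
proof -
  have path: "(\<Sum>e\<in>E. star v e * of_bool (e \<in> set p)) = of_bool (v = source) - of_bool (v = sink)"
    if "stpath p" for p
  proof -
    have "E \<inter> set p = set p" using that by (auto simp: max_dpath_def dpath_def)
    then have "(\<Sum>e\<in>E. star v e * of_bool (e \<in> set p)) = (\<Sum>e\<in>set p. star v e)"
      by (simp add: of_bool_def if_distrib sum.inter_restrict[symmetric] cong: if_cong)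
    then show ?thesis using walk_telescope[of p v] that stpath_iff by (simp add: eq_commute)
  qed
  show ?thesis using assms
  proof induction
    case (add z k p)
    then show ?case using path[OF add(2)]
      by (simp only: distrib_left distrib_right sum.distrib mult_1)
  next
    case (sub z k p)
    then show ?case using path[OF sub(2)]
      by (simp only: right_diff_distrib left_diff_distrib sum_subtractf mult_1)
  qed simp
qed

text \<open>Following the chosen edges backwards lowers the level and so ends at the source: they
  form a tree rooted there that spans everything but the sink.\<close>

definition tree :: "('v \<Rightarrow> 'e) \<Rightarrow> bool" where
  "tree pred \<longleftrightarrow> (\<forall>v \<in> V - {source, sink}. pred v \<in> E \<and> tgt (pred v) = v)"

abbreviation "tree_edges pred \<equiv> pred ` (V - {source, sink})"

lemma tree_exists: "\<exists>pred. tree pred"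
proof -
  have "\<forall>v\<in>V - {source, sink}. \<exists>e. e \<in> E \<and> tgt e = v" using source_iff by blast
  then show ?thesis unfolding tree_def by (rule bchoice)
qed

lemma tree_walk:
  assumes "tree pred"
  shows "v \<in> V \<Longrightarrow> v \<noteq> sink \<Longrightarrow> v \<noteq> source \<Longrightarrow>
    \<exists>p. walk p \<and> src (hd p) = source \<and> tgt (last p) = v \<and> set p \<subseteq> tree_edges pred"
proof (induction "level v" arbitrary: v rule: less_induct)
  case less
  then have v: "pred v \<in> E" "tgt (pred v) = v" "pred v \<in> tree_edges pred"
    using assms by (auto simp: tree_def)
  show ?case
  proof (cases "src (pred v) = source")
    case True
    then show ?thesis using v by (intro exI[of _ "[pred v]"]) (simp add: dpath_Cons)
  next
    case False
    have "level (src (pred v)) < level v" using level_less[OF v(1)] v(2) by simp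
    then obtain p where p: "walk p" "src (hd p) = source" "tgt (last p) = src (pred v)"
      "set p \<subseteq> tree_edges pred"
      using less.hyps[of "src (pred v)"] v False by auto
    then have "walk (p @ [pred v])" using v dpath_nonempty[OF p(1)] by (simp add: dpath_append dpath_Cons)
    then show ?thesis using v p dpath_nonempty[OF p(1)]
      by (intro exI[of _ "p @ [pred v]"]) simp
  qed
qed

text \<open>Go to the tail of \<open>e\<close> inside the tree, take \<open>e\<close>, and continue
  arbitrarily: all later edges have heads of higher level. This makes the elimination of off-tree
  edges triangular.\<close>

lemma tree_stpath:
  assumes "tree pred" "e \<in> E"
  shows "\<exists>p. stpath p \<and> e \<in> set p \<and>
    (\<forall>f\<in>set p. f \<in> tree_edges pred \<or> f = e \<or> level (tgt e) < level (tgt f))"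
proof -
  have "\<exists>q. set q \<subseteq> tree_edges pred \<and> walk (q @ [e]) \<and> src (hd (q @ [e])) = source"
  proof (cases "src e = source")
    case True
    then show ?thesis using assms by (intro exI[of _ "[]"]) (simp add: dpath_Cons)
  next
    case False
    then obtain q where "walk q" "src (hd q) = source" "tgt (last q) = src e" "set q \<subseteq> tree_edges pred"
      using tree_walk[OF assms(1), of "src e"] assms(2) by auto
    then show ?thesis using assms(2) dpath_nonempty[of E src tgt q]
      by (intro exI[of _ q]) (simp add: dpath_append dpath_Cons)
  qed
  then obtain q where q: "set q \<subseteq> tree_edges pred" "walk (q @ [e])" "src (hd (q @ [e])) = source"
    by blast
  obtain r where r: "walk ((q @ [e]) @ r)" "tgt (last ((q @ [e]) @ r)) = sink"
    using walk_extend_right[OF q(2)] .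
  have "level (tgt e) < level (tgt f)" if f: "f \<in> set r" for f
  proof -
    have "r \<noteq> []" using f by auto
    then have "walk r" "tgt e = src (hd r)"
      using r(1) dpath_append[of "q @ [e]" r E src tgt] by (auto simp del: append_assoc)
    then have "level (tgt e) \<le> level (src f)" "f \<in> E"
      using walk_level[OF _ f] dpath_subset[of E src tgt r] f by auto
    then show ?thesis using level_less by (meson le_less_trans)
  qed
  moreover have "src (hd ((q @ [e]) @ r)) = source" using q(3) by (cases q) auto
  ultimately show ?thesis using q(1) r stpath_iff
    by (intro exI[of _ "(q @ [e]) @ r"]) auto
qed

text \<open>The off-tree edges are treated in order of increasing level of the head. The path of
  \<open>tree_stpath\<close> through the new edge \<open>e\<close> contains no other off-tree edge
  treated so far, so a multiple of it corrects the value at \<open>e\<close> and leaves the earlier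
  values alone.\<close>

lemma eliminate_off_tree:
  assumes "tree pred"
  shows "\<exists>z' k. path_span z' k \<and> (\<forall>e\<in>E - tree_edges pred. z e = z' e)"
proof -
  have "\<exists>z' k. path_span z' k \<and> (\<forall>e\<in>S. z e = z' e)" if "finite S" "S \<subseteq> E - tree_edges pred" for S
    using that
  proof (induction S rule: finite_ranking_induct[where f = "\<lambda>e. level (tgt e)"])
    case empty
    then show ?case using path_span.zero by auto
  next
    case (insert e S)
    then obtain z' k where z': "path_span z' k" "\<forall>e\<in>S. z e = z' e" by blast
    have e: "e \<in> E - tree_edges pred" using insert by simp
    then obtain p where p: "stpath p" "e \<in> set p"
      "\<forall>f\<in>set p. f \<in> tree_edges pred \<or> f = e \<or> level (tgt e) < level (tgt f)"
      using tree_stpath[OF assms] by blast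
    define w where "w f = z' f + (z e - z' e) * of_bool (f \<in> set p)" for f
    have "z f = w f" if f: "f \<in> insert e S" for f
    proof (cases "f = e")
      case False
      then have "f \<in> S" using f by simp
      then have "f \<notin> tree_edges pred" "level (tgt f) \<le> level (tgt e)" using insert by auto
      then have "f \<notin> set p" using p(3) False by fastforce
      then show ?thesis using z'(2) \<open>f \<in> S\<close> by (simp add: w_def)
    qed (simp add: w_def p)
    moreover have "path_span w (k + (z e - z' e))"
      unfolding w_def by (rule path_span_add_multiple[OF z'(1) p(1)])
    ultimately show ?case by blast
  qed
  then show ?thesis by simp
qed

text \<open>Subtracting a combination that agrees with \<open>z\<close> off a tree leaves a flow
  \<open>w\<close> supported on the tree. From the highest level downwards, the outgoing edges of
  \<open>v\<close> carry nothing and only \<open>pred v\<close> can enter with a nonzero value, so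
  conservation makes that value vanish too.\<close>

lemma flow_decomposition:
  assumes "\<And>v. v \<in> V - {source, sink} \<Longrightarrow> net z v = (0::int)"
  shows "\<exists>z' k. path_span z' k \<and> (\<forall>e\<in>E. z e = z' e)"
proof -
  obtain pred where pred: "tree pred" using tree_exists by blast
  obtain z' k where z': "path_span z' k" "\<forall>e\<in>E - tree_edges pred. z e = z' e"
    using eliminate_off_tree[OF pred] by blast
  define w where "w e = z e - z' e" for e
  have net0: "net w v = 0" if "v \<in> V - {source, sink}" for v
  proof -
    have "net w v = net z v - net z' v" unfolding w_def net_int by (simp add: algebra_simps sum_subtractf)
    then show ?thesis using assms[OF that] that path_span_star[OF z'(1), of v] by (simp add: net_int)
  qed
  have "w (pred v) = 0" if "v \<in> V - {source, sink}" for v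
    using that
  proof (induction "Max (level ` V) - level v" arbitrary: v rule: less_induct)
    case less
    have v: "pred v \<in> E" "tgt (pred v) = v" using pred less.prems by (auto simp: tree_def)
    have "w e = 0" if "e \<in> E" "src e = v" for e
    proof (cases "e \<in> tree_edges pred")
      case True
      then obtain u where u: "u \<in> V - {source, sink}" "e = pred u" by blast
      then have "level v < level u" using level_less[OF that(1)] that(2) pred by (auto simp: tree_def)
      moreover have "level u \<le> Max (level ` V)" using u by (intro Max_ge) auto
      ultimately have "Max (level ` V) - level u < Max (level ` V) - level v" by linarith
      then show ?thesis using less.hyps[of u] u by simp
    qed (use z'(2) that in \<open>simp add: w_def\<close>)
    then have "(\<Sum>e\<in>{e\<in>E. src e = v}. w e) = 0" by (intro sum.neutral) auto
    moreover have "w e = 0" if "e \<in> {e\<in>E. tgt e = v} - {pred v}" for e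
    proof -
      have "e \<notin> tree_edges pred"
      proof
        assume "e \<in> tree_edges pred"
        then obtain u where "u \<in> V - {source, sink}" "e = pred u" by blast
        then show False using that pred by (auto simp: tree_def)
      qed
      then show ?thesis using that z'(2) by (simp add: w_def)
    qed
    then have "(\<Sum>e\<in>{e\<in>E. tgt e = v}. w e) = w (pred v)"
      using v by (subst sum.remove[of _ "pred v"]) (auto intro: sum.neutral)
    ultimately show ?case using net0[OF less.prems] by (simp add: net_def)
  qed
  then have "z e = z' e" if "e \<in> E" for e
    using that z'(2) unfolding w_def by (cases "e \<in> tree_edges pred") auto
  then show ?thesis using z'(1) by blast
qed

text \<open>The source emits \<open>k\<close>, which is at most 0, along edges with nonnegative
  values, so these values vanish. By induction on the level nothing enters any vertex, hence nothing
  leaves it.\<close>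

lemma nonneg_flow_zero:
  assumes "path_span z k" "k \<le> 0" "\<And>e. e \<in> E \<Longrightarrow> z e \<ge> 0"
  shows "e \<in> E \<Longrightarrow> z e = 0"
proof (induction "level (src e)" arbitrary: e rule: less_induct)
  case less
  let ?v = "src e"
  have "(\<Sum>e\<in>{e\<in>E. tgt e = ?v}. z e) = 0"
  proof (intro sum.neutral ballI)
    fix f assume f: "f \<in> {e\<in>E. tgt e = ?v}"
    then have "level (src f) < level ?v" using level_less[of f] by auto
    then show "z f = 0" using less.hyps f by blast
  qed
  moreover have "net z ?v = - k * of_bool (?v = source)"
    using path_span_star[OF assms(1), of ?v] src_neq_sink[OF less.prems] by (simp add: net_int)
  ultimately have "(\<Sum>e\<in>{e\<in>E. src e = ?v}. z e) = k * of_bool (?v = source)"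
    by (simp add: net_def)
  then have "(\<Sum>e\<in>{e\<in>E. src e = ?v}. z e) \<le> 0" using assms(2) by simp
  moreover have "z e \<le> (\<Sum>e\<in>{e\<in>E. src e = ?v}. z e)"
    using assms(3) less.prems by (intro member_le_sum) auto
  ultimately show ?case using assms(3)[OF less.prems] by linarith
qed

section \<open>Flows and directed cuts\<close>

definition is_flow :: "'a::ab_group_add \<Rightarrow> ('e \<Rightarrow> 'a) \<Rightarrow> bool" where
  "is_flow b m \<longleftrightarrow> (\<forall>v\<in>V. net m v = Tr V E src tgt b v)"

text \<open>The set \<open>C\<close> is the cut leaving the vertices that the source reaches without using \<open>C\<close>.\<close>

lemma flow_through_cut:
  assumes "is_flow b m" and C: "C \<subseteq> E"
    and meet: "\<And>p. stpath p \<Longrightarrow> \<exists>!e. e \<in> set p \<and> e \<in> C"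
  shows "(\<Sum>e\<in>C. m e) = b"
proof -
  define S where "S = {v\<in>V. v = source \<or> (\<exists>p. walk p \<and> src (hd p) = source \<and> tgt (last p) = v \<and> set p \<inter> C = {})}"
  have "finite S" unfolding S_def by simp
  \<comment> \<open>Every walk extends to a source-sink path, so no walk contains two edges of
    \<open>C\<close>.\<close>
  have two: False if "walk p" "e \<in> set p" "f \<in> set p" "e \<in> C" "f \<in> C" "e \<noteq> f" for p e f
    using walk_in_stpath[OF that(1)] meet that by (metis in_set_conv_decomp Un_iff set_append)
  have step: "tgt e \<in> S" if e: "e \<in> E" "src e \<in> S" "e \<notin> C" for e
  proof (cases "src e = source")
    case True
    then show ?thesis using e unfolding S_def by (auto intro!: exI[of _ "[e]"] simp: dpath_Cons)
  next
    case False
    then obtain p where p: "walk p" "src (hd p) = source" "tgt (last p) = src e" "set p \<inter> C = {}"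
      using e unfolding S_def by auto
    then have "walk (p @ [e])" using e dpath_nonempty[OF p(1)] by (simp add: dpath_append dpath_Cons)
    then show ?thesis using p e dpath_nonempty[OF p(1)]
      unfolding S_def by (auto intro!: exI[of _ "p @ [e]"])
  qed
  have reach: "\<exists>p f. walk p \<and> tgt (last p) = v \<and> f \<in> set p \<and> f \<in> C" if "v \<in> V" "v \<notin> S" for v
  proof -
    have "v \<noteq> source" using that unfolding S_def by auto
    then obtain p where p: "walk p" "src (hd p) = source" "tgt (last p) = v"
      using walk_from_source \<open>v \<in> V\<close> by blast
    then have "set p \<inter> C \<noteq> {}" using that unfolding S_def by blast
    then show ?thesis using p by blast
  qed
  \<comment> \<open>Any walk from the source to a vertex outside \<open>S\<close> has already used
    an edge of \<open>C\<close>; another edge of \<open>C\<close> after it would be the second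
    one.\<close>
  have not_src: "e \<notin> C" if e: "e \<in> E" "src e \<notin> S" for e
  proof
    assume "e \<in> C"
    obtain p f where p: "walk p" "tgt (last p) = src e" "f \<in> set p" "f \<in> C"
      using reach[of "src e"] e by auto
    have w: "walk (p @ [e])" using p e dpath_nonempty[OF p(1)] by (simp add: dpath_append dpath_Cons)
    then have "f \<noteq> e" using walk_distinct[OF w] p(3) by auto
    then show False using two[OF w, of f e] p \<open>e \<in> C\<close> by auto
  qed
  have after: False if v: "v \<in> S" "v = src (hd r)" and r: "walk r" "tgt (last r) = sink" "set r \<inter> C = {}"
    for v r
  proof (cases "v = source")
    case True
    then have "stpath r" using r v stpath_iff by simp
    then show False using meet r(3) by blast
  next
    case False
    then obtain p where p: "walk p" "src (hd p) = source" "tgt (last p) = v" "set p \<inter> C = {}"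
      using v unfolding S_def by auto
    then have "stpath (p @ r)"
      using r v dpath_nonempty[OF p(1)] dpath_nonempty[OF r(1)] by (simp add: stpath_iff dpath_append)
    then show False using meet p(4) r(3) by fastforce
  qed
  have no_sink: "sink \<notin> S"
  proof
    assume "sink \<in> S"
    then obtain p where "walk p" "src (hd p) = source" "tgt (last p) = sink" "set p \<inter> C = {}"
      unfolding S_def by auto
    then show False using meet[of p] stpath_iff by blast
  qed
  \<comment> \<open>From a vertex of \<open>S\<close> the sink is reached only through
    \<open>C\<close>. If the head were in \<open>S\<close>, the edge of \<open>C\<close> met after
    \<open>e\<close> would be preceded by another one: \<open>e\<close> itself, or one on the way to
    its tail.\<close>
  have not_tgt: "tgt e \<notin> S" if e: "e \<in> E" "src e \<notin> S \<or> e \<in> C" for e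
  proof
    assume t: "tgt e \<in> S"
    then have "tgt e \<noteq> sink" using no_sink by auto
    then obtain r where r: "walk r" "src (hd r) = tgt e" "tgt (last r) = sink"
      using walk_to_sink[of "tgt e"] e by (metis tgt_in)
    then obtain g where g: "g \<in> set r" "g \<in> C" using after[OF t] by (metis disjoint_iff)
    show False
    proof (cases "e \<in> C")
      case True
      have w: "walk (e # r)" using e r by (simp add: dpath_Cons)
      then have "e \<noteq> g" using walk_distinct[OF w] g by auto
      then show False using two[OF w, of e g] g True by auto
    next
      case False
      then obtain p f where p: "walk p" "tgt (last p) = src e" "f \<in> set p" "f \<in> C"
        using reach[of "src e"] e by auto
      have w: "walk (p @ e # r)" using p e r dpath_nonempty[OF p(1)]
        by (simp add: dpath_append dpath_Cons)
      then have "f \<noteq> g" using walk_distinct[OF w] p(3) g by auto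
      then show False using two[OF w, of f g] p g by auto
    qed
  qed
  \<comment> \<open>Edges of \<open>C\<close> lead from \<open>S\<close> to its complement, and no
    other edge has its ends on different sides. Summing \<open>net\<close> over \<open>S\<close>
    therefore leaves only \<open>C\<close>; by conservation the same sum is the contribution of the
    source alone.\<close>
  have val: "(\<Sum>v\<in>S. (if tgt e = v then m e else 0) - (if src e = v then m e else 0)) = (if e \<in> C then - m e else 0)"
    if e: "e \<in> E" for e
  proof -
    have "(\<Sum>v\<in>S. (if tgt e = v then m e else 0) - (if src e = v then m e else 0))
        = (if tgt e \<in> S then m e else 0) - (if src e \<in> S then m e else 0)"
      using \<open>finite S\<close> by (simp add: sum_subtractf)
    also have "\<dots> = (if e \<in> C then - m e else 0)"
      using step[OF e] not_src[OF e] not_tgt[OF e] by auto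
    finally show ?thesis .
  qed
  have "(\<Sum>v\<in>S. net m v) = (\<Sum>e\<in>E. \<Sum>v\<in>S. (if tgt e = v then m e else 0) - (if src e = v then m e else 0))"
    unfolding net_alt by (rule sum.swap)
  also have "\<dots> = (\<Sum>e\<in>E. if e \<in> C then - m e else 0)" using val by (intro sum.cong) auto
  also have "\<dots> = (\<Sum>e\<in>C. - m e)" using C by (simp add: sum.inter_restrict[symmetric] Int_absorb1)
  finally have "(\<Sum>v\<in>S. net m v) = - (\<Sum>e\<in>C. m e)" by (simp add: sum_negf)
  moreover have "(\<Sum>v\<in>S. net m v) = - b"
  proof -
    have "source \<in> S" "S \<subseteq> V" unfolding S_def by auto
    then have "(\<Sum>v\<in>S. net m v) = (\<Sum>v\<in>S. Tr V E src tgt b v)"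
      using assms(1) unfolding is_flow_def by (intro sum.cong) auto
    also have "\<dots> = (\<Sum>v\<in>S. if v = source then - b else 0)"
      using no_sink by (intro sum.cong) (auto simp: Tr_def)
    also have "\<dots> = - b" using \<open>finite S\<close> \<open>source \<in> S\<close> by simp
    finally show ?thesis .
  qed
  ultimately show ?thesis by simp
qed

end

subsection \<open>Dual pairs of bipolar digraphs\<close>

text \<open>The interface between topology and combinatorics. \<open>side p\<close> stands for the
  facets to the left of the line through \<open>p\<close>. \<open>no_jump\<close> says that the
  facets remain connected to each other when only off-tree edges may be crossed.\<close>

locale dual_pair = bipolar_digraph V E src tgt
  for V :: "'v set" and E :: "'e set" and src tgt :: "'e \<Rightarrow> 'v" +
  fixes Fac :: "'f set" and dt dh :: "'e \<Rightarrow> 'f" and outer_left outer_right :: 'f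
    and side :: "'e list \<Rightarrow> 'f set"
  assumes dt_in: "e \<in> E \<Longrightarrow> dt e \<in> Fac" and dh_in: "e \<in> E \<Longrightarrow> dh e \<in> Fac"
    and outer_left: "outer_left \<in> Fac" "stpath p \<Longrightarrow> outer_left \<in> side p"
    and outer_right: "outer_right \<in> Fac" "stpath p \<Longrightarrow> outer_right \<notin> side p"
    and side_on: "stpath p \<Longrightarrow> e \<in> set p \<Longrightarrow> dt e \<in> side p \<and> dh e \<notin> side p"
    and side_off: "stpath p \<Longrightarrow> e \<in> E \<Longrightarrow> e \<notin> set p \<Longrightarrow> dt e \<in> side p \<longleftrightarrow> dh e \<in> side p"
    and no_jump: "tree pred \<Longrightarrow> (\<And>e. e \<in> E - tree_edges pred \<Longrightarrow> h (dt e) = (h (dh e) :: int)) \<Longrightarrow>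
      F \<in> Fac \<Longrightarrow> F' \<in> Fac \<Longrightarrow> h F = h F'"
begin

lemma stpath_exists: "\<exists>p. stpath p"
proof -
  obtain e where "e \<in> E" using source_iff[OF sink_in] by auto
  then show ?thesis by (meson edge_in_stpath)
qed

lemma outer_neq: "outer_left \<noteq> outer_right"
  using stpath_exists outer_left(2) outer_right(2) by metis

lemma no_jumps:
  assumes "\<And>e. e \<in> E \<Longrightarrow> h (dt e) = (h (dh e) :: int)" "F \<in> Fac" "F' \<in> Fac"
  shows "h F = h F'"
proof -
  obtain pred where "tree pred" using tree_exists by blast
  then show ?thesis by (rule no_jump) (use assms in auto)
qed

text \<open>The jumps of any facet function form a path combination, and its coefficient sum is the
  difference between the outer facets, because \<open>outer_left\<close> is to the left of every
  path and \<open>outer_right\<close> of none. This is the source of all expansions of facet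
  stars.\<close>

lemma jump_path_span:
  fixes h :: "'f \<Rightarrow> int"
  obtains z k where "path_span z k" "\<And>e. e \<in> E \<Longrightarrow> z e = h (dt e) - h (dh e)"
    "k = h outer_left - h outer_right"
proof -
  obtain pred where pred: "tree pred" using tree_exists by blast
  obtain z k where z: "path_span z k" "\<forall>e\<in>E - tree_edges pred. h (dt e) - h (dh e) = z e"
    using eliminate_off_tree[OF pred, of "\<lambda>e. h (dt e) - h (dh e)"] by blast
  have cross: "of_bool (e \<in> set p) = of_bool (dt e \<in> side p) - (of_bool (dh e \<in> side p) :: int)"
    if "stpath p" "e \<in> E" for e p
    using side_on[OF that(1)] side_off[OF that] by (cases "e \<in> set p") auto
  \<comment> \<open>A potential of the combination: the indicators of the sets
    \<open>side p\<close>, taken with the coefficients of the paths \<open>p\<close>.\<close>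
  have "\<exists>g. (\<forall>e\<in>E. z e = g (dt e) - g (dh e)) \<and> k = g outer_left - g outer_right"
    using z(1)
  proof induction
    case zero
    then show ?case by (intro exI[of _ "\<lambda>_. 0"]) simp
  next
    case (add z k p)
    then obtain g where g: "\<And>e. e \<in> E \<Longrightarrow> z e = g (dt e) - g (dh e)" "k = g outer_left - g outer_right"
      by blast
    then show ?case using g cross[OF add(2)] outer_left(2)[OF add(2)] outer_right(2)[OF add(2)]
      by (intro exI[of _ "\<lambda>F. g F + of_bool (F \<in> side p)"]) auto
  next
    case (sub z k p)
    then obtain g where g: "\<And>e. e \<in> E \<Longrightarrow> z e = g (dt e) - g (dh e)" "k = g outer_left - g outer_right"
      by blast
    then show ?case using g cross[OF sub(2)] outer_left(2)[OF sub(2)] outer_right(2)[OF sub(2)]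
      by (intro exI[of _ "\<lambda>F. g F - of_bool (F \<in> side p)"]) auto
  qed
  then obtain g where g: "\<And>e. e \<in> E \<Longrightarrow> z e = g (dt e) - g (dh e)" "k = g outer_left - g outer_right"
    by blast
  have const: "h F - g F = h F' - g F'" if "F \<in> Fac" "F' \<in> Fac" for F F'
  proof (rule no_jump[OF pred _ that])
    fix e assume "e \<in> E - tree_edges pred"
    then show "h (dt e) - g (dt e) = h (dh e) - g (dh e)" using z(2) g(1)[of e] by force
  qed
  show ?thesis
  proof (rule that[OF z(1)])
    show "z e = h (dt e) - h (dh e)" if "e \<in> E" for e
      using const[OF dt_in[OF that] dh_in[OF that]] g(1)[OF that] by simp
    show "k = h outer_left - h outer_right"
      using const[OF outer_left(1) outer_right(1)] g(2) by simp
  qed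
qed

text \<open>The indicator of a facet that touches no edge has no jumps, hence is constant; but it
  cannot take the same value on this facet and on both outer facets, which differ. Finiteness of
  \<open>Fac\<close> follows from this equation.\<close>

lemma Fac_eq: "Fac = dt ` E \<union> dh ` E"
proof (rule ccontr)
  assume neq: "\<not> ?thesis"
  then obtain F where F: "F \<in> Fac" "F \<notin> dt ` E" "F \<notin> dh ` E" using dt_in dh_in by blast
  have "(of_bool (F1 = F) :: int) = of_bool (F2 = F)" if "F1 \<in> Fac" "F2 \<in> Fac" for F1 F2
    by (rule no_jumps[where h = "\<lambda>F'. of_bool (F' = F)", OF _ that]) (use F in auto)
  from this[OF F(1) outer_left(1)] this[OF F(1) outer_right(1)] show False using outer_neq by auto
qed

text \<open>A dual edge crosses the line of \<open>p\<close> exactly at the edges of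
  \<open>p\<close>, and always from left to right, so a dual walk crosses at most once and cannot
  return.\<close>

lemma dual_walk_side:
  assumes "stpath p" "dpath E dt dh q"
  shows "dt (hd q) \<notin> side p \<Longrightarrow> set q \<inter> set p = {} \<and> dh (last q) \<notin> side p"
    and "dt (hd q) \<in> side p \<Longrightarrow> dh (last q) \<notin> side p \<Longrightarrow> \<exists>!e. e \<in> set q \<and> e \<in> set p"
proof -
  have one: "dt (hd q) \<notin> side p \<Longrightarrow> set q \<inter> set p = {} \<and> dh (last q) \<notin> side p"
    if "dpath E dt dh q" for q
    using that
  proof (induction q)
    case (Cons e q)
    then have e: "e \<in> E" "e \<notin> set p" "dh e \<notin> side p"
      using side_on[OF assms(1)] side_off[OF assms(1)] by (auto simp: dpath_Cons)
    show ?case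
    proof (cases "q = []")
      case False
      then show ?thesis using Cons e by (auto simp: dpath_Cons)
    qed (use e in auto)
  qed (simp add: dpath_def)
  show "dt (hd q) \<notin> side p \<Longrightarrow> set q \<inter> set p = {} \<and> dh (last q) \<notin> side p"
    using one assms(2) by blast
  show "dt (hd q) \<in> side p \<Longrightarrow> dh (last q) \<notin> side p \<Longrightarrow> \<exists>!e. e \<in> set q \<and> e \<in> set p"
    using assms(2)
  proof (induction q)
    case (Cons e q)
    have e: "e \<in> E" using Cons by (simp add: dpath_Cons)
    show ?case
    proof (cases "q = []")
      case True
      then have "e \<in> set p" using side_off[OF assms(1) e] Cons by auto
      then show ?thesis using True by auto
    next
      case False
      then have q: "dpath E dt dh q" "dh e = dt (hd q)" "dh (last q) \<notin> side p"
        using Cons by (auto simp: dpath_Cons)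
      show ?thesis
      proof (cases "e \<in> set p")
        case True
        then have "set q \<inter> set p = {}" using one[OF q(1)] side_on[OF assms(1) True] q(2) by simp
        then show ?thesis using True by (intro ex1I[of _ e]) auto
      next
        case False
        then have "dt (hd q) \<in> side p" using side_off[OF assms(1) e False] Cons q by simp
        then have "\<exists>!e. e \<in> set q \<and> e \<in> set p" using Cons.IH q by blast
        then show ?thesis using False by auto
      qed
    qed
  qed (simp add: dpath_def)
qed

lemma dual_neq: "e \<in> E \<Longrightarrow> dt e \<noteq> dh e"
  using side_on edge_in_stpath by metis

text \<open>If no dual edge enters \<open>F\<close>, the indicator of \<open>F\<close> has
  nonnegative jumps. For \<open>F\<close> other than \<open>outer_left\<close> the coefficient sum
  of these jumps is at most 0, so \<open>nonneg_flow_zero\<close> kills them all and the indicator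
  would be constant. The sink is treated with the negated indicator.\<close>

lemma unique_extremal:
  assumes F: "F \<in> Fac"
  shows "(\<And>e. e \<in> E \<Longrightarrow> dh e \<noteq> F) \<Longrightarrow> F = outer_left"
    and "(\<And>e. e \<in> E \<Longrightarrow> dt e \<noteq> F) \<Longrightarrow> F = outer_right"
proof -
  have zero: False
    if h: "h outer_left - h outer_right \<le> (0::int)" "\<And>e. e \<in> E \<Longrightarrow> h (dt e) - h (dh e) \<ge> 0"
      and neq: "F1 \<in> Fac" "F2 \<in> Fac" "h F1 \<noteq> h F2" for h F1 F2
  proof -
    obtain z k where z: "path_span z k" "\<And>e. e \<in> E \<Longrightarrow> z e = h (dt e) - h (dh e)"
      "k = h outer_left - h outer_right" by (rule jump_path_span[of h]) (rule that)
    have "z e = 0" if "e \<in> E" for e using nonneg_flow_zero[OF z(1) _ _ that] z h by auto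
    then have "h F1 = h F2" using z(2) by (intro no_jumps[OF _ neq(1,2)]) auto
    then show False using neq by simp
  qed
  show "F = outer_left" if "\<And>e. e \<in> E \<Longrightarrow> dh e \<noteq> F"
  proof (rule ccontr)
    assume "F \<noteq> outer_left"
    then show False using that
      by (intro zero[of "\<lambda>F'. of_bool (F' = F)" F outer_left] F outer_left(1)) auto
  qed
  show "F = outer_right" if "\<And>e. e \<in> E \<Longrightarrow> dt e \<noteq> F"
  proof (rule ccontr)
    assume "F \<noteq> outer_right"
    then show False using that
      by (intro zero[of "\<lambda>F'. - of_bool (F' = F)" F outer_right] F outer_right(1)) auto
  qed
qed

lemma dual_source: "is_source Fac E dh F \<longleftrightarrow> F = outer_left"
proof
  assume "is_source Fac E dh F"
  then show "F = outer_left" using unique_extremal(1)[of F] by (auto simp: is_source_def)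
next
  have "dh e \<noteq> outer_left" if "e \<in> E" for e
    using edge_in_stpath[OF that] side_on outer_left(2) by metis
  then show "F = outer_left \<Longrightarrow> is_source Fac E dh F" using outer_left(1) by (auto simp: is_source_def)
qed

lemma dual_sink: "is_sink Fac E dt F \<longleftrightarrow> F = outer_right"
proof
  assume "is_sink Fac E dt F"
  then show "F = outer_right" using unique_extremal(2)[of F] by (auto simp: is_sink_def)
next
  have "dt e \<noteq> outer_right" if "e \<in> E" for e
    using edge_in_stpath[OF that] side_on outer_right(2) by metis
  then show "F = outer_right \<Longrightarrow> is_sink Fac E dt F" using outer_right(1) by (auto simp: is_sink_def)
qed

text \<open>For acyclicity, take a source-sink path through the first edge of a closed dual walk.
  After this edge the walk stays to the right of the path and cannot come back to the facet on the
  left where it started.\<close>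

lemma dual_bipolar: "bipolar Fac E dt dh"
proof -
  have "acyclic_dg E dt dh"
    unfolding acyclic_dg_def
  proof
    assume "\<exists>p. dpath E dt dh p \<and> dh (last p) = dt (hd p)"
    then obtain q where q: "dpath E dt dh q" "dh (last q) = dt (hd q)" by blast
    then have "hd q \<in> E" using dpath_subset dpath_nonempty by (metis hd_in_set subsetD)
    then obtain p where p: "stpath p" "hd q \<in> set p" by (rule edge_in_stpath)
    show False
    proof (cases "dt (hd q) \<in> side p")
      case False
      then show False using side_on[OF p] by blast
    next
      case True
      show False
      proof (cases "tl q = []")
        case True
        then have "q = [hd q]" using dpath_nonempty[OF q(1)] by (cases q) auto
        then show False using q(2) dual_neq[OF \<open>hd q \<in> E\<close>] by (metis last.simps)
      next
        case False
        then have "dpath E dt dh (tl q)" "dh (hd q) = dt (hd (tl q))" "last (tl q) = last q"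
          using q(1) by (cases q; auto simp: dpath_Cons)+
        then show False using dual_walk_side(1)[OF p(1), of "tl q"] side_on[OF p] q(2) by auto
      qed
    qed
  qed
  moreover have fin: "finite Fac" unfolding Fac_eq by simp
  moreover have "card Fac \<ge> 2"
    using card_mono[of Fac "{outer_left, outer_right}"] fin outer_neq outer_left(1) outer_right(1) by auto
  ultimately show ?thesis
    unfolding bipolar_def by (auto simp: dual_source dual_sink dt_in dh_in)
qed

sublocale dual: bipolar_digraph Fac E dt dh
  using dual_bipolar by unfold_locales

lemma dual_source_eq [simp]: "dual.source = outer_left"
  unfolding the_source_def dual_source by simp

lemma dual_sink_eq [simp]: "dual.sink = outer_right"
  unfolding the_sink_def dual_sink by simp

lemma meet_once:
  assumes "stpath p" "dual.stpath q"
  shows "\<exists>!e. e \<in> set q \<and> e \<in> set p"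
proof -
  have "dpath E dt dh q" "dt (hd q) = outer_left" "dh (last q) = outer_right"
    using assms(2) dual.stpath_iff by auto
  then show ?thesis using dual_walk_side(2)[OF assms(1)] outer_left(2) outer_right(2) assms(1) by simp
qed

lemma dual_star_span:
  obtains z where "path_span z (of_bool (F = outer_left) - of_bool (F = outer_right))"
    "\<And>e. e \<in> E \<Longrightarrow> z e = dual.star F e"
  by (rule jump_path_span[of "\<lambda>F'. of_bool (F' = F)"]) (auto simp: dual.star_def eq_commute)

text \<open>The star of a facet is a combination of paths, and a path pairs with the star of
  \<open>v\<close> to 1, -1 or 0 by telescoping. So the star of \<open>v\<close> is conserved at the
  inner facets, that is, it is a flow in the dual, and it decomposes into dual paths.\<close>

lemma star_dual_span:
  obtains z where "dual.path_span z (of_bool (v = source) - of_bool (v = sink))"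
    "\<And>e. e \<in> E \<Longrightarrow> z e = star v e"
proof -
  have pair: "(\<Sum>e\<in>E. dual.star F e * star v e) =
      (of_bool (F = outer_left) - of_bool (F = outer_right)) * (of_bool (v = source) - of_bool (v = sink))" for F
  proof -
    obtain z where z: "path_span z (of_bool (F = outer_left) - of_bool (F = outer_right))"
      "\<And>e. e \<in> E \<Longrightarrow> z e = dual.star F e" by (rule dual_star_span[of F]) (rule that)
    have "(\<Sum>e\<in>E. dual.star F e * star v e) = (\<Sum>e\<in>E. star v e * z e)"
      using z(2) by (intro sum.cong) auto
    then show ?thesis using path_span_star[OF z(1)] by simp
  qed
  have "dual.net (star v) F = 0" if "F \<in> Fac - {outer_left, outer_right}" for F
    unfolding dual.net_int pair using that by auto
  then obtain z k where z: "dual.path_span z k" "\<forall>e\<in>E. star v e = z e"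
    using dual.flow_decomposition[of "star v"] by auto
  \<comment> \<open>The coefficient sum is read off at the dual source, which every dual path leaves
    once.\<close>
  have "k = (\<Sum>e\<in>E. dual.star outer_left e * z e)"
    using dual.path_span_star[OF z(1), of outer_left] outer_neq by simp
  also have "\<dots> = (\<Sum>e\<in>E. dual.star outer_left e * star v e)" using z(2) by (intro sum.cong) auto
  finally have "k = of_bool (v = source) - of_bool (v = sink)" using pair[of outer_left] outer_neq by simp
  then show ?thesis using that z by metis
qed

lemma flow_iff_dual_paths:
  "is_flow b m \<longleftrightarrow> (\<forall>q. dual.stpath q \<longrightarrow> (\<Sum>e\<in>set q. m e) = b)"
proof (intro iffI allI impI)
  fix q assume flow: "is_flow b m" and q: "dual.stpath q"
  have "set q \<subseteq> E" using q by (auto simp: max_dpath_def dpath_def)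
  then show "(\<Sum>e\<in>set q. m e) = b"
    using meet_once[OF _ q] by (intro flow_through_cut[OF flow]) (auto simp: conj_commute)
next
  assume paths: "\<forall>q. dual.stpath q \<longrightarrow> (\<Sum>e\<in>set q. m e) = b"
  show "is_flow b m"
    unfolding is_flow_def
  proof
    fix v assume "v \<in> V"
    obtain z where z: "dual.path_span z (of_bool (v = source) - of_bool (v = sink))"
      "\<And>e. e \<in> E \<Longrightarrow> z e = star v e" by (rule star_dual_span[of v]) (rule that)
    have "net m v = - (\<Sum>e\<in>E. zmul (z e) (m e))"
      unfolding net_star using z(2) by (intro arg_cong[of _ _ uminus] sum.cong) auto
    also have "\<dots> = - zmul (of_bool (v = source) - of_bool (v = sink)) b"
      using paths by (intro arg_cong[of _ _ uminus] dual.path_span_eval[OF z(1)]) blast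
    finally show "net m v = Tr V E src tgt b v" by (auto simp: Tr_def)
  qed
qed

lemma dual_flow_iff_paths:
  "dual.is_flow b m \<longleftrightarrow> (\<forall>p. stpath p \<longrightarrow> (\<Sum>e\<in>set p. m e) = b)"
proof (intro iffI allI impI)
  fix p assume flow: "dual.is_flow b m" and p: "stpath p"
  have "set p \<subseteq> E" using p by (auto simp: max_dpath_def dpath_def)
  then show "(\<Sum>e\<in>set p. m e) = b"
    using meet_once[OF p] by (intro dual.flow_through_cut[OF flow]) auto
next
  assume paths: "\<forall>p. stpath p \<longrightarrow> (\<Sum>e\<in>set p. m e) = b"
  show "dual.is_flow b m"
    unfolding dual.is_flow_def
  proof
    fix F assume "F \<in> Fac"
    obtain z where z: "path_span z (of_bool (F = outer_left) - of_bool (F = outer_right))"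
      "\<And>e. e \<in> E \<Longrightarrow> z e = dual.star F e" by (rule dual_star_span[of F]) (rule that)
    have "dual.net m F = - (\<Sum>e\<in>E. zmul (z e) (m e))"
      unfolding dual.net_star using z(2) by (intro arg_cong[of _ _ uminus] sum.cong) auto
    also have "\<dots> = - zmul (of_bool (F = outer_left) - of_bool (F = outer_right)) b"
      using paths by (intro arg_cong[of _ _ uminus] path_span_eval[OF z(1)]) blast
    finally show "dual.net m F = Tr Fac E dt dh b F"
      using outer_neq by (auto simp: Tr_def)
  qed
qed

end

section \<open>From tuples indexed by \<open>1..n\<close> to weights on edges\<close>

lemma sum_fibres:
  fixes a :: "nat \<Rightarrow> 'a::ab_group_add"
  assumes "bij_betw f {1..n} E" "S \<subseteq> E"
  shows "(\<Sum>e\<in>S. \<Sum>i\<in>{i\<in>{1..n}. f i = e \<and> P i}. a i) = (\<Sum>i\<in>{i\<in>{1..n}. f i \<in> S \<and> P i}. a i)"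
proof -
  have "finite S" using assms bij_betw_finite finite_subset by (metis finite_atLeastAtMost)
  then have "(\<Sum>e\<in>S. \<Sum>i\<in>{i\<in>{i\<in>{1..n}. f i \<in> S \<and> P i}. f i = e}. a i) = (\<Sum>i\<in>{i\<in>{1..n}. f i \<in> S \<and> P i}. a i)"
    by (intro sum.group) auto
  moreover have "{i\<in>{i\<in>{1..n}. f i \<in> S \<and> P i}. f i = e} = {i\<in>{1..n}. f i = e \<and> P i}" if "e \<in> S" for e
    using that by auto
  ultimately show ?thesis by simp
qed

text \<open>Each fibre of \<open>\<phi>\<close> over an edge has one element, so the weight of the
  edge \<open>\<phi> i\<close> is \<open>a i\<close> if \<open>\<psi> i\<close> lies on the path
  \<open>q\<close>, and 0 otherwise. Writing it as a fibre sum keeps the inverse of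
  \<open>\<phi>\<close> out of the computation.\<close>

lemma (in bipolar_digraph) solution_iff_flow:
  fixes \<phi> :: "nat \<Rightarrow> 'e"
  assumes "bij_betw \<phi> {1..n} E"
  shows "is_solution V E src tgt EH srcH tgtH \<phi> \<psi> n b a \<longleftrightarrow>
    (\<forall>q. max_dpath EH srcH tgtH q \<longrightarrow> is_flow b (\<lambda>e. \<Sum>i\<in>{i\<in>{1..n}. \<phi> i = e \<and> \<psi> i \<in> set q}. a i))"
proof -
  have "Eff \<phi> src tgt a {j\<in>{1..n}. \<psi> j \<in> set q} v = net (\<lambda>e. \<Sum>i\<in>{i\<in>{1..n}. \<phi> i = e \<and> \<psi> i \<in> set q}. a i) v" for q v
  proof -
    have E: "\<phi> i \<in> E" if "i \<in> {1..n}" for i using assms that bij_betwE by blast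
    have "{i \<in> {j\<in>{1..n}. \<psi> j \<in> set q}. g (\<phi> i) = v} = {i\<in>{1..n}. \<phi> i \<in> {e\<in>E. g e = v} \<and> \<psi> i \<in> set q}" for g
      using E by auto
    then show ?thesis unfolding Eff_def net_def
      using sum_fibres[OF assms, of "{e\<in>E. tgt e = v}" a "\<lambda>i. \<psi> i \<in> set q"]
        sum_fibres[OF assms, of "{e\<in>E. src e = v}" a "\<lambda>i. \<psi> i \<in> set q"] by auto
  qed
  then show ?thesis unfolding is_solution_def is_flow_def by simp
qed

theorem dual_solution_iff:
  fixes a :: "nat \<Rightarrow> 'a::ab_group_add"
  assumes G: "dual_pair VG EG srcG tgtG FG dtG dhG lG rG sideG"
    and H: "dual_pair VH EH srcH tgtH FH dtH dhH lH rH sideH"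
    and \<phi>: "bij_betw \<phi> {1..n} EG" and \<psi>: "bij_betw \<psi> {1..n} EH"
  shows "is_solution VG EG srcG tgtG EH srcH tgtH \<phi> \<psi> n b a \<longleftrightarrow>
    is_solution FH EH dtH dhH EG dtG dhG \<psi> \<phi> n b a"
proof -
  interpret G: dual_pair VG EG srcG tgtG FG dtG dhG lG rG sideG by (rule G)
  interpret H: dual_pair VH EH srcH tgtH FH dtH dhH lH rH sideH by (rule H)
  have 1: "(\<Sum>e\<in>set q. \<Sum>i\<in>{i\<in>{1..n}. \<phi> i = e \<and> \<psi> i \<in> set p}. a i) = (\<Sum>i\<in>{i\<in>{1..n}. \<phi> i \<in> set q \<and> \<psi> i \<in> set p}. a i)"
    if "G.dual.stpath q" for p q
    by (rule sum_fibres[OF \<phi>]) (use that in \<open>auto simp: max_dpath_def dpath_def\<close>)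
  have 2: "(\<Sum>e\<in>set p. \<Sum>i\<in>{i\<in>{1..n}. \<psi> i = e \<and> \<phi> i \<in> set q}. a i) = (\<Sum>i\<in>{i\<in>{1..n}. \<phi> i \<in> set q \<and> \<psi> i \<in> set p}. a i)"
    if "H.stpath p" for p q
    using sum_fibres[OF \<psi>, of "set p" a "\<lambda>i. \<phi> i \<in> set q"] that
    by (simp add: max_dpath_def dpath_def conj_commute)
  show ?thesis
    unfolding G.solution_iff_flow[OF \<phi>] H.dual.solution_iff_flow[OF \<psi>]
      G.flow_iff_dual_paths H.dual_flow_iff_paths
    using 1 2 by auto
qed

subsection \<open>Closed plane graphs with a return arc\<close>

text \<open>Since the integers are closed, values on a dense subset suffice. This is used for
  differences of winding numbers that extend continuously across an arc, on which the winding
  numbers themselves carry no information.\<close>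

lemma integer_valued_constant:
  fixes q :: "complex \<Rightarrow> complex"
  assumes "connected N" and cont: "continuous_on N q"
    and dense: "\<And>z \<epsilon>. z \<in> N \<Longrightarrow> \<epsilon> > 0 \<Longrightarrow> \<exists>y\<in>N. dist y z < \<epsilon> \<and> q y \<in> \<int>"
    and "z \<in> N" "w \<in> N"
  shows "q z = q w"
proof -
  have int: "q z \<in> \<int>" if "z \<in> N" for z
  proof -
    have "q z \<in> closure \<int>"
      unfolding closure_approachable
    proof (intro allI impI)
      fix e :: real assume "e > 0"
      then have "\<exists>d>0. \<forall>y\<in>N. dist y z < d \<longrightarrow> dist (q y) (q z) < e"
        using cont that unfolding continuous_on_iff by blast
      then obtain d where d: "d > 0" "\<forall>y\<in>N. dist y z < d \<longrightarrow> dist (q y) (q z) < e" by blast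
      then show "\<exists>y\<in>\<int>. dist y (q z) < e" using dense[OF that d(1)] by blast
    qed
    then show ?thesis by (simp add: closure_closed)
  qed
  have "q constant_on N"
  proof (rule continuous_discrete_range_constant[OF \<open>connected N\<close> cont])
    fix x assume "x \<in> N"
    have "1 \<le> norm (q y - q x)" if "y \<in> N" "q y \<noteq> q x" for y
    proof -
      obtain k where k: "q y - q x = of_int k"
        using Ints_diff[OF int[OF \<open>y \<in> N\<close>] int[OF \<open>x \<in> N\<close>]] by (rule Ints_cases)
      then have "k \<noteq> 0" using that by auto
      then have "\<bar>real_of_int k\<bar> \<ge> 1" by linarith
      then show ?thesis by (simp add: k)
    qed
    then show "\<exists>e>0. \<forall>y. y \<in> N \<and> q y \<noteq> q x \<longrightarrow> e \<le> norm (q y - q x)"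
      by (intro exI[of _ 1] conjI allI impI) simp_all
  qed
  then show ?thesis using assms(4,5) unfolding constant_on_def by auto
qed

text \<open>Makes the statement independent of orientation: \<open>A\<close> is the inside and
  \<open>w\<close> is 0 for a counterclockwise curve, while \<open>A\<close> is the outside and
  \<open>w\<close> is -1 for a clockwise one.\<close>

lemma Jordan_sides:
  assumes "simple_path g" "pathfinish g = pathstart g"
  obtains A B w where "A \<union> B = - path_image g" "A \<inter> B = {}"
    "connected A" "connected B" "open A" "open B"
    "frontier A = path_image g" "frontier B = path_image g" "w \<in> \<int>"
    "\<And>z. z \<in> A \<Longrightarrow> winding_number g z = w + 1"
    "\<And>z. z \<in> B \<Longrightarrow> winding_number g z = w"
proof -
  note J = Jordan_inside_outside[OF assms]
  have out: "winding_number g z = 0" if "z \<in> outside (path_image g)" for z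
    using winding_number_zero_in_outside[OF simple_path_imp_path] assms that by blast
  show ?thesis
  proof (rule simple_closed_path_winding_number_inside[OF assms(1)])
    assume "\<And>z. z \<in> inside (path_image g) \<Longrightarrow> winding_number g z = 1"
    then show ?thesis using J out by (intro that[of "inside (path_image g)" "outside (path_image g)" 0]) simp_all
  next
    assume "\<And>z. z \<in> inside (path_image g) \<Longrightarrow> winding_number g z = - 1"
    then show ?thesis using J out
      by (intro that[of "outside (path_image g)" "inside (path_image g)" "-1"])
        (simp_all add: Int_commute Un_commute)
  qed
qed

lemma component_containing:
  assumes "C \<in> components S" "z \<in> C" shows "C = connected_component_set S z"
proof -
  obtain x where "C = connected_component_set S x" using assms(1) by (auto elim: componentsE)
  then show ?thesis using assms(2) connected_component_eq by metis
qed

text \<open>The index \<open>None\<close> stands for the return arc \<open>R\<close> from the sink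
  to the source, and \<open>Some e\<close> for the edge \<open>e\<close>. Treating \<open>R\<close>
  as one more arc closes every source-sink path to a Jordan curve.\<close>

locale looped_graph =
  fixes V :: "complex set" and E :: "'e set" and c :: "'e \<Rightarrow> real \<Rightarrow> complex"
    and R :: "real \<Rightarrow> complex"
  assumes bip: "bipolar V E (ptail c) (phead c)"
    and plane: "plane_graph V (insert None (Some ` E)) (case_option R c)"
    and R_ends: "pathstart R = the_sink V E (ptail c)" "pathfinish R = the_source V E (phead c)"
begin

sublocale bipolar_digraph V E "ptail c" "phead c"
  using bip by unfold_locales

abbreviation "arcs1 \<equiv> insert None (Some ` E)"
abbreviation "curve \<equiv> case_option R c"
abbreviation "img x \<equiv> path_image (curve x)"

definition inner :: "'e option \<Rightarrow> complex set" where
  "inner x = img x - {pathstart (curve x), pathfinish (curve x)}"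
definition K :: "complex set" where "K = (\<Union>x\<in>arcs1. img x)"
definition Kminus :: "'e option \<Rightarrow> complex set" where "Kminus x = (\<Union>y\<in>arcs1 - {x}. img y)"
definition cyc :: "'e list \<Rightarrow> 'e option set" where "cyc p = insert None (Some ` set p)"
definition loop :: "'e list \<Rightarrow> complex set" where "loop p = (\<Union>x\<in>cyc p. img x)"
text \<open>The arcs are not closed, so single summands need not be integers; off the loop their sum
  is the winding number of the closed curve. The split form allows one arc to be taken out when two
  loops are compared.\<close>

definition W :: "'e list \<Rightarrow> complex \<Rightarrow> complex" where
  "W p z = (\<Sum>x\<in>cyc p. winding_number (curve x) z)"
text \<open>A loop may run either way around its inside, so its left side is defined as the side with
  the larger winding number.\<close>

definition Left :: "'e list \<Rightarrow> complex set" where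
  "Left p = {z. z \<notin> loop p \<and> (\<exists>z'. z' \<notin> loop p \<and> Re (W p z') < Re (W p z))}"
definition Right :: "'e list \<Rightarrow> complex set" where "Right p = - loop p - Left p"
text \<open>The arc \<open>x\<close> cuts this region into pieces of exactly two facets.\<close>

definition nbhd :: "'e option \<Rightarrow> complex set" where
  "nbhd x = {z. \<exists>y\<in>inner x. connected_component (- Kminus x) y z}"

lemma arc_curve: "x \<in> arcs1 \<Longrightarrow> arc (curve x)"
  and ends_in: "x \<in> arcs1 \<Longrightarrow> pathstart (curve x) \<in> V" "x \<in> arcs1 \<Longrightarrow> pathfinish (curve x) \<in> V"
proof -
  have *: "\<forall>x\<in>arcs1. arc (curve x) \<and> pathstart (curve x) \<in> V \<and> pathfinish (curve x) \<in> V"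
    using plane unfolding plane_graph_def by (elim conjE)
  show "x \<in> arcs1 \<Longrightarrow> arc (curve x)" "x \<in> arcs1 \<Longrightarrow> pathstart (curve x) \<in> V"
    "x \<in> arcs1 \<Longrightarrow> pathfinish (curve x) \<in> V"
    by (drule bspec[OF *], elim conjE, assumption)+
qed

lemma path_curve: "x \<in> arcs1 \<Longrightarrow> path (curve x)"
  using arc_curve arc_imp_path by blast

lemma img_Int:
  assumes "x \<in> arcs1" "y \<in> arcs1" "x \<noteq> y"
  shows "img x \<inter> img y \<subseteq>
    {pathstart (curve x), pathfinish (curve x)} \<inter> {pathstart (curve y), pathfinish (curve y)}"
proof -
  have "\<forall>e\<in>arcs1. \<forall>e'\<in>arcs1. e \<noteq> e' \<longrightarrow> img e \<inter> img e' \<subseteq>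
    {pathstart (curve e), pathfinish (curve e)} \<inter> {pathstart (curve e'), pathfinish (curve e')}"
    using plane unfolding plane_graph_def by (elim conjE)
  from bspec[OF bspec[OF this assms(1)] assms(2)] assms(3) show ?thesis by (rule mp)
qed

lemma inner_img: "x \<in> arcs1 \<Longrightarrow> y \<in> arcs1 \<Longrightarrow> x \<noteq> y \<Longrightarrow> inner x \<inter> img y = {}"
  using img_Int[of x y] unfolding inner_def by blast

lemma ends_in_img: "pathstart (curve x) \<in> img x" "pathfinish (curve x) \<in> img x"
  by (simp_all add: pathstart_in_path_image pathfinish_in_path_image)

lemma ptail_start: "ptail c e = pathstart (curve (Some e))"
  and phead_finish: "phead c e = pathfinish (curve (Some e))"
  by (simp_all add: ptail_def phead_def)

text \<open>With the return arc included, every vertex is the start of one arc and the end of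
  another one, so it stays covered when a single arc is removed.\<close>

lemma vertex_in_Kminus:
  assumes "v \<in> V" shows "v \<in> Kminus x"
proof -
  have "\<exists>y\<in>arcs1. v = pathfinish (curve y)"
  proof (cases "v = source")
    case True
    then show ?thesis using R_ends(2) by (intro bexI[of _ None]) auto
  next
    case False
    then obtain e where "e \<in> E" "phead c e = v" using source_iff[OF assms] by blast
    then show ?thesis by (intro bexI[of _ "Some e"]) (auto simp: phead_def)
  qed
  then obtain y where y: "y \<in> arcs1" "v = pathfinish (curve y)" by blast
  have "\<exists>y\<in>arcs1. v = pathstart (curve y)"
  proof (cases "v = sink")
    case True
    then show ?thesis using R_ends(1) by (intro bexI[of _ None]) auto
  next
    case False
    then obtain e where "e \<in> E" "ptail c e = v" using sink_iff[OF assms] by blast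
    then show ?thesis by (intro bexI[of _ "Some e"]) (auto simp: ptail_def)
  qed
  then obtain y' where y': "y' \<in> arcs1" "v = pathstart (curve y')" by blast
  have "y \<noteq> y'"
    using arc_distinct_ends[OF arc_curve[OF y(1)]] y(2) y'(2) by metis
  moreover have "v \<in> img y" "v \<in> img y'" using y(2) y'(2) ends_in_img by metis+
  ultimately show ?thesis using y(1) y'(1) unfolding Kminus_def by (cases "y = x") blast+
qed

lemma Kminus_Un:
  assumes "x \<in> arcs1" shows "Kminus x \<union> img x = K"
proof -
  have "arcs1 = insert x (arcs1 - {x})" using assms by blast
  then have "K = (\<Union>y\<in>insert x (arcs1 - {x}). img y)" unfolding K_def by (rule arg_cong)
  then show ?thesis unfolding Kminus_def by (simp only: UN_insert Un_commute)
qed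

lemma Kminus_inner: "x \<in> arcs1 \<Longrightarrow> Kminus x \<inter> inner x = {}"
proof -
  assume x: "x \<in> arcs1"
  have "inner x \<inter> img y = {}" if "y \<in> arcs1 - {x}" for y
    using that by (intro inner_img x) auto
  then show ?thesis unfolding Kminus_def by blast
qed

lemma K_minus_inner:
  assumes x: "x \<in> arcs1" shows "K - inner x = Kminus x"
proof -
  have "img x - inner x \<subseteq> Kminus x"
    using vertex_in_Kminus ends_in[OF x] unfolding inner_def by auto
  moreover have "inner x \<subseteq> img x" by (auto simp: inner_def)
  ultimately show ?thesis using Kminus_inner[OF x] Kminus_Un[OF x] by blast
qed

lemma Kminus_subset: "Kminus x \<subseteq> K"
  unfolding Kminus_def K_def by (intro UN_mono Diff_subset) simp

lemma compact_img: "x \<in> arcs1 \<Longrightarrow> compact (img x)"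
  by (simp add: compact_path_image path_curve)

lemma compact_Kminus: "compact (Kminus x)" and compact_K: "compact K"
  unfolding Kminus_def K_def by (intro compact_UN compact_img; auto)+

lemma cyc_subset: "stpath p \<Longrightarrow> cyc p \<subseteq> arcs1"
  unfolding cyc_def max_dpath_def dpath_def by auto

lemma loop_subset: "stpath p \<Longrightarrow> loop p \<subseteq> K"
  unfolding loop_def K_def by (intro UN_mono cyc_subset) simp_all

lemma compact_loop: "stpath p \<Longrightarrow> compact (loop p)"
  unfolding loop_def
  by (intro compact_UN compact_img subsetD[OF cyc_subset]) (simp_all add: cyc_def)

text \<open>Two edges meet only in common ends, and the levels rise along the walk. Hence
  \<open>e\<close> meets the rest of the walk only in its head, and joining the edges gives an
  arc.\<close>

lemma walk_arc:
  "walk p \<Longrightarrow> \<exists>P. arc P \<and> pathstart P = ptail c (hd p) \<and> pathfinish P = phead c (last p) \<and>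
     path_image P = (\<Union>e\<in>set p. img (Some e)) \<and>
     (\<forall>z. z \<notin> path_image P \<longrightarrow> winding_number P z = (\<Sum>e\<in>set p. winding_number (c e) z))"
proof (induction p)
  case (Cons e p)
  then have e: "e \<in> E" by (simp add: dpath_Cons)
  have arc: "arc (c e)" using arc_curve[of "Some e"] e by auto
  show ?case
  proof (cases "p = []")
    case True
    then show ?thesis using arc by (intro exI[of _ "c e"]) (simp add: ptail_def phead_def)
  next
    case False
    then have p: "walk p" "phead c e = ptail c (hd p)" using Cons.prems by (auto simp: dpath_Cons)
    then obtain P where P: "arc P" "pathstart P = ptail c (hd p)" "pathfinish P = phead c (last p)"
      "path_image P = (\<Union>e\<in>set p. img (Some e))"
      "\<And>z. z \<notin> path_image P \<Longrightarrow> winding_number P z = (\<Sum>e\<in>set p. winding_number (c e) z)"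
      using Cons.IH by blast
    have "e \<notin> set p" using walk_distinct[OF Cons.prems] by simp
    have "v = pathstart P" if v: "v \<in> path_image (c e)" "v \<in> path_image P" for v
    proof -
      obtain e' where e': "e' \<in> set p" "v \<in> img (Some e')" using v P(4) by blast
      have "e' \<in> E" "e \<noteq> e'" using e' p(1) dpath_subset \<open>e \<notin> set p\<close> by blast+
      then have v2: "v \<in> {ptail c e, phead c e} \<inter> {ptail c e', phead c e'}"
        using img_Int[of "Some e" "Some e'"] v e' e unfolding ptail_def phead_def by auto
      have "level (ptail c e) < level (phead c e)" "level (phead c e) \<le> level (ptail c e')"
        "level (ptail c e') < level (phead c e')"
        using level_less[OF e] level_less[OF \<open>e' \<in> E\<close>] walk_level[OF p(1) e'(1)] p(2) by auto
      then have "v \<noteq> ptail c e" using v2 by auto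
      then show ?thesis using v2 p(2) P(2) by simp
    qed
    then have sub: "path_image (c e) \<inter> path_image P \<subseteq> {pathstart P}" by blast
    have eq: "pathfinish (c e) = pathstart P" using p P unfolding phead_def by simp
    have "arc (c e +++ P)" using arc_join[OF arc P(1) eq sub] .
    moreover have "path_image (c e +++ P) = (\<Union>e\<in>set (e # p). img (Some e))"
      using path_image_join[OF eq] P(4) by simp
    moreover have "winding_number (c e +++ P) z = (\<Sum>e\<in>set (e # p). winding_number (c e) z)"
      if "z \<notin> path_image (c e +++ P)" for z
      using that winding_number_join[of "c e" z P] arc P eq \<open>e \<notin> set p\<close> path_image_join[OF eq]
      by (simp add: arc_imp_path)
    ultimately show ?thesis using P(3) p False
      by (intro exI[of _ "c e +++ P"]) (simp add: ptail_def)
  qed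
qed (simp add: dpath_def)

lemma stpath_loop:
  assumes "stpath p"
  shows "\<exists>L. simple_path L \<and> pathfinish L = pathstart L \<and> path_image L = loop p \<and>
    (\<forall>z. z \<notin> loop p \<longrightarrow> winding_number L z = W p z)"
proof -
  have p: "walk p" "ptail c (hd p) = source" "phead c (last p) = sink"
    using assms stpath_iff by auto
  obtain P where P: "arc P" "pathstart P = ptail c (hd p)" "pathfinish P = phead c (last p)"
    "path_image P = (\<Union>e\<in>set p. img (Some e))"
    "\<And>z. z \<notin> path_image P \<Longrightarrow> winding_number P z = (\<Sum>e\<in>set p. winding_number (c e) z)"
    using walk_arc[OF p(1)] by blast
  have arcR: "arc R" using arc_curve[of None] by simp
  have PR: "pathfinish P = pathstart R" "pathfinish R = pathstart P"
    using P p R_ends by auto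
  have "path_image P \<inter> path_image R \<subseteq> {pathstart R, pathfinish R}"
    using img_Int[of "Some _" None] dpath_subset[OF p(1)] unfolding P(4) by fastforce
  then have "simple_path (P +++ R)"
    using PR by (intro simple_path_join_loop P(1) arcR) auto
  moreover have im: "path_image (P +++ R) = loop p"
    using path_image_join[OF PR(1)] P(4) unfolding loop_def cyc_def by auto
  moreover have "winding_number (P +++ R) z = W p z" if "z \<notin> loop p" for z
  proof -
    have "z \<notin> path_image P" "z \<notin> path_image R"
      using that im path_image_join[OF PR(1)] by auto
    then have "winding_number (P +++ R) z = (\<Sum>e\<in>set p. winding_number (c e) z) + winding_number R z"
      using winding_number_join[of P z R] P(1,5) arcR PR(1) by (simp add: arc_imp_path)
    also have "\<dots> = W p z"
      unfolding W_def cyc_def by (simp add: sum.reindex)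
    finally show ?thesis .
  qed
  ultimately show ?thesis using PR by (intro exI[of _ "P +++ R"]) auto
qed

section \<open>The left and the right side of a loop\<close>

lemma loop_sides:
  assumes "stpath p"
  shows connected_Left: "connected (Left p)" and connected_Right: "connected (Right p)"
    and open_Left: "open (Left p)" and open_Right: "open (Right p)"
    and frontier_Left: "frontier (Left p) = loop p" and frontier_Right: "frontier (Right p) = loop p"
    and W_sides: "\<exists>w\<in>\<int>. (\<forall>z\<in>Left p. W p z = w + 1) \<and> (\<forall>z\<in>Right p. W p z = w)"
proof -
  obtain L where L: "simple_path L" "pathfinish L = pathstart L" "path_image L = loop p"
    "\<And>z. z \<notin> loop p \<Longrightarrow> winding_number L z = W p z"
    using stpath_loop[OF assms] by blast
  obtain A B w where AB: "A \<union> B = - loop p" "A \<inter> B = {}"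
    "connected A" "connected B" "open A" "open B"
    "frontier A = loop p" "frontier B = loop p" "w \<in> \<int>"
    and wA: "\<And>z. z \<in> A \<Longrightarrow> winding_number L z = w + 1"
    and wB: "\<And>z. z \<in> B \<Longrightarrow> winding_number L z = w"
    by (rule Jordan_sides[OF L(1,2), unfolded L(3)]) (rule that)
  have W: "W p z = w + 1" if "z \<in> A" for z
  proof -
    have "z \<notin> loop p" using AB(1) that by blast
    then show ?thesis using L(4) wA[OF that] by simp
  qed
  have W': "W p z = w" if "z \<in> B" for z
  proof -
    have "z \<notin> loop p" using AB(1) that by blast
    then show ?thesis using L(4) wB[OF that] by simp
  qed
  have "loop p \<noteq> {}" using L(3) path_image_nonempty by metis
  then have "B \<noteq> {}" using AB(8) by auto
  then obtain b where b: "b \<in> B" by blast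
  have "z \<in> Left p" if "z \<in> A" for z
    using W[OF that] W'[OF b] b AB(1) that unfolding Left_def by force
  moreover have "z \<notin> Left p" if "z \<in> B" for z
  proof -
    have "\<not> Re (W p z') < Re (W p z)" if "z' \<notin> loop p" for z'
    proof -
      have "z' \<in> A \<or> z' \<in> B" using AB(1) that by blast
      then show ?thesis using W[of z'] W'[of z'] W'[OF \<open>z \<in> B\<close>] by auto
    qed
    then show ?thesis unfolding Left_def by blast
  qed
  moreover have "Left p \<subseteq> A \<union> B" unfolding AB(1) by (auto simp: Left_def)
  ultimately have A: "Left p = A" by blast
  have B: "Right p = B" unfolding Right_def A using AB(1,2) by blast
  show "connected (Left p)" "connected (Right p)" "open (Left p)" "open (Right p)"
    "frontier (Left p) = loop p" "frontier (Right p) = loop p"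
    "\<exists>w\<in>\<int>. (\<forall>z\<in>Left p. W p z = w + 1) \<and> (\<forall>z\<in>Right p. W p z = w)"
    unfolding A B using AB W W' by auto
qed

lemma Right_iff: "z \<in> Right p \<longleftrightarrow> z \<notin> loop p \<and> z \<notin> Left p"
  by (auto simp: Right_def)

lemma Left_notin: "z \<in> Left p \<Longrightarrow> z \<notin> loop p"
  by (simp add: Left_def)

lemma same_side_connected:
  assumes "stpath p" "z \<notin> loop p" "z' \<notin> loop p" "z \<in> Left p \<longleftrightarrow> z' \<in> Left p"
  shows "connected_component (- loop p) z z'"
proof (cases "z \<in> Left p")
  case True
  then have "Left p \<subseteq> connected_component_set (- loop p) z"
    using connected_Left[OF assms(1)] by (intro connected_component_maximal) (auto simp: Left_def)
  then show ?thesis using True assms(4) by blast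
next
  case False
  then have "Right p \<subseteq> connected_component_set (- loop p) z"
    using connected_Right[OF assms(1)] assms(2)
    by (intro connected_component_maximal) (auto simp: Right_def)
  then show ?thesis using False assms by (auto simp: Right_def)
qed

lemma connected_same_side:
  assumes "stpath p" "connected S" "S \<inter> loop p = {}" "z \<in> S" "z' \<in> S"
  shows "z \<in> Left p \<longleftrightarrow> z' \<in> Left p"
proof -
  have "Left p \<inter> Right p \<inter> S = {}" "S \<subseteq> Left p \<union> Right p" using assms(3) by (auto simp: Right_def)
  then have "Left p \<inter> S = {} \<or> Right p \<inter> S = {}"
    using connectedD[OF assms(2) open_Left[OF assms(1)] open_Right[OF assms(1)]] by auto
  then show ?thesis using assms(3,4,5) by (auto simp: Right_def)
qed

lemma W_step:
  assumes "stpath p" "z \<in> Left p" "z' \<in> Right p"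
  shows "W p z = W p z' + 1"
  using W_sides[OF assms(1)] assms by auto

lemma W_same:
  assumes "stpath p" "z \<notin> loop p" "z' \<notin> loop p" "z \<in> Left p \<longleftrightarrow> z' \<in> Left p"
  shows "W p z = W p z'"
  using W_sides[OF assms(1)] assms by (cases "z \<in> Left p") (auto simp: Right_def)

lemma W_Ints:
  assumes "stpath p" "z \<notin> loop p" shows "W p z \<in> \<int>"
  using W_sides[OF assms(1)] assms by (cases "z \<in> Left p") (auto simp: Right_def)

lemma near_loop:
  assumes "stpath p" "y \<in> loop p" "\<epsilon> > 0"
  shows "\<exists>z\<in>Left p. dist z y < \<epsilon>" "\<exists>z\<in>Right p. dist z y < \<epsilon>"
proof -
  have "y \<in> closure (Left p)" "y \<in> closure (Right p)"
    using assms(2) frontier_Left[OF assms(1)] frontier_Right[OF assms(1)]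
    by (auto simp: frontier_def)
  then show "\<exists>z\<in>Left p. dist z y < \<epsilon>" "\<exists>z\<in>Right p. dist z y < \<epsilon>"
    using assms(3) unfolding closure_approachable by blast+
qed

lemma inner_connected: "x \<in> arcs1 \<Longrightarrow> connected (inner x)"
  unfolding inner_def by (intro connected_simple_path_endless arc_imp_simple_path arc_curve)

lemma mem_inner_iff:
  assumes "x \<in> arcs1"
  shows "z \<in> inner x \<longleftrightarrow> (\<exists>t. 0 < t \<and> t < 1 \<and> z = curve x t)"
proof -
  have inj: "inj_on (curve x) {0..1}" using arc_curve[OF assms] by (simp add: arc_def)
  show ?thesis
  proof
    assume "z \<in> inner x"
    then obtain t where "t \<in> {0..1}" "z = curve x t" "z \<noteq> curve x 0" "z \<noteq> curve x 1"
      unfolding inner_def path_image_def pathstart_def pathfinish_def by blast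
    then show "\<exists>t. 0 < t \<and> t < 1 \<and> z = curve x t"
      by (intro exI[of _ t]) (auto simp: less_le)
  next
    assume "\<exists>t. 0 < t \<and> t < 1 \<and> z = curve x t"
    then obtain t where t: "0 < t" "t < 1" "z = curve x t" by blast
    then have "curve x t \<noteq> curve x 0" "curve x t \<noteq> curve x 1"
      using inj_onD[OF inj, of t 0] inj_onD[OF inj, of t 1] by auto
    then show "z \<in> inner x"
      using t unfolding inner_def path_image_def pathstart_def pathfinish_def by auto
  qed
qed

lemma inner_nonempty: "x \<in> arcs1 \<Longrightarrow> inner x \<noteq> {}"
  using mem_inner_iff[of x "curve x (1/2)"] by (auto intro!: exI[of _ "1/2"])

lemma connected_walk: "walk p \<Longrightarrow> connected (\<Union>e\<in>set p. img (Some e))"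
  using walk_arc connected_arc_image by metis

lemma walk_Un_ends:
  assumes "walk p"
  shows "ptail c (hd p) \<in> (\<Union>e\<in>set p. img (Some e))" "phead c (last p) \<in> (\<Union>e\<in>set p. img (Some e))"
proof -
  obtain P where "pathstart P = ptail c (hd p)" "pathfinish P = phead c (last p)"
     "path_image P = (\<Union>e\<in>set p. img (Some e))" using walk_arc[OF assms] by blast
  then show "ptail c (hd p) \<in> (\<Union>e\<in>set p. img (Some e))" "phead c (last p) \<in> (\<Union>e\<in>set p. img (Some e))"
    by (metis pathstart_in_path_image, metis pathfinish_in_path_image)
qed

text \<open>If \<open>x\<close> is the return arc, the path remains. Otherwise the pieces of the
  path before and after \<open>x\<close> both hang on the return arc.\<close>

lemma rest_connected:
  assumes "stpath p" "x \<in> cyc p"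
  shows "connected (loop p - inner x)"
proof -
  have p: "walk p" "ptail c (hd p) = source" "phead c (last p) = sink"
    using assms stpath_iff by auto
  have pE: "Some ` set p \<subseteq> arcs1" using dpath_subset[OF p(1)] by auto
  have loop_eq: "loop p = (\<Union>e\<in>set p. img (Some e)) \<union> img None"
    unfolding loop_def cyc_def by auto
  show ?thesis
  proof (cases x)
    case None
    have "inner None \<inter> img (Some e) = {}" if "e \<in> set p" for e
      using that pE by (intro inner_img) auto
    then have "(\<Union>e\<in>set p. img (Some e)) \<inter> inner None = {}" by blast
    moreover have "img None - inner None \<subseteq> (\<Union>e\<in>set p. img (Some e))"
      using walk_Un_ends[OF p(1)] p(2,3) R_ends unfolding inner_def by auto
    ultimately have "loop p - inner x = (\<Union>e\<in>set p. img (Some e))"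
      unfolding loop_eq None by blast
    then show ?thesis using connected_walk[OF p(1)] by simp
  next
    case (Some e)
    then have "e \<in> set p" using assms(2) by (auto simp: cyc_def)
    then obtain q r where qr: "p = q @ e # r" by (meson split_list)
    define Q where "Q = (\<Union>e\<in>set q. img (Some e))"
    define S where "S = (\<Union>e\<in>set r. img (Some e))"
    have dist: "e \<notin> set q" "e \<notin> set r" using walk_distinct[OF p(1)] qr by auto
    have attach: "connected ((\<Union>e\<in>set r. img (Some e)) \<union> img None)"
      if "walk r" "ptail c (hd r) \<in> img None \<or> phead c (last r) \<in> img None" for r
      using connected_walk[OF that(1)] walk_Un_ends[OF that(1)] that(2) arc_curve[of None]
      by (intro connected_Un connected_arc_image) auto
    have None: "connected (img None)" using arc_curve[of None] by (intro connected_arc_image) auto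
    have Q: "connected (Q \<union> img None) \<and> ptail c e \<in> Q \<union> img None"
    proof (cases "q = []")
      case True
      then have "ptail c e = pathfinish R" using p R_ends qr by auto
      then show ?thesis using None True ends_in_img(2)[of None] by (simp add: Q_def)
    next
      case False
      then have q: "walk q" "phead c (last q) = ptail c e"
        using p(1) unfolding qr by (auto simp: dpath_append)
      have "ptail c (hd q) = pathfinish R" using p R_ends qr False by simp
      then show ?thesis
        using attach[OF q(1)] walk_Un_ends(2)[OF q(1)] q(2) ends_in_img(2)[of None]
        unfolding Q_def by auto
    qed
    have S: "connected (S \<union> img None) \<and> phead c e \<in> S \<union> img None"
    proof (cases "r = []")
      case True
      then have "phead c e = pathstart R" using p R_ends qr by auto
      then show ?thesis using None True ends_in_img(1)[of None] by (simp add: S_def)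
    next
      case False
      then have r: "walk r" "phead c e = ptail c (hd r)"
        using p(1) dpath_append[of "q @ [e]" r] qr by auto
      have "phead c (last r) = pathstart R" using p R_ends qr False by simp
      then show ?thesis
        using attach[OF r(1)] walk_Un_ends(1)[OF r(1)] r(2) ends_in_img(1)[of None]
        unfolding S_def by auto
    qed
    have "inner (Some e) \<inter> img y = {}" if "y \<in> insert None (Some ` (set q \<union> set r))" for y
      using that pE dist qr by (intro inner_img) auto
    then have "(Q \<union> img None \<union> (S \<union> img None)) \<inter> inner (Some e) = {}"
      unfolding Q_def S_def by blast
    moreover have "img (Some e) - inner (Some e) \<subseteq> Q \<union> img None \<union> (S \<union> img None)"
      using Q S unfolding inner_def ptail_start phead_finish by blast
    moreover have "loop p = Q \<union> S \<union> img (Some e) \<union> img None"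
      unfolding loop_eq Q_def S_def by (auto simp: qr)
    moreover have "inner (Some e) \<subseteq> img (Some e)" by (auto simp: inner_def)
    ultimately have "loop p - inner x = (Q \<union> img None) \<union> (S \<union> img None)" unfolding Some by blast
    moreover have "connected ((Q \<union> img None) \<union> (S \<union> img None))"
      by (rule connected_Un[OF conjunct1[OF Q] conjunct1[OF S]]) (use ends_in_img(1)[of None] in auto)
    ultimately show ?thesis by simp
  qed
qed

section \<open>The two facets along a single arc\<close>

lemma nbhd_component:
  assumes "x \<in> arcs1" "y \<in> inner x"
  shows "nbhd x = connected_component_set (- Kminus x) y"
proof -
  have "connected_component (- Kminus x) y y'" if "y' \<in> inner x" for y'
    unfolding connected_component_def
    using inner_connected[OF assms(1)] Kminus_inner[OF assms(1)] assms(2) that by blast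
  then show ?thesis
    unfolding nbhd_def using assms(2) by (auto intro: connected_component_trans)
qed

lemma open_nbhd: "x \<in> arcs1 \<Longrightarrow> open (nbhd x)"
  and connected_nbhd: "x \<in> arcs1 \<Longrightarrow> connected (nbhd x)"
  and nbhd_Kminus: "x \<in> arcs1 \<Longrightarrow> nbhd x \<inter> Kminus x = {}"
  and inner_nbhd: "x \<in> arcs1 \<Longrightarrow> inner x \<subseteq> nbhd x"
proof -
  assume x: "x \<in> arcs1"
  obtain y where y: "y \<in> inner x" using inner_nonempty[OF x] by blast
  note eq = nbhd_component[OF x]
  have "closed (Kminus x)" using compact_Kminus compact_imp_closed by blast
  then show "open (nbhd x)" "connected (nbhd x)"
    unfolding eq[OF y] by (auto intro: open_connected_component)
  show "nbhd x \<inter> Kminus x = {}"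
    unfolding eq[OF y] using connected_component_subset[of "- Kminus x" y] by blast
  show "inner x \<subseteq> nbhd x"
    using eq Kminus_inner[OF x] connected_component_refl[of _ "- Kminus x"] by blast
qed

lemma nbhd_K: "x \<in> arcs1 \<Longrightarrow> z \<in> nbhd x \<Longrightarrow> z \<in> K \<longleftrightarrow> z \<in> inner x"
  using nbhd_Kminus[of x] K_minus_inner[of x] Kminus_Un[of x] by (auto simp: inner_def simp del: insert_iff)

lemma inner_loop: "x \<in> cyc p \<Longrightarrow> inner x \<subseteq> loop p"
  unfolding inner_def loop_def by blast

text \<open>Janiszewski's theorem for \<open>loop p\<close> and \<open>Kminus x\<close>. They
  intersect in the loop without the open arc \<open>x\<close>, which is connected, and their union
  is \<open>K\<close>; two points separated by neither set are not separated by the union.\<close>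

lemma facet_near_arc:
  assumes p: "stpath p" "x \<in> cyc p" and z: "z \<in> nbhd x - K" "z' \<in> nbhd x - K"
    and "z \<in> Left p \<longleftrightarrow> z' \<in> Left p"
  shows "connected_component (- K) z z'"
proof -
  have x: "x \<in> arcs1" using cyc_subset p by blast
  have "loop p \<inter> Kminus x = loop p - inner x"
    using K_minus_inner[OF x] loop_subset[OF p(1)] by blast
  then have 1: "connected (loop p \<inter> Kminus x)" using rest_connected[OF p] by simp
  have 2: "connected_component (- loop p) z z'"
    using loop_subset[OF p(1)] z assms(5) by (intro same_side_connected p(1)) blast+
  have 3: "connected_component (- Kminus x) z z'"
    unfolding connected_component_def
    using connected_nbhd[OF x] nbhd_Kminus[OF x] z by (intro exI[of _ "nbhd x"]) blast
  have "closed (Kminus x)" using compact_Kminus compact_imp_closed by blast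
  from Janiszewski[OF compact_loop[OF p(1)] this 1 2 3]
  have "connected_component (- (loop p \<union> Kminus x)) z z'" .
  moreover have "img x \<subseteq> loop p" using p(2) by (auto simp: loop_def)
  then have "loop p \<union> Kminus x = K"
    using Kminus_Un[OF x] loop_subset[OF p(1)] Kminus_subset[of x] by blast
  ultimately show ?thesis by simp
qed

lemma nbhd_off_loop:
  assumes p: "stpath p" "x \<in> arcs1" "x \<notin> cyc p" and z: "z \<in> nbhd x" "z' \<in> nbhd x"
  shows "z \<in> Left p \<longleftrightarrow> z' \<in> Left p"
proof (rule connected_same_side[OF p(1) connected_nbhd[OF p(2)]])
  have "loop p \<subseteq> Kminus x" unfolding loop_def Kminus_def
    using cyc_subset[OF p(1)] p(3) by (intro UN_mono) auto
  then show "nbhd x \<inter> loop p = {}" using nbhd_Kminus[OF p(2)] by blast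
qed (use z in auto)

lemma near_inner:
  assumes p: "stpath p" "x \<in> cyc p" and "y \<in> inner x" "\<epsilon> > 0"
  shows "\<exists>z\<in>nbhd x - K. z \<in> Left p \<and> dist z y < \<epsilon>" "\<exists>z\<in>nbhd x - K. z \<in> Right p \<and> dist z y < \<epsilon>"
proof -
  have x: "x \<in> arcs1" using cyc_subset p by blast
  have "y \<in> nbhd x" using inner_nbhd[OF x] assms by blast
  then obtain d where d: "d > 0" "ball y d \<subseteq> nbhd x"
    using open_nbhd[OF x] open_contains_ball by blast
  have off: "z \<in> nbhd x - K" if "z \<notin> loop p" "dist z y < min \<epsilon> d" for z
  proof -
    have "z \<in> nbhd x" using d that by (auto simp: dist_commute)
    then show ?thesis using nbhd_K[OF x] that(1) inner_loop[OF p(2)] by blast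
  qed
  have "y \<in> loop p" using inner_loop[OF p(2)] assms by blast
  then obtain z z' where "z \<in> Left p" "dist z y < min \<epsilon> d" "z' \<in> Right p" "dist z' y < min \<epsilon> d"
    using near_loop[OF p(1), of y "min \<epsilon> d"] assms d by auto
  then show "\<exists>z\<in>nbhd x - K. z \<in> Left p \<and> dist z y < \<epsilon>" "\<exists>z\<in>nbhd x - K. z \<in> Right p \<and> dist z y < \<epsilon>"
    using off[of z] off[of z'] by (auto simp: Right_def Left_notin)
qed

text \<open>Two loops through the same arc traverse it in the same direction, so near the arc their
  winding numbers differ by a continuous integer-valued function.\<close>

lemma W_diff_constant:
  assumes p: "stpath p" "x \<in> cyc p" and q: "finite Q" "x \<in> Q" "Q \<subseteq> arcs1"
    and int: "\<And>z. z \<in> nbhd x - K \<Longrightarrow> (\<Sum>y\<in>Q. winding_number (curve y) z) \<in> \<int>"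
    and z: "z \<in> nbhd x - K" "z' \<in> nbhd x - K"
  shows "W p z - W p z' = (\<Sum>y\<in>Q. winding_number (curve y) z) - (\<Sum>y\<in>Q. winding_number (curve y) z')"
proof -
  have x: "x \<in> arcs1" using cyc_subset p by blast
  define f where "f S z = (\<Sum>y\<in>S - {x}. winding_number (curve y) z)" for S z
  have fin: "finite (cyc p)" by (simp add: cyc_def)
  have W: "W p z = winding_number (curve x) z + f (cyc p) z" for z
    unfolding W_def f_def using sum.remove[OF fin p(2)] by simp
  have W': "(\<Sum>y\<in>Q. winding_number (curve y) z) = winding_number (curve x) z + f Q z" for z
    unfolding f_def using sum.remove[OF q(1,2)] by simp
  \<comment> \<open>With \<open>x\<close> taken out, the remaining arcs avoid \<open>nbhd x\<close>,
    so these sums are continuous across \<open>x\<close>.\<close>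
  have cont: "continuous_on (nbhd x) (f S)" if "S \<subseteq> arcs1" for S
    unfolding f_def
  proof (intro continuous_on_sum)
    fix y assume y: "y \<in> S - {x}"
    then have "img y \<subseteq> Kminus x" using that unfolding Kminus_def by blast
    then have "nbhd x \<subseteq> - img y" using nbhd_Kminus[OF x] by blast
    moreover have "path (curve y)" using y that by (intro path_curve) blast
    ultimately show "continuous_on (nbhd x) (winding_number (curve y))"
      using continuous_on_winding_number continuous_on_subset by blast
  qed
  have eq: "f (cyc p) z - f Q z = f (cyc p) z' - f Q z'"
  proof (rule integer_valued_constant[OF connected_nbhd[OF x], where q = "\<lambda>z. f (cyc p) z - f Q z"])
    show "continuous_on (nbhd x) (\<lambda>z. f (cyc p) z - f Q z)"
      using cont cyc_subset[OF p(1)] q(3) by (intro continuous_on_diff) auto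
    fix y \<epsilon> assume y: "y \<in> nbhd x" "\<epsilon> > (0::real)"
    have "\<exists>z\<in>nbhd x - K. dist z y < \<epsilon>"
    proof (cases "y \<in> K")
      case True
      then have "y \<in> inner x" using nbhd_K[OF x y(1)] by simp
      then show ?thesis using near_inner(1)[OF p _ y(2)] by blast
    next
      case False
      then show ?thesis using y by (intro bexI[of _ y]) auto
    qed
    then obtain u where u: "u \<in> nbhd x - K" "dist u y < \<epsilon>" by blast
    have "W p u - (\<Sum>y\<in>Q. winding_number (curve y) u) \<in> \<int>"
      using int[OF u(1)] u(1) loop_subset[OF p(1)] by (intro Ints_diff W_Ints p(1)) auto
    then show "\<exists>z\<in>nbhd x. dist z y < \<epsilon> \<and> f (cyc p) z - f Q z \<in> \<int>"
      unfolding W W' using u by (intro bexI[of _ u]) auto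
  qed (use z in auto)
  then show ?thesis unfolding W W' by (simp add: algebra_simps)
qed

text \<open>Near \<open>x\<close> the functions \<open>W p\<close> and \<open>W q\<close> differ by
  a constant. The step of 1 from a point \<open>r\<close> on the right of \<open>p\<close> to a
  point \<open>l\<close> on the left therefore also occurs for \<open>q\<close>, which fixes the
  sides of \<open>q\<close>. So "left of an edge" does not depend on the path through it.\<close>

lemma Left_independent:
  assumes p: "stpath p" "x \<in> cyc p" and q: "stpath q" "x \<in> cyc q" and z: "z \<in> nbhd x - K"
  shows "z \<in> Left p \<longleftrightarrow> z \<in> Left q"
proof -
  have x: "x \<in> arcs1" using cyc_subset p by blast
  have notloop: "z \<notin> loop p" "z \<notin> loop q" if "z \<in> nbhd x - K" for z
    using that loop_subset[OF p(1)] loop_subset[OF q(1)] by auto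
  have diff: "W p z - W p z' = W q z - W q z'" if "z \<in> nbhd x - K" "z' \<in> nbhd x - K" for z z'
    unfolding W_def[of q]
  proof (rule W_diff_constant[OF p _ q(2) cyc_subset[OF q(1)] _ that])
    show "(\<Sum>y\<in>cyc q. winding_number (curve y) z) \<in> \<int>" if "z \<in> nbhd x - K" for z
      using W_Ints[OF q(1) notloop(2)[OF that]] unfolding W_def .
  qed (simp add: cyc_def)
  obtain y where y: "y \<in> inner x" using inner_nonempty[OF x] by blast
  obtain l where l: "l \<in> nbhd x - K" "l \<in> Left p" using near_inner(1)[OF p y, of 1] by auto
  obtain r where r: "r \<in> nbhd x - K" "r \<in> Right p" using near_inner(2)[OF p y, of 1] by auto
  have "W q l = W q r + 1" using diff[OF l(1) r(1)] W_step[OF p(1) l(2) r(2)] by (simp add: algebra_simps)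
  then have "Re (W q l) = Re (W q r) + 1" by simp
  have lq: "l \<in> Left q"
    using \<open>W q l = W q r + 1\<close> notloop(2)[OF l(1)] notloop(2)[OF r(1)] unfolding Left_def by force
  have rq: "r \<in> Right q"
  proof (rule ccontr)
    assume "r \<notin> Right q"
    then have "r \<in> Left q" using notloop(2)[OF r(1)] by (auto simp: Right_def)
    then show False using W_same[OF q(1), of l r] lq notloop(2) l(1) r(1) \<open>W q l = W q r + 1\<close> by auto
  qed
  show ?thesis
  proof
    assume "z \<in> Left p"
    then have "W p z = W p l" using W_same[OF p(1)] l notloop z by simp
    then have "W q z = W q l" using diff[OF z l(1)] by simp
    then show "z \<in> Left q" using W_step[OF q(1) lq, of z] notloop(2)[OF z] by (auto simp: Right_def)
  next
    assume "z \<in> Left q"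
    then have "W q z = W q l" using W_same[OF q(1)] l lq notloop z by simp
    then have "W p z = W p l" using diff[OF z l(1)] by simp
    then show "z \<in> Left p" using W_step[OF p(1) l(2), of z] notloop(1)[OF z] by (auto simp: Right_def)
  qed
qed

subsection \<open>Facets of the closed graph\<close>

lemma arc_in_cyc:
  assumes "x \<in> arcs1" obtains p where "stpath p" "x \<in> cyc p"
proof (cases x)
  case None
  obtain e where "e \<in> E" using source_iff[OF sink_in] by auto
  then obtain p where "stpath p" by (rule edge_in_stpath)
  then show ?thesis using that[of p] None by (simp add: cyc_def)
next
  case (Some e)
  then have "e \<in> E" using assms by auto
  then obtain p where "stpath p" "e \<in> set p" by (rule edge_in_stpath)
  then show ?thesis using that[of p] Some by (simp add: cyc_def)
qed

text \<open>Formally a union over all paths through \<open>x\<close> and all nearby points on their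
  left. By \<open>left_facet_eq\<close> all choices lead to one and the same component.\<close>

definition left_facet :: "'e option \<Rightarrow> complex set" where
  "left_facet x = {z. \<exists>p. stpath p \<and> x \<in> cyc p \<and>
     (\<exists>y\<in>nbhd x - K. y \<in> Left p \<and> connected_component (- K) y z)}"
definition right_facet :: "'e option \<Rightarrow> complex set" where
  "right_facet x = {z. \<exists>p. stpath p \<and> x \<in> cyc p \<and>
     (\<exists>y\<in>nbhd x - K. y \<in> Right p \<and> connected_component (- K) y z)}"

lemma left_facet_eq:
  assumes p: "stpath p" "x \<in> cyc p" and y: "y \<in> nbhd x - K" "y \<in> Left p"
  shows "left_facet x = connected_component_set (- K) y"
proof -
  have "connected_component (- K) y y'"
    if "stpath q" "x \<in> cyc q" "y' \<in> nbhd x - K" "y' \<in> Left q" for q y'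
    using facet_near_arc[OF p y(1) that(3)] Left_independent[OF p that(1-3)] that(4) y(2) by blast
  then show ?thesis
    unfolding left_facet_def using p y connected_component_trans by blast
qed

lemma right_facet_eq:
  assumes p: "stpath p" "x \<in> cyc p" and y: "y \<in> nbhd x - K" "y \<in> Right p"
  shows "right_facet x = connected_component_set (- K) y"
proof -
  have "connected_component (- K) y y'"
    if q: "stpath q" "x \<in> cyc q" "y' \<in> nbhd x - K" "y' \<in> Right q" for q y'
  proof -
    have "y' \<notin> Left p" using Left_independent[OF p q(1-3)] q(4) by (simp add: Right_iff)
    moreover have "y \<notin> Left p" using y(2) by (simp add: Right_iff)
    ultimately show ?thesis using facet_near_arc[OF p y(1) q(3)] by blast
  qed
  then show ?thesis
    unfolding right_facet_def using p y connected_component_trans by blast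
qed

lemma facets_components:
  assumes "x \<in> arcs1"
  shows "left_facet x \<in> components (- K)" "right_facet x \<in> components (- K)"
proof -
  obtain p where p: "stpath p" "x \<in> cyc p" using assms by (rule arc_in_cyc)
  obtain y where y: "y \<in> inner x" using inner_nonempty[OF assms] by blast
  obtain l where "l \<in> nbhd x - K" "l \<in> Left p" using near_inner(1)[OF p y, of 1] by auto
  then show "left_facet x \<in> components (- K)"
    using left_facet_eq[OF p] by (auto intro: componentsI)
  obtain r where "r \<in> nbhd x - K" "r \<in> Right p" using near_inner(2)[OF p y, of 1] by auto
  then show "right_facet x \<in> components (- K)"
    using right_facet_eq[OF p] by (auto intro: componentsI)
qed

lemma component_same_side:
  assumes "stpath p" "C \<in> components (- K)" "z \<in> C" "z' \<in> C"
  shows "z \<in> Left p \<longleftrightarrow> z' \<in> Left p"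
proof (rule connected_same_side[OF assms(1)])
  show "connected C" using assms(2) by (rule in_components_connected)
  show "C \<inter> loop p = {}" using in_components_subset[OF assms(2)] loop_subset[OF assms(1)] by blast
qed (use assms in auto)

lemma facet_sides:
  assumes "stpath p" "x \<in> cyc p"
  shows "left_facet x \<subseteq> Left p" "right_facet x \<inter> Left p = {}"
proof -
  have x: "x \<in> arcs1" using cyc_subset assms by blast
  obtain y where y: "y \<in> inner x" using inner_nonempty[OF x] by blast
  obtain l where l: "l \<in> nbhd x - K" "l \<in> Left p" using near_inner(1)[OF assms y, of 1] by auto
  then have "l \<in> left_facet x" using left_facet_eq[OF assms l] by simp
  then show "left_facet x \<subseteq> Left p"
    using component_same_side[OF assms(1) facets_components(1)[OF x]] l by blast
  obtain r where r: "r \<in> nbhd x - K" "r \<in> Right p" using near_inner(2)[OF assms y, of 1] by auto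
  then have "r \<in> right_facet x" using right_facet_eq[OF assms r] by simp
  then show "right_facet x \<inter> Left p = {}"
    using component_same_side[OF assms(1) facets_components(2)[OF x]] r Right_iff by blast
qed

lemma facet_touching:
  assumes p: "stpath p" "x \<in> cyc p" and C: "C \<in> components (- K)" "z \<in> C" "z \<in> nbhd x"
  shows "z \<in> Left p \<Longrightarrow> C = left_facet x" "z \<notin> Left p \<Longrightarrow> C = right_facet x"
proof -
  have z: "z \<in> nbhd x - K" using C in_components_subset by blast
  then have "z \<notin> loop p" using loop_subset[OF p(1)] by blast
  show "z \<in> Left p \<Longrightarrow> C = left_facet x"
    using left_facet_eq[OF p z] component_containing[OF C(1,2)] by simp
  assume "z \<notin> Left p"
  then have "z \<in> Right p" using \<open>z \<notin> loop p\<close> by (simp add: Right_iff)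
  then show "C = right_facet x" using right_facet_eq[OF p z] component_containing[OF C(1,2)] by simp
qed

lemma facet_near:
  assumes "x \<in> arcs1" "y \<in> inner x" "\<epsilon> > 0"
  shows "\<exists>z\<in>left_facet x. z \<in> nbhd x \<and> dist z y < \<epsilon>" "\<exists>z\<in>right_facet x. z \<in> nbhd x \<and> dist z y < \<epsilon>"
proof -
  obtain p where p: "stpath p" "x \<in> cyc p" using assms(1) by (rule arc_in_cyc)
  obtain l where l: "l \<in> nbhd x - K" "l \<in> Left p" "dist l y < \<epsilon>"
    using near_inner(1)[OF p assms(2,3)] by blast
  then show "\<exists>z\<in>left_facet x. z \<in> nbhd x \<and> dist z y < \<epsilon>"
    using left_facet_eq[OF p l(1,2)] by (intro bexI[of _ l]) auto
  obtain r where r: "r \<in> nbhd x - K" "r \<in> Right p" "dist r y < \<epsilon>"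
    using near_inner(2)[OF p assms(2,3)] by blast
  then show "\<exists>z\<in>right_facet x. z \<in> nbhd x \<and> dist z y < \<epsilon>"
    using right_facet_eq[OF p r(1,2)] by (intro bexI[of _ r]) auto
qed

lemma facet_off_loop:
  assumes p: "stpath p" "x \<in> arcs1" "x \<notin> cyc p"
  shows "left_facet x \<subseteq> Left p \<longleftrightarrow> right_facet x \<subseteq> Left p"
proof -
  obtain y where y: "y \<in> inner x" using inner_nonempty[OF p(2)] by blast
  obtain l where l: "l \<in> left_facet x" "l \<in> nbhd x" using facet_near(1)[OF p(2) y, of 1] by auto
  obtain r where r: "r \<in> right_facet x" "r \<in> nbhd x" using facet_near(2)[OF p(2) y, of 1] by auto
  have "l \<in> Left p \<longleftrightarrow> r \<in> Left p" by (rule nbhd_off_loop[OF p l(2) r(2)])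
  then show ?thesis
    using component_same_side[OF p(1) facets_components(1)[OF p(2)]] l(1)
      component_same_side[OF p(1) facets_components(2)[OF p(2)]] r(1) by blast
qed

text \<open>The edges \<open>pred v\<close> form a tree rooted at the source; the return arc \<open>R\<close> attaches the sink.\<close>

lemma connected_tree_complement:
  assumes pred: "\<And>v. v \<in> V - {source, sink} \<Longrightarrow> pred v \<in> E \<and> phead c (pred v) = v"
    and "finite S" "S \<subseteq> V - {source, sink}"
  shows "connected (- (img None \<union> (\<Union>v\<in>S. img (Some (pred v)))))"
  using assms(2,3)
proof (induction S rule: finite_ranking_induct[where f = level])
  case empty
  have "connected (- img None)" using arc_curve[of None] by (intro connected_arc_complement) auto
  then show ?case by simp
next
  case (insert v S)
  define T where "T = img None \<union> (\<Union>v\<in>S. img (Some (pred v)))"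
  have v: "v \<in> V" "v \<noteq> source" "v \<noteq> sink" "pred v \<in> E" "phead c (pred v) = v"
    using pred[of v] insert by auto
  show ?case
  proof (cases "v \<in> S")
    case True
    then show ?thesis using insert by (simp add: insert_absorb)
  next
    case False
    \<comment> \<open>Edges enter the tree in order of increasing level of their heads. The new head
      \<open>v\<close> is then on no earlier arc: it is not an end of \<open>R\<close>, the earlier
      heads are other vertices, and the earlier tails have smaller level.\<close>
    have one: "img (Some (pred v)) \<inter> img x \<subseteq> {ptail c (pred v)}"
      if x: "x \<in> insert None ((Some \<circ> pred) ` S)" for x
    proof -
      have x1: "x \<in> arcs1" and "v \<noteq> pathstart (curve x) \<and> v \<noteq> pathfinish (curve x) \<and> x \<noteq> Some (pred v)"
      proof -
        consider "x = None" | u where "x = Some (pred u)" "u \<in> S" using x by auto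
        then have "x \<in> arcs1 \<and> v \<noteq> pathstart (curve x) \<and> v \<noteq> pathfinish (curve x) \<and> x \<noteq> Some (pred v)"
        proof cases
          case 1
          then show ?thesis using v R_ends by auto
        next
          case u: 2
          then have pu: "pred u \<in> E" "phead c (pred u) = u" using pred[of u] insert by auto
          have "level (ptail c (pred u)) < level v"
            using level_less[OF pu(1)] pu(2) insert(2)[OF u(2)] by simp
          then have "ptail c (pred u) \<noteq> v" by auto
          moreover have "u \<noteq> v" using u(2) False by auto
          ultimately show ?thesis using u pu v(5) by (auto simp: ptail_def phead_def)
        qed
        then show "x \<in> arcs1" "v \<noteq> pathstart (curve x) \<and> v \<noteq> pathfinish (curve x) \<and> x \<noteq> Some (pred v)"
          by auto
      qed
      then show ?thesis
        using img_Int[of "Some (pred v)" x] v(4,5) unfolding ptail_start phead_finish by auto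
    qed
    have "img (Some (pred v)) \<inter> T \<subseteq> {ptail c (pred v)}"
    proof -
      have "img (Some (pred v)) \<inter> img None \<subseteq> {ptail c (pred v)}" by (rule one) simp
      moreover have "img (Some (pred v)) \<inter> img (Some (pred u)) \<subseteq> {ptail c (pred v)}" if "u \<in> S" for u
        by (rule one) (use that in simp)
      ultimately show ?thesis unfolding T_def by blast
    qed
    \<comment> \<open>The new arc meets the old set in at most one point, so by Janiszewski's
      theorem the complement of the union is still connected.\<close>
    then have "connected (img (Some (pred v)) \<inter> T)"
      using connected_sing connected_empty by (metis subset_singletonD)
    moreover have "compact (img (Some (pred v)))" using v(4) by (intro compact_img) auto
    moreover have "closed T"
    proof -
      have "closed (img (Some (pred u)))" if "u \<in> S" for u
        using pred[of u] insert that by (intro compact_imp_closed compact_img) auto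
      moreover have "closed (img None)" by (intro compact_imp_closed compact_img) simp
      ultimately show ?thesis unfolding T_def using \<open>finite S\<close> by (intro closed_Un closed_UN) auto
    qed
    moreover have "connected (- img (Some (pred v)))"
      using v(4) by (intro connected_arc_complement arc_curve) auto
    moreover have "connected (- T)" unfolding T_def using insert by auto
    ultimately have "connected (- (img (Some (pred v)) \<union> T))" by (intro Janiszewski_connected)
    moreover have "img (Some (pred v)) \<union> T = img None \<union> (\<Union>v\<in>insert v S. img (Some (pred v)))"
      unfolding T_def by blast
    ultimately show ?thesis by (simp only:)
  qed
qed

text \<open>The function \<open>h\<close> extends to a locally constant function on the complement of the tree.\<close>

lemma facet_function_constant:
  fixes h :: "complex set \<Rightarrow> 'g"
  assumes pred: "\<And>v. v \<in> V - {source, sink} \<Longrightarrow> pred v \<in> E \<and> phead c (pred v) = v"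
    and h: "\<And>e. e \<in> E - pred ` (V - {source, sink}) \<Longrightarrow> h (left_facet (Some e)) = h (right_facet (Some e))"
    and C: "C \<in> components (- K)" "C' \<in> components (- K)"
  shows "h C = h C'"
proof -
  let ?S = "V - {source, sink}"
  define M where "M = - (img None \<union> (\<Union>v\<in>?S. img (Some (pred v))))"
  \<comment> \<open>On an open arc \<open>H\<close> takes the value of the left facet, which off the
    tree is also that of the right facet. \<open>M\<close> contains no vertices, so at points of
    \<open>M\<close> on \<open>K\<close> the arc chosen by \<open>SOME\<close> is unique.\<close>
  define H where "H z = (if z \<in> K then h (left_facet (SOME x. x \<in> arcs1 \<and> z \<in> inner x))
     else h (connected_component_set (- K) z))" for z
  have "v \<notin> M" if "v \<in> V" for v
  proof (cases "v \<in> ?S")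
    case True
    then have "v \<in> img (Some (pred v))"
      using pred ends_in_img(2)[of "Some (pred v)"] unfolding phead_finish by force
    then show ?thesis using True unfolding M_def by blast
  next
    case False
    then have "v \<in> img None" using that R_ends ends_in_img[of None] by auto
    then show ?thesis unfolding M_def by blast
  qed
  then have inner: "\<exists>e\<in>E - pred ` ?S. z \<in> inner (Some e)" if z: "z \<in> M" "z \<in> K" for z
  proof -
    obtain x where x: "x \<in> arcs1" "z \<in> img x" using z(2) unfolding K_def by blast
    then have "z \<in> inner x" using ends_in[OF x(1)] \<open>\<And>v. v \<in> V \<Longrightarrow> v \<notin> M\<close> z(1) unfolding inner_def by blast
    moreover have "x \<noteq> None" "x \<notin> Some ` pred ` ?S" using x z(1) unfolding M_def by blast+
    ultimately show ?thesis using x(1) by auto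
  qed
  have some: "(SOME x. x \<in> arcs1 \<and> z \<in> inner x) = y" if y: "y \<in> arcs1" "z \<in> inner y" for y z
  proof (rule some_equality)
    fix x assume "x \<in> arcs1 \<and> z \<in> inner x"
    then show "x = y" using inner_img[of x y] y unfolding inner_def by blast
  qed (use y in auto)
  have "H constant_on M"
  proof (rule locally_constant_imp_constant)
    show "connected M" unfolding M_def by (intro connected_tree_complement pred) auto
    fix z assume z: "z \<in> M"
    have "\<exists>U. open U \<and> z \<in> U \<and> (\<forall>w\<in>U. H w = H z)"
    proof (cases "z \<in> K")
      case True
      then obtain e where e: "e \<in> E - pred ` ?S" "z \<in> inner (Some e)" using inner z by blast
      then have x: "Some e \<in> arcs1" by auto
      obtain p where p: "stpath p" "Some e \<in> cyc p" using x by (rule arc_in_cyc)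
      have "H w = h (left_facet (Some e))" if w: "w \<in> nbhd (Some e)" for w
      proof (cases "w \<in> K")
        case True
        then show ?thesis using nbhd_K[OF x w] some[OF x] unfolding H_def by simp
      next
        case False
        then have C: "connected_component_set (- K) w \<in> components (- K)"
          "w \<in> connected_component_set (- K) w" by (auto intro: componentsI)
        have "h (connected_component_set (- K) w) = h (left_facet (Some e))"
        proof (cases "w \<in> Left p")
          case True
          then show ?thesis using facet_touching(1)[OF p C w] by simp
        next
          case False
          then show ?thesis using facet_touching(2)[OF p C w] h[OF e(1)] by simp
        qed
        then show ?thesis using False by (simp add: H_def)
      qed
      moreover have "z \<in> nbhd (Some e)" using inner_nbhd[OF x] e by blast
      ultimately show ?thesis using open_nbhd[OF x] by metis
    next
      case False
      let ?U = "connected_component_set (- K) z"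
      have "open ?U"
        by (rule open_connected_component) (simp add: open_Compl compact_imp_closed compact_K)
      moreover have "H w = H z" if w: "w \<in> ?U" for w
      proof -
        have "w \<notin> K" using w connected_component_subset[of "- K" z] by blast
        moreover have "connected_component_set (- K) w = ?U" using w by (metis connected_component_eq)
        ultimately show ?thesis using False by (simp add: H_def)
      qed
      moreover have "z \<in> ?U" using False by simp
      ultimately show ?thesis by blast
    qed
    then obtain U where "open U" "z \<in> U" "\<forall>w\<in>U. H w = H z" by blast
    then show "\<exists>T. openin (top_of_set M) T \<and> z \<in> T \<and> (\<forall>w\<in>T. H w = H z)"
      using z openin_open_Int[of U M] by blast
  qed
  moreover have "\<exists>z\<in>M. H z = h D" if D: "D \<in> components (- K)" for D
  proof -
    obtain z where z: "z \<in> D" using in_components_nonempty[OF D] by blast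
    have "z \<notin> K" using in_components_subset[OF D] z by blast
    moreover have "img None \<union> (\<Union>v\<in>?S. img (Some (pred v))) \<subseteq> K"
    proof -
      have "img (Some (pred v)) \<subseteq> K" if "v \<in> ?S" for v
        using pred[OF that] unfolding K_def by auto
      moreover have "img None \<subseteq> K" unfolding K_def by auto
      ultimately show ?thesis by blast
    qed
    then have "- K \<subseteq> M" unfolding M_def by blast
    ultimately have "z \<in> M" "H z = h D" using component_containing[OF D z] unfolding H_def by auto
    then show ?thesis by blast
  qed
  ultimately obtain k where k: "\<And>z. z \<in> M \<Longrightarrow> H z = k"
    and ex: "\<And>D. D \<in> components (- K) \<Longrightarrow> \<exists>z\<in>M. H z = h D"
    unfolding constant_on_def by blast
  show ?thesis using ex[OF C(1)] ex[OF C(2)] k by auto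
qed

end

subsection \<open>Inversion\<close>

text \<open>A logarithm of \<open>p - z\<close> exists along the contractible parameter interval,
  and its increment gives the winding number of any path, closed or not.\<close>

lemma path_logarithm:
  assumes "path p" "z \<notin> path_image p"
  obtains q where "path q" "\<And>t. t \<in> {0..1} \<Longrightarrow> p t - z = exp (q t)"
    "winding_number p z = (pathfinish q - pathstart q) / (2 * complex_of_real pi * \<i>)"
proof -
  have "continuous_on {0..1} (\<lambda>t. p t - z)"
    using assms(1) by (intro continuous_intros) (simp add: path_def)
  moreover have "contractible {0..1::real}" by (simp add: convex_imp_contractible)
  moreover have "p t - z \<noteq> 0" if "t \<in> {0..1}" for t
    using assms(2) that unfolding path_image_def by auto
  ultimately obtain q where q: "continuous_on {0..1} q" "\<And>t. t \<in> {0..1} \<Longrightarrow> p t - z = exp (q t)"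
    by (rule continuous_logarithm_on_contractible) blast+
  have "path q" using q(1) by (simp add: path_def)
  have "winding_number p z = winding_number (\<lambda>t. p t - z) 0" by (rule winding_number_offset)
  also have "\<dots> = winding_number (exp \<circ> q) 0"
    by (rule winding_number_cong) (use q(2) in auto)
  finally show ?thesis using winding_number_compose_exp[OF \<open>path q\<close>] by (intro that[OF \<open>path q\<close> q(2)]) auto
qed

locale inversion =
  fixes z0 :: complex
begin

text \<open>Since \<open>inverse 0 = 0\<close>, this is a bijection of the whole plane that takes
  \<open>z0\<close> to 0, although it is discontinuous at \<open>z0\<close>. Hence
  \<open>uninv_inv0\<close> and \<open>inv0_uninv\<close> hold without side conditions.\<close>

definition inv0 :: "complex \<Rightarrow> complex" where "inv0 z = inverse (z - z0)"
definition uninv :: "complex \<Rightarrow> complex" where "uninv w = z0 + inverse w"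

lemma uninv_inv0 [simp]: "uninv (inv0 z) = z" and inv0_uninv [simp]: "inv0 (uninv z) = z"
  by (simp_all add: uninv_def inv0_def)

lemma inv0_eq_iff [simp]: "inv0 z = inv0 w \<longleftrightarrow> z = w"
  by (metis uninv_inv0)

lemma inv0_zero_iff [simp]: "inv0 z = 0 \<longleftrightarrow> z = z0"
  by (simp add: inv0_def)

lemma inj_inv0: "inj_on inv0 S"
  by (simp add: inj_on_def)

lemma continuous_inv0: "z0 \<notin> S \<Longrightarrow> continuous_on S inv0"
  unfolding inv0_def by (intro continuous_intros) auto

lemma continuous_uninv: "0 \<notin> S \<Longrightarrow> continuous_on S uninv"
  unfolding uninv_def by (intro continuous_intros) auto

lemma inv0_image_iff: "w \<in> inv0 ` S \<longleftrightarrow> uninv w \<in> S"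
  by (metis imageE imageI inv0_uninv uninv_inv0)

lemma path_inv0: "path p \<Longrightarrow> z0 \<notin> path_image p \<Longrightarrow> path (inv0 \<circ> p)"
  by (intro path_continuous_image continuous_inv0)

lemma arc_inv0: "arc p \<Longrightarrow> z0 \<notin> path_image p \<Longrightarrow> arc (inv0 \<circ> p)"
  using path_inv0 unfolding arc_def by (auto intro: comp_inj_on inj_inv0)

text \<open>The path need not be closed; its winding numbers are then complex.\<close>

lemma winding_number_inv0:
  assumes "path p" "z \<notin> path_image p" "z0 \<notin> path_image p" "z \<noteq> z0"
  shows "winding_number (inv0 \<circ> p) (inv0 z) = winding_number p z - winding_number p z0"
proof -
  obtain q where q: "path q" "\<And>t. t \<in> {0..1} \<Longrightarrow> p t - z = exp (q t)"
    "winding_number p z = (pathfinish q - pathstart q) / (2 * complex_of_real pi * \<i>)"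
    using path_logarithm[OF assms(1,2)] by blast
  obtain q0 where q0: "path q0" "\<And>t. t \<in> {0..1} \<Longrightarrow> p t - z0 = exp (q0 t)"
    "winding_number p z0 = (pathfinish q0 - pathstart q0) / (2 * complex_of_real pi * \<i>)"
    using path_logarithm[OF assms(1,3)] by blast
  \<comment> \<open>The difference of two inverses contains the constant factor
    \<open>- inverse (z - z0)\<close>. Its logarithm \<open>a\<close> shifts \<open>r\<close> by a
    constant and cancels in the increment.\<close>
  define a where "a = Ln (- inverse (z - z0))"
  have a: "exp a = - inverse (z - z0)" unfolding a_def using assms(4) by simp
  define r where "r t = q t - q0 t + a" for t
  have "path r" using q(1) q0(1) unfolding r_def path_def by (intro continuous_intros)
  have "(inv0 \<circ> p) t - inv0 z = exp (r t)" if "t \<in> {0..1}" for t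
  proof -
    have "p t \<noteq> z0" using assms(3) that unfolding path_image_def by auto
    then have "inverse (p t - z0) - inverse (z - z0) = (p t - z) * inverse (p t - z0) * - inverse (z - z0)"
      using assms(4) inverse_diff_inverse[of "p t - z0" "z - z0"] by (simp add: algebra_simps)
    also have "\<dots> = exp (q t) * inverse (exp (q0 t)) * exp a"
      unfolding a using q(2)[OF that] q0(2)[OF that] by simp
    also have "\<dots> = exp (r t)" unfolding r_def by (simp add: exp_add exp_diff divide_inverse)
    finally show ?thesis by (simp add: inv0_def)
  qed
  then have "winding_number (\<lambda>t. (inv0 \<circ> p) t - inv0 z) 0 = winding_number (exp \<circ> r) 0"
    by (intro winding_number_cong) auto
  then have "winding_number (inv0 \<circ> p) (inv0 z) = winding_number (exp \<circ> r) 0"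
    using winding_number_offset[of "inv0 \<circ> p" "inv0 z"] by simp
  also have "\<dots> = (pathfinish r - pathstart r) / (2 * complex_of_real pi * \<i>)"
    by (rule winding_number_compose_exp[OF \<open>path r\<close>])
  also have "\<dots> = winding_number p z - winding_number p z0"
    unfolding q(3) q0(3) r_def pathfinish_def pathstart_def by (simp add: diff_divide_distrib add_divide_distrib)
  finally show ?thesis .
qed

text \<open>The substitution \<open>x / (1 - x)\<close> maps \<open>[0,1)\<close> onto the parameter
  range of the ray. Its inverted points tend to 0 because the norm tends to infinity, so 0 can be
  added as the end of an arc.\<close>

lemma ray_arc:
  fixes \<gamma> :: "real \<Rightarrow> complex"
  assumes cont: "continuous_on {0..} \<gamma>" and inj: "inj_on \<gamma> {0..}"
    and lim: "filterlim (\<lambda>r. norm (\<gamma> r)) at_top at_top" and z0: "z0 \<notin> \<gamma> ` {0..}"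
  obtains g where "arc g" "pathstart g = inv0 (\<gamma> 0)" "pathfinish g = 0"
    "path_image g = insert 0 (inv0 ` \<gamma> ` {0..})"
proof -
  define g where "g x = (if x < 1 then inv0 (\<gamma> (x / (1 - x))) else 0)" for x :: real
  have cont_g: "continuous_on {0..1} g"
    unfolding continuous_on_def
  proof
    fix x :: real assume x: "x \<in> {0..1}"
    show "(g \<longlongrightarrow> g x) (at x within {0..1})"
    proof (cases "x < 1")
      case True
      have "continuous_on {0..<1} (\<lambda>x. inv0 (\<gamma> (x / (1 - x))))"
      proof (rule continuous_on_compose2[OF continuous_inv0[of "\<gamma> ` {0..}"]])
        show "continuous_on {0..<1} (\<lambda>x. \<gamma> (x / (1 - x)))"
          by (rule continuous_on_compose2[OF cont]) (auto intro!: continuous_intros)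
      qed (use z0 in auto)
      then have "continuous_on {0..<1} g" by (rule continuous_on_eq) (simp add: g_def)
      then have "(g \<longlongrightarrow> g x) (at x within {0..<1})" using x True by (simp add: continuous_on_def)
      moreover have "at x within {0..1} = at x within {0..<1}"
        by (rule at_within_nhd[of _ "{..<1}"]) (use True in auto)
      ultimately show ?thesis by simp
    next
      case False
      then have x1: "x = 1" using x by simp
      have lim0: "((\<lambda>r. inv0 (\<gamma> r)) \<longlongrightarrow> 0) at_top"
      proof -
        have "filterlim (\<lambda>r. norm (\<gamma> r - z0)) at_top at_top"
        proof (rule filterlim_at_top_mono)
          show "filterlim (\<lambda>r. - norm z0 + norm (\<gamma> r)) at_top at_top"
            by (rule filterlim_tendsto_add_at_top[OF tendsto_const lim])
          show "\<forall>\<^sub>F r in at_top. - norm z0 + norm (\<gamma> r) \<le> norm (\<gamma> r - z0)"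
            using norm_triangle_ineq2[of "\<gamma> _" z0] by (intro always_eventually allI) (simp add: algebra_simps)
        qed
        then have "filterlim (\<lambda>r. \<gamma> r - z0) at_infinity at_top" by (simp add: filterlim_at_infinity_conv_norm_at_top)
        then show ?thesis unfolding inv0_def by (rule filterlim_compose[OF tendsto_inverse_0])
      qed
      have "filterlim (\<lambda>x::real. x / (1 - x)) at_top (at_left 1)" by real_asymp
      then have "((\<lambda>x. inv0 (\<gamma> (x / (1 - x)))) \<longlongrightarrow> 0) (at_left 1)"
        by (rule filterlim_compose[OF lim0])
      moreover have "\<forall>\<^sub>F x in at_left 1. inv0 (\<gamma> (x / (1 - x))) = g x"
        by (rule eventually_at_leftI[of 0]) (auto simp: g_def)
      ultimately have "(g \<longlongrightarrow> 0) (at_left 1)" by (rule Lim_transform_eventually)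
      moreover have "at (1::real) within {0..1} = at_left 1"
        by (simp add: at_within_Icc_at_left)
      ultimately show ?thesis using x1 by (simp add: g_def)
    qed
  qed
  have inj_g: "inj_on g {0..1}"
  proof (rule inj_onI)
    fix x y :: real assume xy: "x \<in> {0..1}" "y \<in> {0..1}" "g x = g y"
    have nz: "inv0 (\<gamma> (x / (1 - x))) \<noteq> 0" if "0 \<le> x" "x < 1" for x
      using z0 that by auto
    consider "x < 1" "y < 1" | "x = 1" "y = 1" | "x < 1" "y = 1" | "x = 1" "y < 1" using xy by fastforce
    then show "x = y"
    proof cases
      case 1
      then have "\<gamma> (x / (1 - x)) = \<gamma> (y / (1 - y))" using xy by (simp add: g_def)
      then have "x / (1 - x) = y / (1 - y)" using inj_onD[OF inj] 1 xy by simp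
      then show ?thesis using 1 by (simp add: field_simps)
    qed (use xy nz in \<open>auto simp: g_def\<close>)
  qed
  have "path_image g = insert 0 (inv0 ` \<gamma> ` {0..})"
  proof (intro equalityI subsetI)
    fix w assume "w \<in> path_image g"
    then obtain x where x: "x \<in> {0..1}" "w = g x" unfolding path_image_def by blast
    then show "w \<in> insert 0 (inv0 ` \<gamma> ` {0..})"
      by (cases "x < 1") (auto simp: g_def)
  next
    fix w assume "w \<in> insert 0 (inv0 ` \<gamma> ` {0..})"
    then consider "w = 0" | r where "r \<ge> 0" "w = inv0 (\<gamma> r)" by auto
    then show "w \<in> path_image g"
    proof cases
      case 1
      then have "w = g 1" by (simp add: g_def)
      then show ?thesis unfolding path_image_def by auto
    next
      case 2
      have "(r / (1 + r)) / (1 - r / (1 + r)) = r" using 2 by (simp add: field_simps)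
      moreover have "r / (1 + r) < 1" using 2 by (simp add: field_simps)
      ultimately have "w = g (r / (1 + r))" using 2(2) by (simp add: g_def)
      then show ?thesis using 2 unfolding path_image_def by (auto simp: field_simps)
    qed
  qed
  then show ?thesis using cont_g inj_g
    by (intro that[of g]) (auto simp: arc_def path_def g_def pathstart_def pathfinish_def)
qed

end

text \<open>Within distance 1 of a given point only a compact initial piece of the ray matters,
  because the norm tends to infinity.\<close>

lemma closed_ray:
  fixes \<gamma> :: "real \<Rightarrow> complex"
  assumes cont: "continuous_on {a..} \<gamma>" and lim: "filterlim (\<lambda>r. norm (\<gamma> r)) at_top at_top"
  shows "closed (\<gamma> ` {a..})"
proof -
  have "\<exists>e>0. ball y e \<subseteq> - (\<gamma> ` {a..})" if y: "y \<notin> \<gamma> ` {a..}" for y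
  proof -
    obtain N where N: "\<And>r. r \<ge> N \<Longrightarrow> norm (\<gamma> r) \<ge> norm y + 1"
      using lim unfolding filterlim_at_top eventually_at_top_linorder by blast
    have "compact (\<gamma> ` {a..N})"
      by (intro compact_continuous_image continuous_on_subset[OF cont]) auto
    then have "open (- (\<gamma> ` {a..N}))" by (simp add: compact_imp_closed open_Compl)
    moreover have "y \<in> - (\<gamma> ` {a..N})" using y by auto
    ultimately obtain e where e: "e > 0" "ball y e \<subseteq> - (\<gamma> ` {a..N})"
      using open_contains_ball by blast
    have "\<gamma> r \<notin> ball y (min e 1)" if "r \<ge> a" for r
    proof (cases "r \<le> N")
      case True
      then show ?thesis using e that by auto
    next
      case False
      have "norm (\<gamma> r) - norm y \<le> norm (\<gamma> r - y)" by (rule norm_triangle_ineq2)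
      then show ?thesis using N[of r] False by (simp add: dist_norm norm_minus_commute)
    qed
    then show ?thesis using e(1) by (intro exI[of _ "min e 1"]) auto
  qed
  then show ?thesis unfolding closed_def open_contains_ball by blast
qed

text \<open>Removing a point disconnects a ray but not a disc.\<close>

lemma ray_no_interior:
  fixes \<gamma> :: "real \<Rightarrow> complex"
  assumes cont: "continuous_on {0..} \<gamma>" and inj: "inj_on \<gamma> {0..}"
    and lim: "filterlim (\<lambda>r. norm (\<gamma> r)) at_top at_top"
    and d: "d > 0"
  shows "\<not> ball (\<gamma> 1) d \<subseteq> \<gamma> ` {0..}"
proof
  assume sub: "ball (\<gamma> 1) d \<subseteq> \<gamma> ` {0..}"
  let ?S = "ball (\<gamma> 1) d - {\<gamma> 1}"
  have "connected ?S" by (intro connected_open_delete) auto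
  moreover have "closed (\<gamma> ` {0..1})"
    by (intro compact_imp_closed compact_continuous_image continuous_on_subset[OF cont]) auto
  moreover have "closed (\<gamma> ` {1..})"
    by (intro closed_ray lim continuous_on_subset[OF cont]) auto
  moreover have "?S \<subseteq> \<gamma> ` {0..1} \<union> \<gamma> ` {1..}"
  proof -
    have "{0..} = {0..1} \<union> {1::real..}" by auto
    then show ?thesis using sub by (metis Diff_subset image_Un subset_trans)
  qed
  moreover have "\<gamma> ` {0..1} \<inter> \<gamma> ` {1..} \<inter> ?S = {}"
  proof -
    have "x = 1" if "x \<in> {0..1}" "y \<in> {1..}" "\<gamma> x = \<gamma> y" for x y
      using inj_onD[OF inj that(3)] that by auto
    then show ?thesis by blast
  qed
  ultimately have cases: "\<gamma> ` {0..1} \<inter> ?S = {} \<or> \<gamma> ` {1..} \<inter> ?S = {}"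
    unfolding connected_closed by blast
  obtain e where e: "e > 0" "\<And>x. x \<ge> 0 \<Longrightarrow> \<bar>x - 1\<bar> < e \<Longrightarrow> dist (\<gamma> x) (\<gamma> 1) < d"
    using cont d unfolding continuous_on_iff dist_real_def by (metis atLeast_iff zero_le_one)
  have in_S: "\<gamma> x \<in> ?S" if "x \<ge> 0" "\<bar>x - 1\<bar> < e" "x \<noteq> 1" for x
    using e(2)[OF that(1,2)] inj_onD[OF inj, of x 1] that by (auto simp: dist_commute)
  \<comment> \<open>Parameters just below and just above 1 give points of the punctured disc on both
    closed pieces of the ray, so neither piece can miss it. The maximum keeps the parameter in the
    domain.\<close>
  have "\<gamma> (max 0 (1 - e/2)) \<in> ?S" by (rule in_S) (use e(1) in \<open>auto simp: max_def\<close>)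
  moreover have "\<gamma> (1 + e/2) \<in> ?S" by (rule in_S) (use e(1) in auto)
  moreover have "max 0 (1 - e/2) \<in> {0..1}" "1 + e/2 \<in> {1..}" using e(1) by auto
  ultimately show False using cases by blast
qed

section \<open>Renaming vertices by an injective map\<close>

lemma bipolar_image:
  assumes bip: "bipolar V E src tgt" and inj: "inj_on f V"
  shows "bipolar (f ` V) E (\<lambda>e. f (src e)) (\<lambda>e. f (tgt e))"
    and "the_source (f ` V) E (\<lambda>e. f (tgt e)) = f (the_source V E tgt)"
    and "the_sink (f ` V) E (\<lambda>e. f (src e)) = f (the_sink V E src)"
proof -
  interpret bipolar_digraph V E src tgt using bip by unfold_locales
  have src: "is_source (f ` V) E (\<lambda>e. f (tgt e)) w \<longleftrightarrow> w = f source" for w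
  proof
    assume "is_source (f ` V) E (\<lambda>e. f (tgt e)) w"
    then show "w = f source" using source_iff unfolding is_source_def by auto
  next
    have "f (tgt e) \<noteq> f source" if "e \<in> E" for e
      using that inj tgt_neq_source by (simp add: inj_on_eq_iff)
    then show "w = f source \<Longrightarrow> is_source (f ` V) E (\<lambda>e. f (tgt e)) w"
      unfolding is_source_def by auto
  qed
  have snk: "is_sink (f ` V) E (\<lambda>e. f (src e)) w \<longleftrightarrow> w = f sink" for w
  proof
    assume "is_sink (f ` V) E (\<lambda>e. f (src e)) w"
    then show "w = f sink" using sink_iff unfolding is_sink_def by auto
  next
    have "f (src e) \<noteq> f sink" if "e \<in> E" for e
      using that inj src_neq_sink by (simp add: inj_on_eq_iff)
    then show "w = f sink \<Longrightarrow> is_sink (f ` V) E (\<lambda>e. f (src e)) w"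
      unfolding is_sink_def by auto
  qed
  show "the_source (f ` V) E (\<lambda>e. f (tgt e)) = f source" unfolding the_source_def[of "f ` V"] src by simp
  show "the_sink (f ` V) E (\<lambda>e. f (src e)) = f sink" unfolding the_sink_def[of "f ` V"] snk by simp
  have "acyclic_dg E (\<lambda>e. f (src e)) (\<lambda>e. f (tgt e))"
  proof -
    have "f (tgt (last p)) = f (src (hd p)) \<longleftrightarrow> tgt (last p) = src (hd p)" if "walk p" for p
    proof -
      have "last p \<in> E" "hd p \<in> E" using dpath_subset[OF that] dpath_nonempty[OF that] by auto
      then show ?thesis using inj by (simp add: inj_on_eq_iff)
    qed
    moreover have "acyclic_dg E src tgt" using bip by (simp add: bipolar_def)
    ultimately show ?thesis
      unfolding acyclic_dg_def using dpath_comp_inj[OF inj, of E src tgt] by auto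
  qed
  then show "bipolar (f ` V) E (\<lambda>e. f (src e)) (\<lambda>e. f (tgt e))"
    using bip inj unfolding bipolar_def src snk by (auto simp: card_image)
qed

lemma max_dpath_comp_inj:
  assumes "inj_on f V" "\<forall>e\<in>E. src e \<in> V \<and> tgt e \<in> V"
  shows "max_dpath E (\<lambda>e. f (src e)) (\<lambda>e. f (tgt e)) p \<longleftrightarrow> max_dpath E src tgt p"
proof -
  have "(\<exists>e\<in>E. f (tgt e) = f (src (hd p))) \<longleftrightarrow> (\<exists>e\<in>E. tgt e = src (hd p))"
    "(\<exists>e\<in>E. f (src e) = f (tgt (last p))) \<longleftrightarrow> (\<exists>e\<in>E. src e = tgt (last p))" if "dpath E src tgt p"
  proof -
    have "last p \<in> E" "hd p \<in> E" using dpath_subset[OF that] dpath_nonempty[OF that] by auto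
    then show "(\<exists>e\<in>E. f (tgt e) = f (src (hd p))) \<longleftrightarrow> (\<exists>e\<in>E. tgt e = src (hd p))"
      "(\<exists>e\<in>E. f (src e) = f (tgt (last p))) \<longleftrightarrow> (\<exists>e\<in>E. src e = tgt (last p))"
      using assms by (auto simp: inj_on_eq_iff)
  qed
  then show ?thesis unfolding max_dpath_def dpath_comp_inj[OF assms] by blast
qed

subsection \<open>Closing up a cut plane graph\<close>

locale cut_graph =
  fixes V :: "complex set" and E :: "'e set" and c :: "'e \<Rightarrow> real \<Rightarrow> complex"
    and \<gamma>1 \<gamma>2 :: "real \<Rightarrow> complex"
  assumes upward: "upward_bipolar_plane V E c" and cut: "is_cut V E c \<gamma>1 \<gamma>2"
begin

lemma bip: "bipolar V E (ptail c) (phead c)" and plane: "plane_graph V E c"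
  using upward unfolding upward_bipolar_plane_def by auto

sublocale bipolar_digraph V E "ptail c" "phead c"
  using bip by unfold_locales

definition D :: "complex set" where "D = drawing V E c"
definition rays :: "complex set" where "rays = \<gamma>1 ` {0..} \<union> \<gamma>2 ` {0..}"
definition barrier :: "complex set" where "barrier = D \<union> rays"

lemma arc_edge: "e \<in> E \<Longrightarrow> arc (c e)"
  using plane unfolding plane_graph_def by auto

lemma edge_vertex:
  assumes "e \<in> E" "v \<in> V" "v \<in> path_image (c e)"
  shows "v = pathstart (c e) \<or> v = pathfinish (c e)"
proof -
  have "\<forall>e\<in>E. \<forall>v\<in>V. v \<in> path_image (c e) \<longrightarrow> v = pathstart (c e) \<or> v = pathfinish (c e)"
    using plane unfolding plane_graph_def by (elim conjE)
  from bspec[OF bspec[OF this assms(1)] assms(2)] show ?thesis using assms(3) by blast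
qed

lemma edge_Int:
  assumes "e \<in> E" "e' \<in> E" "e \<noteq> e'"
  shows "path_image (c e) \<inter> path_image (c e') \<subseteq>
    {pathstart (c e), pathfinish (c e)} \<inter> {pathstart (c e'), pathfinish (c e')}"
proof -
  have "\<forall>e\<in>E. \<forall>e'\<in>E. e \<noteq> e' \<longrightarrow> path_image (c e) \<inter> path_image (c e') \<subseteq>
    {pathstart (c e), pathfinish (c e)} \<inter> {pathstart (c e'), pathfinish (c e')}"
    using plane unfolding plane_graph_def by (elim conjE)
  from bspec[OF bspec[OF this assms(1)] assms(2)] assms(3) show ?thesis by (rule mp)
qed

lemma D_eq: "D = V \<union> (\<Union>e\<in>E. path_image (c e))"
  unfolding D_def drawing_def by simp

lemma compact_D: "compact D"
  unfolding D_eq using arc_edge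
  by (intro compact_Un compact_UN compact_path_image finite_imp_compact) (auto intro: arc_imp_path)

lemma ray1: "continuous_on {0..} \<gamma>1" "inj_on \<gamma>1 {0..}" "\<gamma>1 0 = source"
    "filterlim (\<lambda>r. norm (\<gamma>1 r)) at_top at_top" "\<gamma>1 ` {0<..} \<subseteq> outside D"
  and ray2: "continuous_on {0..} \<gamma>2" "inj_on \<gamma>2 {0..}" "\<gamma>2 0 = sink"
    "filterlim (\<lambda>r. norm (\<gamma>2 r)) at_top at_top" "\<gamma>2 ` {0<..} \<subseteq> outside D"
  and rays_disjoint: "\<gamma>1 ` {0..} \<inter> \<gamma>2 ` {0..} = {}"
  using cut unfolding is_cut_def escaping_ray_def D_def by simp_all

lemma ray_split: "\<gamma>1 ` {0..} = insert source (\<gamma>1 ` {0<..})" "\<gamma>2 ` {0..} = insert sink (\<gamma>2 ` {0<..})"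
proof -
  have "{0::real..} = insert 0 {0<..}" by auto
  then show "\<gamma>1 ` {0..} = insert source (\<gamma>1 ` {0<..})" "\<gamma>2 ` {0..} = insert sink (\<gamma>2 ` {0<..})"
    using ray1(3) ray2(3) by (metis image_insert)+
qed

lemma rays_D: "rays \<inter> D \<subseteq> {source, sink}"
  using ray1(5) ray2(5) outside_no_overlap[of D] unfolding rays_def ray_split by blast

lemma rays_sub: "rays \<subseteq> outside D \<union> D"
  using ray1(5) ray2(5) source_in sink_in unfolding rays_def ray_split D_eq by blast

lemma closed_rays: "closed rays"
  unfolding rays_def using closed_ray ray1 ray2 by blast

lemma closed_barrier: "closed barrier"
  unfolding barrier_def using closed_rays compact_D by (blast intro: closed_Un compact_imp_closed)

lemma component_inside:
  assumes "x \<in> inside D"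
  shows "connected_component_set (- barrier) x = connected_component_set (- D) x"
proof
  show "connected_component_set (- barrier) x \<subseteq> connected_component_set (- D) x"
    by (intro connected_component_mono) (auto simp: barrier_def)
  have "connected_component_set (- D) x \<subseteq> inside D"
    using assms inside_same_component[of D x] by auto
  then have "connected_component_set (- D) x \<inter> barrier = {}"
    using rays_sub inside_Int_outside[of D] inside_no_overlap[of D] unfolding barrier_def by blast
  moreover have "x \<in> connected_component_set (- D) x" using assms by (simp add: inside_def)
  ultimately show "connected_component_set (- D) x \<subseteq> connected_component_set (- barrier) x"
    by (intro connected_component_maximal) auto
qed

lemma component_outside:
  assumes "x \<in> outside D - rays"
  shows "connected_component_set (- barrier) x = connected_component_set (outside D - rays) x"
proof
  have D: "x \<notin> D" using assms outside_no_overlap[of D] by blast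
  have "connected_component_set (- barrier) x \<subseteq> connected_component_set (- D) x"
    by (intro connected_component_mono) (auto simp: barrier_def)
  moreover have "connected_component_set (- D) x \<subseteq> outside D"
    using assms outside_same_component[of D x] by auto
  moreover have "connected_component_set (- barrier) x \<inter> rays = {}"
    using connected_component_subset[of "- barrier" x] unfolding barrier_def by blast
  moreover have "x \<in> connected_component_set (- barrier) x"
    using assms D by (simp add: barrier_def)
  ultimately show "connected_component_set (- barrier) x \<subseteq> connected_component_set (outside D - rays) x"
    by (intro connected_component_maximal) auto
  show "connected_component_set (outside D - rays) x \<subseteq> connected_component_set (- barrier) x"
    using outside_no_overlap[of D] unfolding barrier_def by (intro connected_component_mono) blast
qed

text \<open>The rays stay in the outer face except at their starting points, so cutting along them
  leaves the bounded faces unchanged. Inner and outer facets thus become the components of one open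
  set.\<close>

lemma facets_eq: "facets V E c \<gamma>1 \<gamma>2 = components (- barrier)"
proof -
  have "facets V E c \<gamma>1 \<gamma>2 = {C \<in> components (- D). bounded C} \<union> components (outside D - rays)"
    by (simp add: facets_def D_def rays_def)
  also have "\<dots> = components (- barrier)"
  proof (intro equalityI subsetI)
    fix C assume "C \<in> {C \<in> components (- D). bounded C} \<union> components (outside D - rays)"
    then consider x where "x \<notin> D" "C = connected_component_set (- D) x" "bounded C"
      | x where "x \<in> outside D - rays" "C = connected_component_set (outside D - rays) x"
      unfolding components_def by auto
    then show "C \<in> components (- barrier)"
    proof cases
      case 1
      then have "x \<in> inside D" by (simp add: inside_def)
      moreover from this have "x \<notin> barrier"
        using rays_sub inside_Int_outside[of D] inside_no_overlap[of D] unfolding barrier_def by blast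
      ultimately show ?thesis using component_inside[of x] 1 componentsI[of x "- barrier"] by simp
    next
      case 2
      then have "x \<notin> barrier" using outside_no_overlap[of D] unfolding barrier_def by blast
      then show ?thesis using component_outside[of x] 2 componentsI[of x "- barrier"] by simp
    qed
  next
    fix C assume "C \<in> components (- barrier)"
    then obtain x where x: "x \<notin> barrier" "C = connected_component_set (- barrier) x"
      unfolding components_def by auto
    have "inside D \<union> outside D = - D" by (rule inside_Un_outside)
    then have "x \<in> inside D \<or> x \<in> outside D - rays" using x(1) unfolding barrier_def by blast
    then show "C \<in> {C \<in> components (- D). bounded C} \<union> components (outside D - rays)"
    proof
      assume ins: "x \<in> inside D"
      then have "C = connected_component_set (- D) x" using component_inside x by simp
      then show ?thesis using ins by (auto simp: inside_def intro: componentsI)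
    next
      assume out: "x \<in> outside D - rays"
      then have "C = connected_component_set (outside D - rays) x" using component_outside x by simp
      then show ?thesis using out by (auto intro: componentsI)
    qed
  qed
  finally show ?thesis .
qed

text \<open>Provides a centre for the inversion. Near \<open>\<gamma>1 1\<close> the barrier
  consists of the first ray alone, which contains no disc around this point.\<close>

lemma barrier_proper: "\<exists>z0. z0 \<notin> barrier"
proof (rule ccontr)
  assume "\<not> ?thesis"
  then have all: "barrier = UNIV" by auto
  have out: "\<gamma>1 1 \<in> outside D" using ray1(5) by auto
  have "\<gamma>1 1 \<in> \<gamma>1 ` {0..}" by simp
  then have "\<gamma>1 1 \<notin> \<gamma>2 ` {0..}" using rays_disjoint by blast
  moreover have "closed (\<gamma>2 ` {0..})" using closed_ray ray2 by blast
  moreover have "open (outside D)" using compact_D by (intro open_outside compact_imp_closed)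
  ultimately have "open (outside D - \<gamma>2 ` {0..})" "\<gamma>1 1 \<in> outside D - \<gamma>2 ` {0..}"
    using out by (auto intro: open_Diff)
  then obtain d where d: "d > 0" "ball (\<gamma>1 1) d \<subseteq> outside D - \<gamma>2 ` {0..}"
    using open_contains_ball by blast
  then have "ball (\<gamma>1 1) d \<subseteq> \<gamma>1 ` {0..}"
    using all outside_no_overlap[of D] unfolding barrier_def rays_def by blast
  then show False using ray_no_interior[OF ray1(1,2,4) d(1)] by simp
qed

end

text \<open>The inverted second ray runs from the sink to 0, the image of infinity, and the inverted
  first ray runs backwards from 0 to the source.\<close>

lemma (in cut_graph) return_arc_exists:
  assumes "z0 \<notin> barrier"
  shows "\<exists>R. arc R \<and> pathstart R = inversion.inv0 z0 sink \<and> pathfinish R = inversion.inv0 z0 source \<and>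
    path_image R = insert 0 (inversion.inv0 z0 ` rays)"
proof -
  interpret inversion z0 .
  have z0: "z0 \<notin> \<gamma>1 ` {0..}" "z0 \<notin> \<gamma>2 ` {0..}" using assms by (auto simp: barrier_def rays_def)
  obtain g1 where g1: "arc g1" "pathstart g1 = inv0 source" "pathfinish g1 = 0"
    "path_image g1 = insert 0 (inv0 ` \<gamma>1 ` {0..})"
    using ray_arc[OF ray1(1,2,4) z0(1)] ray1(3) by metis
  obtain g2 where g2: "arc g2" "pathstart g2 = inv0 sink" "pathfinish g2 = 0"
    "path_image g2 = insert 0 (inv0 ` \<gamma>2 ` {0..})"
    using ray_arc[OF ray2(1,2,4) z0(2)] ray2(3) by metis
  have "inv0 ` \<gamma>2 ` {0..} \<inter> inv0 ` \<gamma>1 ` {0..} = {}"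
    using rays_disjoint by (metis image_Int[OF inj_inv0] image_empty inf_commute inj_inv0 inj_on_image_Int subset_UNIV)
  moreover have "0 \<notin> inv0 ` \<gamma>1 ` {0..}" "0 \<notin> inv0 ` \<gamma>2 ` {0..}" using z0 by auto
  ultimately have "path_image g2 \<inter> path_image (reversepath g1) \<subseteq> {pathstart (reversepath g1)}"
    using g1 g2 by auto
  then have "arc (g2 +++ reversepath g1)"
    using g1 g2 by (intro arc_join arc_reversepath) auto
  moreover have "path_image (g2 +++ reversepath g1) = insert 0 (inv0 ` rays)"
    using g1 g2 by (subst path_image_join) (auto simp: rays_def)
  ultimately show ?thesis using g1 g2 by (intro exI[of _ "g2 +++ reversepath g1"]) simp
qed

text \<open>Inverting the plane at a point \<open>z0\<close> of some facet turns the two rays into one arc \<open>R\<close> through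
  the image \<open>0\<close> of the point at infinity.\<close>

locale inverted_graph = cut_graph V E c \<gamma>1 \<gamma>2 + inversion z0
  for V :: "complex set" and E :: "'e set" and c :: "'e \<Rightarrow> real \<Rightarrow> complex"
    and \<gamma>1 \<gamma>2 :: "real \<Rightarrow> complex" and z0 :: complex +
  fixes R :: "real \<Rightarrow> complex"
  assumes z0: "z0 \<notin> barrier" and arc_R: "arc R"
    and R_start: "pathstart R = inv0 sink" and R_finish: "pathfinish R = inv0 source"
    and R_image: "path_image R = insert 0 (inv0 ` rays)"
begin

abbreviation "dtail \<equiv> dual_tail V E c \<gamma>1 \<gamma>2"
abbreviation "dhead \<equiv> dual_head V E c \<gamma>1 \<gamma>2"
abbreviation "cinv \<equiv> (\<lambda>e. inv0 \<circ> c e)"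

lemma z0_notin_D: "z0 \<notin> D"
  using z0 by (auto simp: barrier_def)

lemma edge_in_D: "e \<in> E \<Longrightarrow> path_image (c e) \<subseteq> D" and V_in_D: "V \<subseteq> D"
  by (auto simp: D_eq)

lemma path_image_cinv: "path_image (inv0 \<circ> p) = inv0 ` path_image p"
  by (rule path_image_compose)

lemma ptail_cinv: "ptail cinv = (\<lambda>e. inv0 (ptail c e))" and phead_cinv: "phead cinv = (\<lambda>e. inv0 (phead c e))"
  by (simp_all add: fun_eq_iff ptail_def phead_def pathstart_compose pathfinish_compose)

lemma R_edge:
  assumes "e \<in> E"
  shows "path_image R \<inter> path_image (cinv e) \<subseteq>
    {pathstart (cinv e), pathfinish (cinv e)} \<inter> {pathstart R, pathfinish R}"
proof
  fix w assume w: "w \<in> path_image R \<inter> path_image (cinv e)"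
  then obtain y where y: "y \<in> path_image (c e)" "w = inv0 y" unfolding path_image_cinv by blast
  then have "y \<in> D" using edge_in_D[OF assms] by blast
  then have "w \<noteq> 0" using z0_notin_D y by auto
  then have "y \<in> rays" using w y(2) unfolding R_image by auto
  then have "y = source \<or> y = sink" using \<open>y \<in> D\<close> rays_D by blast
  moreover from this have "y = pathstart (c e) \<or> y = pathfinish (c e)"
    using edge_vertex[OF assms _ y(1)] by auto
  ultimately show "w \<in> {pathstart (cinv e), pathfinish (cinv e)} \<inter> {pathstart R, pathfinish R}"
    using R_start R_finish y(2) by (auto simp: pathstart_compose pathfinish_compose)
qed

lemma plane_inverted: "plane_graph (inv0 ` V) (insert None (Some ` E)) (case_option R cinv)"
proof -
  have arc: "arc (cinv e)" if "e \<in> E" for e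
    using arc_edge[OF that] edge_in_D[OF that] z0_notin_D by (intro arc_inv0) auto
  have ends: "pathstart (cinv e) \<in> inv0 ` V \<and> pathfinish (cinv e) \<in> inv0 ` V" if "e \<in> E" for e
    using src_in[OF that] tgt_in[OF that] unfolding pathstart_compose pathfinish_compose ptail_def phead_def by blast
  have vertex: "v = pathstart (cinv e) \<or> v = pathfinish (cinv e)"
    if e: "e \<in> E" and v: "v \<in> inv0 ` V" "v \<in> path_image (cinv e)" for e v
  proof -
    obtain y where "y \<in> V" "v = inv0 y" using v(1) by blast
    moreover from this have "y \<in> path_image (c e)" using v(2) unfolding path_image_cinv by auto
    ultimately show ?thesis
      using edge_vertex[OF e] unfolding pathstart_compose pathfinish_compose by blast
  qed
  have vertexR: "v = pathstart R \<or> v = pathfinish R" if v: "v \<in> inv0 ` V" "v \<in> path_image R" for v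
  proof -
    obtain y where y: "y \<in> V" "v = inv0 y" using v by blast
    then have "y \<in> D" using V_in_D by blast
    then have "y \<in> rays" using v y z0_notin_D unfolding R_image by auto
    then show ?thesis using \<open>y \<in> D\<close> rays_D R_start R_finish y(2) by auto
  qed
  have edges: "path_image (cinv e) \<inter> path_image (cinv e') \<subseteq>
      {pathstart (cinv e), pathfinish (cinv e)} \<inter> {pathstart (cinv e'), pathfinish (cinv e')}"
    if "e \<in> E" "e' \<in> E" "e \<noteq> e'" for e e'
  proof
    fix w assume "w \<in> path_image (cinv e) \<inter> path_image (cinv e')"
    then obtain y where "y \<in> path_image (c e) \<inter> path_image (c e')" "w = inv0 y"
      unfolding path_image_cinv by auto
    then show "w \<in> {pathstart (cinv e), pathfinish (cinv e)} \<inter> {pathstart (cinv e'), pathfinish (cinv e')}"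
      using edge_Int[OF that] unfolding pathstart_compose pathfinish_compose by auto
  qed
  show ?thesis
    unfolding plane_graph_def
  proof (intro conjI ballI impI)
    fix x assume x: "x \<in> insert None (Some ` E)"
    show "arc (case_option R cinv x)" using x arc arc_R by auto
    show "pathstart (case_option R cinv x) \<in> inv0 ` V" using x ends R_start sink_in by auto
    show "pathfinish (case_option R cinv x) \<in> inv0 ` V" using x ends R_finish source_in by auto
    show "v = pathstart (case_option R cinv x) \<or> v = pathfinish (case_option R cinv x)"
      if "v \<in> inv0 ` V" "v \<in> path_image (case_option R cinv x)" for v
    proof (cases x)
      case None
      then show ?thesis using vertexR that by simp
    next
      case (Some e)
      then have "e \<in> E" using x by auto
      then show ?thesis using vertex[of e v] that Some by simp
    qed
    fix y assume y: "y \<in> insert None (Some ` E)" "x \<noteq> y"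
    consider "x = None" "y = None" | e where "x = None" "y = Some e" "e \<in> E"
      | e where "x = Some e" "y = None" "e \<in> E" | e e' where "x = Some e" "y = Some e'" "e \<in> E" "e' \<in> E"
      using x y by auto
    then show "path_image (case_option R cinv x) \<inter> path_image (case_option R cinv y) \<subseteq>
      {pathstart (case_option R cinv x), pathfinish (case_option R cinv x)} \<inter>
      {pathstart (case_option R cinv y), pathfinish (case_option R cinv y)}"
    proof cases
      case 1
      then show ?thesis using y by simp
    next
      case 2
      then show ?thesis using R_edge[OF 2(3)] by (simp add: Int_commute)
    next
      case 3
      then show ?thesis using R_edge[OF 3(3)] by (simp add: Int_commute)
    next
      case 4
      then show ?thesis using edges[OF 4(3,4)] y(2) by simp
    qed
  qed simp_all
qed

sublocale L: looped_graph "inv0 ` V" E cinv R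
proof
  note image = bipolar_image[OF bip inj_inv0[of V]]
  show "bipolar (inv0 ` V) E (ptail cinv) (phead cinv)" unfolding ptail_cinv phead_cinv by (rule image(1))
  show "plane_graph (inv0 ` V) (insert None (Some ` E)) (case_option R cinv)" by (rule plane_inverted)
  show "pathstart R = the_sink (inv0 ` V) E (ptail cinv)" unfolding ptail_cinv image(3) by (rule R_start)
  show "pathfinish R = the_source (inv0 ` V) E (phead cinv)" unfolding phead_cinv image(2) by (rule R_finish)
qed

lemma L_ends: "L.source = inv0 source" "L.sink = inv0 sink"
  unfolding ptail_cinv phead_cinv bipolar_image[OF bip inj_inv0[of V]] by simp_all

lemma L_stpath: "L.stpath p \<longleftrightarrow> stpath p"
  unfolding ptail_cinv phead_cinv by (rule max_dpath_comp_inj[OF inj_inv0[of V]]) simp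

lemma L_K: "L.K = insert 0 (inv0 ` barrier)"
proof -
  have "L.K = path_image R \<union> (\<Union>e\<in>E. path_image (cinv e))" unfolding L.K_def by auto
  moreover have "D = (\<Union>e\<in>E. path_image (c e))"
  proof -
    have "v \<in> (\<Union>e\<in>E. path_image (c e))" if v: "v \<in> V" for v
    proof (cases "v = source")
      case True
      then obtain e where "e \<in> E" "ptail c e = v" using sink_iff[OF v] source_neq_sink by blast
      then show ?thesis unfolding ptail_def by blast
    next
      case False
      then obtain e where "e \<in> E" "phead c e = v" using source_iff[OF v] by blast
      then show ?thesis unfolding phead_def by blast
    qed
    then show ?thesis unfolding D_eq by blast
  qed
  ultimately show ?thesis unfolding R_image barrier_def path_image_cinv by (simp add: image_Un image_UN Un_commute)
qed

section \<open>Correspondence of facets under inversion\<close>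

lemma notin_K_iff: "inv0 z \<notin> L.K \<longleftrightarrow> z \<notin> barrier \<and> z \<noteq> z0"
  unfolding L_K by (auto simp: inv0_image_iff)

text \<open>\<open>z0\<close> is removed because inversion really moves it to infinity, while its
  formal image 0 lies on \<open>R\<close>. An open connected set of the plane stays connected
  without one point.\<close>

definition lift :: "complex set \<Rightarrow> complex set" where "lift F = inv0 ` (F - {z0})"

lemma lift_eq:
  assumes "F \<in> components (- barrier)" "x \<in> F" "x \<noteq> z0"
  shows "lift F = connected_component_set (- L.K) (inv0 x)"
proof
  have F: "connected F" "F \<inter> barrier = {}" "open F"
    using in_components_connected[OF assms(1)] in_components_subset[OF assms(1)]
      open_components[OF _ assms(1)] closed_barrier by auto
  have "connected (lift F)" unfolding lift_def
    using F by (intro connected_continuous_image continuous_inv0 connected_open_delete) auto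
  moreover have "lift F \<subseteq> - L.K" unfolding lift_def using F(2) notin_K_iff by auto
  ultimately show "lift F \<subseteq> connected_component_set (- L.K) (inv0 x)"
    using assms(2,3) by (intro connected_component_maximal) (auto simp: lift_def)
  let ?C = "connected_component_set (- L.K) (inv0 x)"
  have C: "connected ?C" "?C \<subseteq> - L.K" by (auto simp: connected_component_subset)
  then have "0 \<notin> ?C" using L_K by blast
  then have "connected (uninv ` ?C)" using C by (intro connected_continuous_image continuous_uninv)
  moreover have "uninv w \<notin> barrier \<and> uninv w \<noteq> z0" if "w \<in> ?C" for w
    using C(2) that notin_K_iff[of "uninv w"] by auto
  moreover have "x \<in> uninv ` ?C"
  proof -
    have "inv0 x \<notin> L.K" using notin_K_iff assms F(2) by blast
    then show ?thesis by (intro image_eqI[of _ _ "inv0 x"]) auto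
  qed
  ultimately have "uninv ` ?C \<subseteq> F"
    unfolding component_containing[OF assms(1,2)] by (intro connected_component_maximal) auto
  then show "?C \<subseteq> lift F"
    using \<open>\<And>w. w \<in> ?C \<Longrightarrow> _ \<and> _\<close> unfolding lift_def by (auto simp: inv0_image_iff)
qed

lemma facet_point:
  assumes "F \<in> components (- barrier)" obtains x where "x \<in> F" "x \<noteq> z0"
proof -
  have "open F" using open_components[OF _ assms] closed_barrier by auto
  then have "F \<noteq> {z0}" using not_open_singleton by auto
  then show ?thesis using in_components_nonempty[OF assms] that by blast
qed

lemma lift_component: "F \<in> components (- barrier) \<Longrightarrow> lift F \<in> components (- L.K)"
proof -
  assume F: "F \<in> components (- barrier)"
  then obtain x where x: "x \<in> F" "x \<noteq> z0" by (rule facet_point)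
  then have "inv0 x \<notin> L.K" using in_components_subset[OF F] notin_K_iff by blast
  then show ?thesis unfolding lift_eq[OF F x] by (intro componentsI) simp
qed

lemma lift_inj:
  assumes "F \<in> components (- barrier)" "F' \<in> components (- barrier)" "lift F = lift F'"
  shows "F = F'"
proof -
  obtain x where x: "x \<in> F" "x \<noteq> z0" using assms(1) by (rule facet_point)
  then have "inv0 x \<in> lift F'" using assms(3) by (auto simp: lift_def)
  then have "x \<in> F'" by (auto simp: lift_def)
  then show ?thesis using assms(1,2) x(1) components_nonoverlap by blast
qed

lemma lift_surj:
  assumes "C \<in> components (- L.K)" obtains F where "F \<in> components (- barrier)" "lift F = C"
proof -
  obtain w where w: "w \<in> C" using in_components_nonempty[OF assms] by blast
  then have wK: "w \<notin> L.K" using in_components_subset[OF assms] by blast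
  then have u: "uninv w \<notin> barrier" "uninv w \<noteq> z0" using notin_K_iff[of "uninv w"] by auto
  let ?F = "connected_component_set (- barrier) (uninv w)"
  have F: "?F \<in> components (- barrier)" using u by (intro componentsI) simp
  have "lift ?F = connected_component_set (- L.K) (inv0 (uninv w))"
    using u by (intro lift_eq F) auto
  then have "lift ?F = C" using component_containing[OF assms w] by simp
  then show ?thesis using F that by blast
qed

end

subsection \<open>Left and right sides of edges\<close>

lemma open_minus_point_nonempty:
  fixes S :: "complex set"
  assumes "open S" "S \<noteq> {}" shows "\<exists>x\<in>S. x \<noteq> a"
proof (rule ccontr)
  assume "\<not> ?thesis"
  then have "S = {a}" using assms(2) by auto
  then show False using assms(1) not_open_singleton by auto
qed

context inverted_graph begin

lemma inner_edge: "e \<in> E \<Longrightarrow> 0 < t \<Longrightarrow> t < 1 \<Longrightarrow> inv0 (c e t) \<in> L.inner (Some e)"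
  using L.mem_inner_iff[of "Some e" "inv0 (c e t)"] by auto

text \<open>The neighbourhood \<open>nbhd\<close> of the edge, transported back to the original
  plane.\<close>

definition tube :: "'e \<Rightarrow> complex set" where
  "tube e = {y. y \<noteq> z0 \<and> inv0 y \<in> L.nbhd (Some e)}"

lemma open_tube: assumes "e \<in> E" shows "open (tube e)"
proof -
  have "open (- {z0} \<inter> inv0 -` L.nbhd (Some e))"
    using assms by (intro continuous_open_preimage continuous_inv0 L.open_nbhd) auto
  moreover have "tube e = - {z0} \<inter> inv0 -` L.nbhd (Some e)" by (auto simp: tube_def)
  ultimately show ?thesis by simp
qed

lemma edge_not_z0: "e \<in> E \<Longrightarrow> t \<in> {0..1} \<Longrightarrow> c e t \<noteq> z0"
  using edge_in_D[of e] z0_notin_D unfolding path_image_def by blast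

lemma edge_tube: "e \<in> E \<Longrightarrow> 0 < t \<Longrightarrow> t < 1 \<Longrightarrow> c e t \<in> tube e"
  using inner_edge[of e t] L.inner_nbhd[of "Some e"] edge_not_z0[of e t] by (auto simp: tube_def)

lemma tube_barrier:
  assumes "e \<in> E" "y \<in> tube e"
  shows "y \<in> barrier \<longleftrightarrow> (\<exists>t. 0 < t \<and> t < 1 \<and> y = c e t)"
proof -
  have "y \<in> barrier \<longleftrightarrow> inv0 y \<in> L.K" using notin_K_iff[of y] assms(2) by (auto simp: tube_def)
  also have "\<dots> \<longleftrightarrow> inv0 y \<in> L.inner (Some e)"
    using assms by (intro L.nbhd_K) (auto simp: tube_def)
  also have "\<dots> \<longleftrightarrow> (\<exists>t. 0 < t \<and> t < 1 \<and> y = c e t)"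
    using L.mem_inner_iff[of "Some e" "inv0 y"] assms(1) by auto
  finally show ?thesis .
qed

lemma lift_touching:
  assumes "L.stpath p" "e \<in> set p" "F \<in> components (- barrier)" "y \<in> F" "y \<in> tube e"
  shows "inv0 y \<in> L.Left p \<Longrightarrow> lift F = L.left_facet (Some e)"
    and "inv0 y \<notin> L.Left p \<Longrightarrow> lift F = L.right_facet (Some e)"
proof -
  have "Some e \<in> L.cyc p" using assms(2) by (simp add: L.cyc_def)
  moreover have "inv0 y \<in> lift F" "inv0 y \<in> L.nbhd (Some e)"
    using assms(4,5) by (auto simp: lift_def tube_def)
  ultimately show "inv0 y \<in> L.Left p \<Longrightarrow> lift F = L.left_facet (Some e)"
    "inv0 y \<notin> L.Left p \<Longrightarrow> lift F = L.right_facet (Some e)"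
    using L.facet_touching[OF assms(1) _ lift_component[OF assms(3)]] by blast+
qed

lemma facets_neq:
  assumes "x \<in> L.arcs1" shows "L.left_facet x \<noteq> L.right_facet x"
proof -
  obtain p where p: "L.stpath p" "x \<in> L.cyc p" using assms by (rule L.arc_in_cyc)
  then show ?thesis
    using L.facet_sides[OF p] in_components_nonempty[OF L.facets_components(1)[OF assms]] by blast
qed

lemma side_curve:
  assumes e: "e \<in> E" and F: "F \<in> components (- barrier)" and uw: "0 < u" "u < w" "w < 1"
    and \<beta>: "arc \<beta>" "pathstart \<beta> = c e w" "pathfinish \<beta> = c e u" "path_image \<beta> - {c e u, c e w} \<subseteq> F"
  shows "simple_path (subpath u w (c e) +++ \<beta>)"
    "pathfinish (subpath u w (c e) +++ \<beta>) = pathstart (subpath u w (c e) +++ \<beta>)"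
    "path_image (subpath u w (c e) +++ \<beta>) = c e ` {u..w} \<union> path_image \<beta>"
    "arc (subpath u w (c e))" "path_image (subpath u w (c e)) = c e ` {u..w}"
    "pathfinish (subpath u w (c e)) = pathstart \<beta>"
proof -
  show arc: "arc (subpath u w (c e))"
    using arc_edge[OF e] uw by (intro arc_subpath_arc) auto
  show im: "path_image (subpath u w (c e)) = c e ` {u..w}"
    using uw by (simp add: path_image_subpath)
  show fin: "pathfinish (subpath u w (c e)) = pathstart \<beta>" using \<beta> by simp
  have "c e ` {u..w} \<subseteq> barrier" using edge_in_D[OF e] uw
    unfolding barrier_def path_image_def by (auto simp: subset_iff)
  moreover have "F \<inter> barrier = {}" using in_components_subset[OF F] by blast
  ultimately have sub: "c e ` {u..w} \<inter> path_image \<beta> \<subseteq> {c e u, c e w}" using \<beta>(4) by blast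
  show "simple_path (subpath u w (c e) +++ \<beta>)"
    using arc \<beta> im sub by (intro simple_path_join_loop) auto
  show "pathfinish (subpath u w (c e) +++ \<beta>) = pathstart (subpath u w (c e) +++ \<beta>)"
    using \<beta> by simp
  show "path_image (subpath u w (c e) +++ \<beta>) = c e ` {u..w} \<union> path_image \<beta>"
    using path_image_join[OF fin] im by simp
qed

text \<open>The inside of the curve avoids the loop, since the rest of the loop is connected and passes
  through the point at infinity.\<close>

lemma inside_off_loop:
  assumes e: "e \<in> E" and F: "F \<in> components (- barrier)" and uw: "0 < u" "u < w" "w < 1"
    and \<beta>: "arc \<beta>" "pathstart \<beta> = c e w" "pathfinish \<beta> = c e u" "path_image \<beta> - {c e u, c e w} \<subseteq> F"
    and p: "L.stpath p" "e \<in> set p"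
    and I: "I = inside (path_image (subpath u w (c e) +++ \<beta>))"
  shows "inv0 ` (I - {z0}) \<inter> L.loop p = {}"
proof -
  note J = side_curve[OF e F uw \<beta>]
  let ?J = "path_image (subpath u w (c e) +++ \<beta>)"
  have cyc: "Some e \<in> L.cyc p" using p(2) by (simp add: L.cyc_def)
  define Q where "Q = L.loop p - inv0 ` c e ` {u..w}"
  have part: "connected (inv0 ` c e ` S)" if "connected S" "S \<subseteq> {0..1}" for S
  proof -
    have "continuous_on S (c e)"
      using arc_imp_path[OF arc_edge[OF e]] that(2) unfolding path_def by (rule continuous_on_subset)
    moreover have "z0 \<notin> c e ` S" using edge_not_z0[OF e] that(2) by blast
    ultimately show ?thesis using that(1) by (intro connected_continuous_image continuous_inv0)
  qed
  have inj: "inj_on (c e) {0..1}" using arc_edge[OF e] by (simp add: arc_def)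
  have Q_eq: "Q = (L.loop p - L.inner (Some e)) \<union> inv0 ` c e ` {0..<u} \<union> inv0 ` c e ` {w<..1}"
  proof (intro equalityI subsetI)
    fix y assume y: "y \<in> Q"
    show "y \<in> (L.loop p - L.inner (Some e)) \<union> inv0 ` c e ` {0..<u} \<union> inv0 ` c e ` {w<..1}"
    proof (cases "y \<in> L.inner (Some e)")
      case True
      then obtain t where t: "0 < t" "t < 1" "y = inv0 (c e t)"
        using L.mem_inner_iff[of "Some e" y] e by auto
      then have "t \<notin> {u..w}" using y unfolding Q_def by auto
      then have "t \<in> {0..<u} \<or> t \<in> {w<..1}" using t by auto
      then show ?thesis using t(3) by blast
    qed (use y in \<open>auto simp: Q_def\<close>)
  next
    fix y assume "y \<in> (L.loop p - L.inner (Some e)) \<union> inv0 ` c e ` {0..<u} \<union> inv0 ` c e ` {w<..1}"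
    then consider "y \<in> L.loop p - L.inner (Some e)"
      | t where "t \<in> {0..<u} \<union> {w<..1}" "y = inv0 (c e t)" by blast
    then show "y \<in> Q"
    proof cases
      case 1
      moreover have "inv0 ` c e ` {u..w} \<subseteq> L.inner (Some e)" using inner_edge[OF e] uw by auto
      ultimately show ?thesis unfolding Q_def by blast
    next
      case 2
      have "c e t \<noteq> c e t'" if "t' \<in> {u..w}" for t'
        using inj_onD[OF inj, of t t'] that 2(1) uw by auto
      then have "y \<notin> inv0 ` c e ` {u..w}" using 2(2) by (metis imageE inv0_eq_iff)
      moreover have "y \<in> L.img (Some e)" using 2 uw by (auto simp: path_image_def)
      then have "y \<in> L.loop p" using cyc unfolding L.loop_def by blast
      ultimately show ?thesis unfolding Q_def by blast
    qed
  qed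
  have ends: "inv0 (c e 0) \<in> L.loop p - L.inner (Some e)" "inv0 (c e 1) \<in> L.loop p - L.inner (Some e)"
  proof -
    have "inv0 (c e 0) = pathstart (L.curve (Some e))" "inv0 (c e 1) = pathfinish (L.curve (Some e))"
      by (simp_all add: pathstart_def pathfinish_def)
    then have "inv0 (c e 0) \<notin> L.inner (Some e)" "inv0 (c e 1) \<notin> L.inner (Some e)"
      "inv0 (c e 0) \<in> L.img (Some e)" "inv0 (c e 1) \<in> L.img (Some e)"
      using L.ends_in_img[of "Some e"] unfolding L.inner_def by auto
    then show "inv0 (c e 0) \<in> L.loop p - L.inner (Some e)" "inv0 (c e 1) \<in> L.loop p - L.inner (Some e)"
      using cyc unfolding L.loop_def by blast+
  qed
  have "connected Q"
  proof -
    have "connected (L.loop p - L.inner (Some e) \<union> inv0 ` c e ` {0..<u})"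
    proof (rule connected_Un[OF L.rest_connected[OF p(1) cyc] part])
      have "inv0 (c e 0) \<in> inv0 ` c e ` {0..<u}" using uw by auto
      then show "(L.loop p - L.inner (Some e)) \<inter> inv0 ` c e ` {0..<u} \<noteq> {}" using ends(1) by blast
    qed (use uw in auto)
    then show ?thesis unfolding Q_eq
    proof (rule connected_Un[OF _ part])
      have "inv0 (c e 1) \<in> inv0 ` c e ` {w<..1}" using uw by auto
      then show "(L.loop p - L.inner (Some e) \<union> inv0 ` c e ` {0..<u}) \<inter> inv0 ` c e ` {w<..1} \<noteq> {}"
        using ends(2) by blast
    qed (use uw in auto)
  qed
  have loopK: "L.loop p \<subseteq> L.K" by (rule L.loop_subset[OF p(1)])
  have zero: "0 \<in> Q"
  proof -
    have "0 \<in> L.loop p" using R_image unfolding L.loop_def L.cyc_def by auto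
    moreover have "0 \<notin> inv0 ` c e ` {u..w}" using edge_not_z0[OF e] uw by auto
    ultimately show ?thesis by (simp add: Q_def)
  qed
  have Q_J: "uninv y \<notin> ?J" if "y \<in> Q" "y \<noteq> 0" for y
  proof -
    have "y \<notin> inv0 ` c e ` {u..w}" "y \<in> L.K" using that loopK by (auto simp: Q_def)
    then have "uninv y \<notin> c e ` {u..w}" "uninv y \<in> barrier"
      using that(2) unfolding L_K by (auto simp: inv0_image_iff)
    then have "uninv y \<notin> F" using in_components_subset[OF F] by blast
    have "c e u \<in> c e ` {u..w}" "c e w \<in> c e ` {u..w}" using uw by auto
    then have "uninv y \<noteq> c e u" "uninv y \<noteq> c e w" using \<open>uninv y \<notin> c e ` {u..w}\<close> by metis+
    then have "uninv y \<notin> path_image \<beta>" using \<beta>(4) \<open>uninv y \<notin> F\<close> by auto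
    then show ?thesis using \<open>uninv y \<notin> c e ` {u..w}\<close> by (simp only: J(3) Un_iff simp_thms)
  qed
  note Jordan = Jordan_inside_outside[OF J(1,2)]
  have fr: "frontier I = ?J" "open I" "bounded I" using Jordan unfolding I by auto
  define A where "A = inv0 ` (I - {z0})"
  have A_iff: "y \<in> A \<longleftrightarrow> y \<noteq> 0 \<and> uninv y \<in> I" for y
    unfolding A_def inv0_image_iff using inv0_zero_iff[of "uninv y"] by auto
  \<comment> \<open>\<open>Q\<close> avoids the curve, so its part inside is both open and closed in
    \<open>Q\<close>. As \<open>Q\<close> is connected and contains 0, which is not in
    \<open>A\<close>, that part is empty.\<close>
  have "openin (top_of_set Q) (Q \<inter> A)"
  proof -
    have "open (- {0} \<inter> uninv -` I)"
      using fr(2) by (intro continuous_open_preimage continuous_uninv) auto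
    moreover have "- {0} \<inter> uninv -` I = A" using A_iff by auto
    ultimately show ?thesis by (auto intro: openin_open_Int)
  qed
  moreover have "closedin (top_of_set Q) (Q \<inter> A)"
  proof -
    obtain B where B: "B > 0" "\<And>y. y \<in> closure I \<Longrightarrow> norm y \<le> B"
      using bounded_closure[OF fr(3)] bounded_pos by metis
    \<comment> \<open>The inside is bounded by \<open>B\<close>, so its inverted points satisfy
      \<open>inverse (norm y) <= B + norm z0\<close>. They keep the distance \<open>\<delta>\<close>
      from 0, where \<open>uninv\<close> is discontinuous.\<close>
    define \<delta> where "\<delta> = inverse (B + norm z0)"
    have "B + norm z0 > 0" using B(1) norm_ge_zero[of z0] by linarith
    then have \<delta>: "\<delta> > 0" by (simp add: \<delta>_def)
    define T where "T = {y. norm y \<ge> \<delta>} \<inter> uninv -` closure I"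
    have "closed T"
      unfolding T_def
    proof (intro continuous_closed_preimage continuous_uninv)
      show "closed {y::complex. \<delta> \<le> norm y}" by (intro closed_Collect_le continuous_intros)
    qed (use \<delta> in auto)
    moreover have "Q \<inter> A = Q \<inter> T"
    proof (intro equalityI subsetI)
      fix y assume y: "y \<in> Q \<inter> A"
      then have uI: "y \<noteq> 0" "uninv y \<in> I" using A_iff by auto
      then have "norm (uninv y) \<le> B" using B(2) closure_subset by blast
      moreover have "norm (inverse y) \<le> norm (uninv y) + norm z0"
        using norm_triangle_ineq4[of "uninv y" z0] by (simp add: uninv_def)
      ultimately have "inverse (norm y) \<le> B + norm z0" by (simp add: norm_inverse)
      then have "\<delta> \<le> norm y" unfolding \<delta>_def
        using uI(1) \<open>B + norm z0 > 0\<close> by (metis inverse_inverse_eq le_imp_inverse_le positive_imp_inverse_positive zero_less_norm_iff)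
      then show "y \<in> Q \<inter> T" using y uI closure_subset unfolding T_def by auto
    next
      fix y assume y: "y \<in> Q \<inter> T"
      then have "y \<noteq> 0" "uninv y \<in> closure I" using \<delta> unfolding T_def by auto
      moreover have "closure I = I \<union> ?J" using fr(1) closure_Un_frontier by metis
      ultimately show "y \<in> Q \<inter> A" using y Q_J[of y] A_iff by auto
    qed
    ultimately show ?thesis by (auto intro: closedin_closed_Int)
  qed
  ultimately have "Q \<inter> A = {} \<or> Q \<inter> A = Q" using \<open>connected Q\<close> connected_clopen by blast
  moreover have "0 \<notin> A" using A_iff by simp
  ultimately have "Q \<inter> A = {}" using zero by blast
  moreover have "A \<inter> inv0 ` c e ` {u..w} = {}"
  proof -
    have "I \<inter> ?J = {}" unfolding I by (rule inside_no_overlap)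
    then have "I \<inter> c e ` {u..w} = {}" unfolding J(3) by blast
    then show ?thesis unfolding A_def by auto
  qed
  ultimately show ?thesis unfolding A_def[symmetric] Q_def by blast
qed

text \<open>Near the middle of the sub-arc, \<open>W p\<close> and the winding number of the small
  curve \<open>J\<close> both jump across the same piece of \<open>e\<close>, and the other
  contributions are continuous. So \<open>W p\<close> changes by \<open>k\<close> from outside to
  inside of \<open>J\<close>. As \<open>W p\<close> is larger by 1 on the left, \<open>k\<close> is
  1 or -1 and tells on which side of the loop the inside of \<open>J\<close>, and with it
  \<open>F\<close>, lies.\<close>

lemma on_side_sign:
  assumes e: "e \<in> E" and F: "F \<in> components (- barrier)"
    and side: "on_side (c e) F k" and k: "k \<noteq> 0"
  shows "k = 1 \<and> lift F = L.left_facet (Some e) \<or> k = - 1 \<and> lift F = L.right_facet (Some e)"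
proof -
  obtain u w \<beta> z where uw: "0 < u" "u < w" "w < 1"
    and \<beta>: "arc \<beta>" "pathstart \<beta> = c e w" "pathfinish \<beta> = c e u" "path_image \<beta> - {c e u, c e w} \<subseteq> F"
    and z: "z \<notin> path_image (subpath u w (c e) +++ \<beta>)" "winding_number (subpath u w (c e) +++ \<beta>) z = k"
    using side unfolding on_side_def by blast
  note curve = side_curve[OF e F uw \<beta>]
  define J where "J = subpath u w (c e) +++ \<beta>"
  note J = curve[folded J_def]
  have pJ: "path J" using J(1) by (rule simple_path_imp_path)
  define I where "I = inside (path_image J)"
  note Jordan = Jordan_inside_outside[OF J(1,2)]
  have I: "open I" "connected I" "frontier I = path_image J" "I \<inter> path_image J = {}"
    "frontier (outside (path_image J)) = path_image J"
    using Jordan inside_no_overlap[of "path_image J"] unfolding I_def by auto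
  have out: "winding_number J y = 0" if "y \<in> outside (path_image J)" for y
    using winding_number_zero_in_outside[OF pJ J(2) that] .
  have "z \<in> I"
  proof (rule ccontr)
    assume "z \<notin> I"
    then have "z \<in> outside (path_image J)"
      using z(1) inside_Un_outside[of "path_image J"] unfolding I_def J_def by blast
    then show False using out z(2) k by (simp add: J_def)
  qed
  have inI: "winding_number J y = k" if "y \<in> I" for y
    using winding_number_eq[OF pJ J(2) that \<open>z \<in> I\<close> I(2,4)] z(2) by (simp add: J_def)
  obtain p where p: "L.stpath p" "e \<in> set p"
    using edge_in_stpath[OF e] L_stpath by blast
  have cyc: "Some e \<in> L.cyc p" "Some e \<in> L.arcs1" using p(2) e by (auto simp: L.cyc_def)
  have off: "inv0 ` (I - {z0}) \<inter> L.loop p = {}"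
    by (rule inside_off_loop[OF e F uw \<beta> p]) (simp add: I_def J_def)
  have same: "inv0 y \<in> L.Left p \<longleftrightarrow> inv0 y' \<in> L.Left p" if "y \<in> I - {z0}" "y' \<in> I - {z0}" for y y'
  proof (rule L.connected_same_side[OF p(1) _ off])
    show "connected (inv0 ` (I - {z0}))"
      using I by (intro connected_continuous_image continuous_inv0 connected_open_delete) auto
  qed (use that in auto)
  have openF: "open F" using open_components[OF _ F] closed_barrier by auto
  have injb: "inj_on \<beta> {0..1}" using \<beta>(1) by (simp add: arc_def)
  have \<beta>F: "\<beta> t \<in> F" if "0 < t" "t < 1" for t
  proof -
    have "\<beta> t \<noteq> \<beta> 0" "\<beta> t \<noteq> \<beta> 1" using inj_onD[OF injb, of t 0] inj_onD[OF injb, of t 1] that by auto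
    then have "\<beta> t \<in> path_image \<beta> - {c e u, c e w}"
      using \<beta>(2,3) that by (auto simp: path_image_def pathstart_def pathfinish_def)
    then show ?thesis using \<beta>(4) by blast
  qed
  \<comment> \<open>The interior of \<open>\<beta>\<close> lies in the open set \<open>F\<close> and
    on the frontier of \<open>I\<close>, so \<open>F\<close> and \<open>I\<close> have common
    points.\<close>
  obtain y0 where y0: "y0 \<in> F" "y0 \<in> I" "y0 \<noteq> z0"
  proof -
    have "\<beta> (1/2) \<in> path_image J" unfolding J(3) by (auto simp: path_image_def)
    then have "\<beta> (1/2) \<in> closure I" using I(3) by (auto simp: frontier_def)
    moreover have "\<beta> (1/2) \<in> F" by (rule \<beta>F) auto
    ultimately have "F \<inter> I \<noteq> {}" using open_Int_closure_eq_empty[OF openF, of I] by blast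
    moreover have "open (F \<inter> I)" using openF I(1) by blast
    ultimately show ?thesis using open_minus_point_nonempty[of "F \<inter> I" z0] that by blast
  qed
  \<comment> \<open>Around \<open>c e m\<close> a small disc meets neither the two remaining pieces
    of \<open>e\<close> nor \<open>\<beta>\<close>.\<close>
  define m where "m = (u + w) / 2"
  have m: "u < m" "m < w" using uw by (auto simp: m_def)
  have inj: "inj_on (c e) {0..1}" using arc_edge[OF e] by (simp add: arc_def)
  have pe: "path (c e)" using arc_edge[OF e] by (rule arc_imp_path)
  define S1 where "S1 = subpath 0 u (c e)"
  define S2 where "S2 = subpath w 1 (c e)"
  have S: "path S1" "path S2" "path_image S1 = c e ` {0..u}" "path_image S2 = c e ` {w..1}"
    unfolding S1_def S2_def using pe uw by (auto intro!: path_subpath simp: path_image_subpath)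
  have "c e m \<notin> path_image S1" "c e m \<notin> path_image S2"
    using inj_onD[OF inj, of m] m uw unfolding S by force+
  moreover have "c e m \<notin> path_image \<beta>"
  proof -
    have "0 < m" "m < 1" using m uw by auto
    then have "c e m \<in> barrier" using tube_barrier[OF e edge_tube[OF e]] by blast
    then have "c e m \<notin> F" using in_components_subset[OF F] by blast
    moreover have "c e m \<noteq> c e u" "c e m \<noteq> c e w"
      using inj_onD[OF inj, of m u] inj_onD[OF inj, of m w] m uw by auto
    ultimately show ?thesis using \<beta>(4) by blast
  qed
  moreover have "open (tube e - path_image S1 - path_image S2 - path_image \<beta>)"
    using S(1,2) arc_imp_path[OF \<beta>(1)] by (intro open_Diff open_tube e closed_path_image)
  moreover have "c e m \<in> tube e" using edge_tube[OF e, of m] m uw by simp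
  ultimately obtain d where d: "d > 0"
    "ball (c e m) d \<subseteq> tube e - path_image S1 - path_image S2 - path_image \<beta>"
    using open_contains_ball by (metis DiffI)
  let ?B = "ball (c e m) d"
  have offJ: "y \<notin> path_image (c e) \<and> y \<notin> barrier \<and> y \<noteq> z0 \<and> inv0 y \<notin> L.loop p"
    if y: "y \<in> ?B" "y \<notin> path_image J" for y
  proof -
    have "{0..1} = {0..u} \<union> {u..w} \<union> {w..1}" using uw by auto
    then have "path_image (c e) = path_image S1 \<union> c e ` {u..w} \<union> path_image S2"
      unfolding path_image_def[of "c e"] S by (metis image_Un)
    then have 1: "y \<notin> path_image (c e)" using y d(2) J(3) by blast
    have "y \<in> tube e" using y d(2) by blast
    then have 2: "y \<notin> barrier" "y \<noteq> z0"
      using tube_barrier[OF e, of y] 1 by (auto simp: path_image_def tube_def)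
    then have "inv0 y \<notin> L.K" using notin_K_iff by blast
    then show ?thesis using 1 2 L.loop_subset[OF p(1)] by blast
  qed
  \<comment> \<open>What is left of \<open>W p - winding_number J\<close> once the common piece of
    \<open>e\<close> cancels. The inverted edge contributes the winding number of \<open>c e\<close>
    up to the constant at \<open>z0\<close>. All terms are continuous on the disc, including at
    points of \<open>e\<close>.\<close>
  define q where "q y = (\<Sum>x\<in>L.cyc p - {Some e}. winding_number (L.curve x) (inv0 y))
    + winding_number S1 y + winding_number S2 y - winding_number (c e) z0 - winding_number \<beta> y" for y
  have q_eq: "q y = L.W p (inv0 y) - winding_number J y" if y: "y \<in> ?B" "y \<notin> path_image J" for y
  proof -
    note o = offJ[OF y]
    have ze: "z0 \<notin> path_image (c e)" using edge_in_D[OF e] z0_notin_D by blast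
    have "L.W p (inv0 y) = winding_number (inv0 \<circ> c e) (inv0 y)
        + (\<Sum>x\<in>L.cyc p - {Some e}. winding_number (L.curve x) (inv0 y))"
      unfolding L.W_def using cyc(1) by (subst sum.remove[of _ "Some e"]) (auto simp: L.cyc_def)
    moreover have "winding_number (inv0 \<circ> c e) (inv0 y) = winding_number (c e) y - winding_number (c e) z0"
      using o ze by (intro winding_number_inv0 pe) auto
    moreover have "winding_number (c e) y
        = winding_number S1 y + winding_number (subpath u w (c e)) y + winding_number S2 y"
    proof -
      have "winding_number S1 y + winding_number (subpath u w (c e)) y = winding_number (subpath 0 w (c e)) y"
        unfolding S1_def using o uw by (intro winding_number_subpath_combine pe) auto
      moreover have "winding_number (subpath 0 w (c e)) y + winding_number S2 y = winding_number (subpath 0 1 (c e)) y"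
        unfolding S2_def using o uw by (intro winding_number_subpath_combine pe) auto
      ultimately show ?thesis by simp
    qed
    moreover have "winding_number J y = winding_number (subpath u w (c e)) y + winding_number \<beta> y"
      unfolding J_def using y(2) J(3,4,5,6) \<beta>(1) by (intro winding_number_join) (auto simp: arc_imp_path)
    ultimately show ?thesis unfolding q_def by simp
  qed
  have const: "q y = q y'" if "y \<in> ?B" "y' \<in> ?B" for y y'
  proof (rule integer_valued_constant[OF connected_ball _ _ that])
    have "continuous_on ?B (\<lambda>y. winding_number (L.curve x) (inv0 y))" if x: "x \<in> L.cyc p - {Some e}" for x
    proof (rule continuous_on_compose2[of "L.nbhd (Some e)" _ _ inv0])
      have xa: "x \<in> L.arcs1 - {Some e}" using L.cyc_subset[OF p(1)] x by blast
      then have "L.img x \<subseteq> L.Kminus (Some e)" unfolding L.Kminus_def by blast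
      then have "L.nbhd (Some e) \<subseteq> - L.img x" using L.nbhd_Kminus[OF cyc(2)] by blast
      then show "continuous_on (L.nbhd (Some e)) (winding_number (L.curve x))"
        using xa L.path_curve[of x] continuous_on_winding_number continuous_on_subset by (metis DiffD1)
      have sub: "?B \<subseteq> tube e" using d(2) by blast
      then show "continuous_on ?B inv0" by (intro continuous_inv0) (auto simp: tube_def)
      show "inv0 ` ?B \<subseteq> L.nbhd (Some e)" using sub by (auto simp: tube_def)
    qed
    moreover have "continuous_on ?B (winding_number T)" if "path T" "?B \<inter> path_image T = {}" for T
      by (rule continuous_on_subset[OF continuous_on_winding_number[OF that(1)]]) (use that(2) in blast)
    moreover have "?B \<inter> path_image S1 = {}" "?B \<inter> path_image S2 = {}" "?B \<inter> path_image \<beta> = {}"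
      using d(2) by blast+
    ultimately show "continuous_on ?B q"
      unfolding q_def using S(1,2) arc_imp_path[OF \<beta>(1)]
      by (intro continuous_on_add continuous_on_diff continuous_on_sum continuous_on_const) auto
    fix y \<epsilon> assume y: "y \<in> ?B" "\<epsilon> > (0::real)"
    have "\<exists>y'\<in>?B. dist y' y < \<epsilon> \<and> y' \<notin> path_image J"
    proof (cases "y \<in> path_image J")
      case True
      then have "y \<in> closure I" using I(3) by (auto simp: frontier_def)
      moreover obtain r where r: "r > 0" "ball y r \<subseteq> ?B" using y(1) open_ball open_contains_ball by blast
      ultimately obtain y' where "y' \<in> I" "dist y' y < min \<epsilon> r"
        using y(2) unfolding closure_approachable by (metis min_less_iff_conj)
      then show ?thesis using r(2) I(4) by (intro bexI[of _ y']) (auto simp: dist_commute subset_iff)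
    next
      case False
      then show ?thesis using y by (intro bexI[of _ y]) auto
    qed
    then obtain y' where y': "y' \<in> ?B" "dist y' y < \<epsilon>" "y' \<notin> path_image J" by blast
    have "winding_number J y' \<in> \<int>" using pJ J(2) y'(3) by (rule integer_winding_number)
    then have "q y' \<in> \<int>"
      unfolding q_eq[OF y'(1,3)] using offJ[OF y'(1,3)] by (intro Ints_diff L.W_Ints p(1)) auto
    then show "\<exists>y'\<in>?B. dist y' y < \<epsilon> \<and> q y' \<in> \<int>" using y' by blast
  qed
  have cm: "c e m \<in> path_image J" unfolding J(3) using m by auto
  then have "c e m \<in> closure I" "c e m \<in> closure (outside (path_image J))"
    using I(3,5) by (auto simp: frontier_def)
  \<comment> \<open>Points of the disc on the two sides of \<open>J\<close>, between which the jump
    is measured.\<close>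
  then obtain z1 z2 where z1: "z1 \<in> I" "dist z1 (c e m) < d"
    and z2: "z2 \<in> outside (path_image J)" "dist z2 (c e m) < d"
    using d(1) unfolding closure_approachable by blast
  have z12: "z1 \<in> ?B" "z1 \<notin> path_image J" "z2 \<in> ?B" "z2 \<notin> path_image J"
  proof -
    show "z1 \<in> ?B" "z2 \<in> ?B" using z1(2) z2(2) by (simp_all add: dist_commute)
    show "z1 \<notin> path_image J" using z1(1) I(4) by blast
    show "z2 \<notin> path_image J" using z2(1) outside_no_overlap[of "path_image J"] by blast
  qed
  note o1 = offJ[OF z12(1,2)] and o2 = offJ[OF z12(3,4)]
  have jump: "L.W p (inv0 z1) - L.W p (inv0 z2) = k"
    using const[OF z12(1,3)] q_eq[OF z12(1,2)] q_eq[OF z12(3,4)] inI[OF z1(1)] out[OF z2(1)]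
    by (simp add: algebra_simps)
  \<comment> \<open>The start of \<open>\<beta>\<close> near \<open>c e w\<close> gives a point of
    \<open>F\<close> in the tube, as \<open>lift_touching\<close> demands.\<close>
  obtain yt where yt: "yt \<in> F" "yt \<in> tube e"
  proof -
    have "c e w \<in> tube e" using edge_tube[OF e, of w] uw by simp
    then obtain r where r: "r > 0" "ball (c e w) r \<subseteq> tube e" using open_tube[OF e] open_contains_ball by blast
    have "continuous_on {0..1} \<beta>" using arc_imp_path[OF \<beta>(1)] by (simp add: path_def)
    then obtain s where s: "s > 0" "\<forall>t\<in>{0..1}. dist t 0 < s \<longrightarrow> dist (\<beta> t) (\<beta> 0) < r"
      using r(1) unfolding continuous_on_iff by (metis atLeastAtMost_iff order_refl zero_le_one)
    define t where "t = min (s/2) (1/2)"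
    have t: "0 < t" "t < 1" "dist t 0 < s" using s(1) by (auto simp: t_def min_def)
    then have "\<beta> t \<in> ball (c e w) r" using s(2) \<beta>(2) by (auto simp: pathstart_def dist_commute)
    then show ?thesis using that[of "\<beta> t"] \<beta>F[OF t(1,2)] r(2) by blast
  qed
  \<comment> \<open>The side is carried from \<open>yt\<close> to \<open>y0\<close> within the
    facet, and from \<open>y0\<close> to \<open>z1\<close> within the inside of \<open>J\<close>,
    which the loop does not enter.\<close>
  have "inv0 yt \<in> lift F" "inv0 y0 \<in> lift F" using yt y0 by (auto simp: lift_def tube_def)
  then have "inv0 yt \<in> L.Left p \<longleftrightarrow> inv0 y0 \<in> L.Left p"
    by (rule L.component_same_side[OF p(1) lift_component[OF F]])
  also have "\<dots> \<longleftrightarrow> inv0 z1 \<in> L.Left p" using o1 z1(1) y0 by (intro same) auto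
  finally have side_eq: "inv0 yt \<in> L.Left p \<longleftrightarrow> inv0 z1 \<in> L.Left p" .
  have sides: "\<not> (inv0 z1 \<in> L.Left p \<longleftrightarrow> inv0 z2 \<in> L.Left p)"
  proof
    assume "inv0 z1 \<in> L.Left p \<longleftrightarrow> inv0 z2 \<in> L.Left p"
    then have "L.W p (inv0 z1) = L.W p (inv0 z2)" using o1 o2 by (intro L.W_same p(1)) simp_all
    then show False using jump k by simp
  qed
  show ?thesis
  proof (cases "inv0 z1 \<in> L.Left p")
    case True
    then have "inv0 z2 \<in> L.Right p" using sides o2 by (simp add: L.Right_iff)
    then have "k = 1" using L.W_step[OF p(1) True] jump by simp
    then show ?thesis using lift_touching(1)[OF p F yt] side_eq True by simp
  next
    case False
    then have "inv0 z2 \<in> L.Left p" "inv0 z1 \<in> L.Right p" using sides o1 by (simp_all add: L.Right_iff)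
    then have "L.W p (inv0 z2) = L.W p (inv0 z1) + 1" by (rule L.W_step[OF p(1)])
    then have "k = - 1" using jump by (simp add: algebra_simps)
    then show ?thesis using lift_touching(2)[OF p F yt] side_eq False by simp
  qed
qed

text \<open>Walk straight from a point of \<open>F\<close> near \<open>c e t\<close> towards
  \<open>c e t\<close> and stop at the first point of the barrier. The walk stays in the tube, so
  this is an interior point of \<open>e\<close>.\<close>

lemma accessible_point:
  assumes e: "e \<in> E" and F: "F \<in> components (- barrier)"
    and lift: "lift F \<in> {L.left_facet (Some e), L.right_facet (Some e)}"
    and t: "0 < t" "t < 1" and \<epsilon>: "\<epsilon> > 0"
  obtains s y where "0 < s" "s < 1" "dist (c e s) (c e t) < \<epsilon>" "y \<in> F"
    "closed_segment y (c e s) \<subseteq> insert (c e s) F"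
proof -
  have x: "Some e \<in> L.arcs1" using e by auto
  have "open (tube e \<inter> ball (c e t) \<epsilon>)" using open_tube[OF e] by blast
  moreover have "c e t \<in> tube e \<inter> ball (c e t) \<epsilon>" using edge_tube[OF e t] \<epsilon> by simp
  ultimately obtain r where r: "r > 0" "ball (c e t) r \<subseteq> tube e \<inter> ball (c e t) \<epsilon>"
    using open_contains_ball by blast
  have ne: "c e t \<noteq> z0" using edge_not_z0[OF e] t by auto
  have "continuous_on (- {0}) uninv" by (rule continuous_uninv) simp
  then have "continuous (at (inv0 (c e t))) uninv"
    using continuous_on_eq_continuous_at[of "- {0}" uninv] ne by (auto simp: open_Compl)
  then obtain \<delta> where \<delta>: "\<delta> > 0" "\<And>w. dist w (inv0 (c e t)) < \<delta> \<Longrightarrow> dist (uninv w) (c e t) < r"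
    using r(1) unfolding continuous_at_eps_delta by (metis uninv_inv0)
  have "\<exists>w\<in>lift F. dist w (inv0 (c e t)) < \<delta>"
    using L.facet_near[OF x inner_edge[OF e t] \<delta>(1)] lift by auto
  then obtain w where w: "w \<in> lift F" "dist w (inv0 (c e t)) < \<delta>" by blast
  define y where "y = uninv w"
  have y: "y \<in> F" "y \<in> ball (c e t) r"
    using w \<delta>(2)[OF w(2)] unfolding y_def lift_def by (auto simp: dist_commute)
  have ct: "c e t \<in> barrier" using tube_barrier[OF e edge_tube[OF e t]] t by blast
  have "closed (barrier \<inter> closed_segment y (c e t))" by (intro closed_Int closed_barrier closed_segment)
  moreover have "barrier \<inter> closed_segment y (c e t) \<noteq> {}" using ct by auto
  ultimately obtain b where b: "b \<in> barrier \<inter> closed_segment y (c e t)"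
    "open_segment y b \<inter> (barrier \<inter> closed_segment y (c e t)) = {}"
    by (rule segment_to_point_exists[of _ y])
  have seg: "closed_segment y (c e t) \<subseteq> ball (c e t) r"
    using y(2) r(1) by (intro closed_segment_subset) auto
  then have "b \<in> tube e" "b \<in> barrier" "dist (c e t) b < \<epsilon>" using b(1) r(2) by auto
  then obtain s where s: "0 < s" "s < 1" "b = c e s" using tube_barrier[OF e] by blast
  have sub: "closed_segment y b \<subseteq> closed_segment y (c e t)"
    using b(1) by (intro closed_segment_subset) auto
  have "y \<notin> barrier" using y(1) in_components_subset[OF F] by blast
  moreover have "closed_segment y b = {y, b} \<union> open_segment y b" by (simp add: closed_segment_eq_open)
  ultimately have disj: "(closed_segment y b - {b}) \<inter> barrier = {}" using b sub by auto
  have "y \<noteq> b" using \<open>y \<notin> barrier\<close> b(1) by blast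
  have "connected (closed_segment y b - {b})"
  proof (rule connected_intermediate_closure)
    show "connected (open_segment y b)" by (intro convex_connected convex_open_segment)
    show "open_segment y b \<subseteq> closed_segment y b - {b}" by (auto simp: open_segment_def)
    show "closed_segment y b - {b} \<subseteq> closure (open_segment y b)"
      using \<open>y \<noteq> b\<close> by (simp add: closure_open_segment Diff_subset)
  qed
  moreover have "y \<in> closed_segment y b - {b}" using \<open>y \<noteq> b\<close> by simp
  ultimately have "closed_segment y b - {b} \<subseteq> F"
    unfolding component_containing[OF F y(1)] using disj by (intro connected_component_maximal) auto
  then show ?thesis using that[OF s(1,2) _ y(1)] s(3) \<open>dist (c e t) b < \<epsilon>\<close> by (auto simp: dist_commute)
qed

text \<open>Two points of \<open>e\<close> accessible from \<open>F\<close> are joined by an arc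
  through \<open>F\<close>. Together with the piece of \<open>e\<close> between them it forms a
  Jordan curve, whose winding number around its inside is not 0.\<close>

lemma on_side_exists:
  assumes e: "e \<in> E" and F: "F \<in> components (- barrier)"
    and lift: "lift F \<in> {L.left_facet (Some e), L.right_facet (Some e)}"
  obtains k where "k \<noteq> 0" "on_side (c e) F k"
proof -
  have inj: "inj_on (c e) {0..1}" using arc_edge[OF e] by (simp add: arc_def)
  \<comment> \<open>Half the distance between two points of \<open>e\<close>, so that accessible
    points chosen within \<open>\<epsilon>\<close> of them are distinct.\<close>
  define \<epsilon> where "\<epsilon> = dist (c e (1/3)) (c e (2/3)) / 2"
  have \<epsilon>: "\<epsilon> > 0" using inj_onD[OF inj, of "1/3" "2/3"] by (auto simp: \<epsilon>_def)
  obtain s1 y1 where 1: "0 < s1" "s1 < 1" "dist (c e s1) (c e (1/3)) < \<epsilon>" "y1 \<in> F"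
    "closed_segment y1 (c e s1) \<subseteq> insert (c e s1) F"
    using accessible_point[OF e F lift _ _ \<epsilon>, of "1/3"] by auto
  obtain s2 y2 where 2: "0 < s2" "s2 < 1" "dist (c e s2) (c e (2/3)) < \<epsilon>" "y2 \<in> F"
    "closed_segment y2 (c e s2) \<subseteq> insert (c e s2) F"
    using accessible_point[OF e F lift _ _ \<epsilon>, of "2/3"] by auto
  have ne: "c e s1 \<noteq> c e s2"
  proof
    assume "c e s1 = c e s2"
    then have "dist (c e (1/3)) (c e (2/3)) \<le> dist (c e s1) (c e (1/3)) + dist (c e s2) (c e (2/3))"
      using dist_triangle3[of "c e (1/3)" "c e (2/3)" "c e s1"] by simp
    then show False using 1(3) 2(3) by (simp add: \<epsilon>_def)
  qed
  have "path_connected F"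
    using open_components[OF _ F] closed_barrier in_components_connected[OF F]
    by (intro connected_open_path_connected) auto
  moreover have seg: "path_connected (closed_segment y z)" for y z :: complex
    by (intro convex_imp_path_connected convex_closed_segment)
  ultimately have "path_connected (F \<union> closed_segment y1 (c e s1))"
    using 1(4) by (intro path_connected_Un) auto
  then have "path_connected (F \<union> closed_segment y1 (c e s1) \<union> closed_segment y2 (c e s2))"
    by (rule path_connected_Un[OF _ seg]) (use 2(4) in auto)
  moreover have "F \<union> closed_segment y1 (c e s1) \<union> closed_segment y2 (c e s2) = F \<union> {c e s1, c e s2}"
    using 1(5) 2(5) by auto
  ultimately have pc: "path_connected (F \<union> {c e s1, c e s2})" by simp
  define u where "u = min s1 s2"
  define w where "w = max s1 s2"
  have "s1 \<noteq> s2" using ne by auto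
  then have uw: "0 < u" "u < w" "w < 1" "{c e u, c e w} = {c e s1, c e s2}" "c e u \<noteq> c e w"
    using 1 2 ne by (auto simp: u_def w_def min_def max_def)
  have "c e w \<in> F \<union> {c e s1, c e s2}" "c e u \<in> F \<union> {c e s1, c e s2}" using uw(4) by auto
  then obtain \<beta> where \<beta>: "arc \<beta>" "path_image \<beta> \<subseteq> F \<union> {c e s1, c e s2}"
    "pathstart \<beta> = c e w" "pathfinish \<beta> = c e u"
    using pc uw(5) unfolding path_connected_arcwise by metis
  have \<beta>': "path_image \<beta> - {c e u, c e w} \<subseteq> F" using \<beta>(2) uw(4) by blast
  define J where "J = subpath u w (c e) +++ \<beta>"
  note J = side_curve[OF e F uw(1-3) \<beta>(1,3,4) \<beta>', folded J_def]
  obtain z where z: "z \<in> inside (path_image J)" using Jordan_inside_outside[OF J(1,2)] by blast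
  then have "z \<notin> path_image J" using inside_no_overlap by blast
  moreover have "winding_number J z \<noteq> 0"
    by (rule simple_closed_path_winding_number_inside[OF J(1)]) (use z in auto)
  moreover have "on_side (c e) F (winding_number J z)"
    unfolding on_side_def using uw(1-3) \<beta>(1,3,4) \<beta>' \<open>z \<notin> path_image J\<close> unfolding J_def by blast
  ultimately show ?thesis using that by blast
qed

text \<open>A facet touching \<open>e\<close> has some nonzero side number by
  \<open>on_side_exists\<close>; \<open>on_side_sign\<close> determines its value, since the two
  facets along \<open>e\<close> differ.\<close>

lemma on_side_iff:
  assumes e: "e \<in> E" and F: "F \<in> components (- barrier)"
  shows "on_side (c e) F 1 \<longleftrightarrow> lift F = L.left_facet (Some e)"
    and "on_side (c e) F (- 1) \<longleftrightarrow> lift F = L.right_facet (Some e)"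
proof -
  have ne: "L.left_facet (Some e) \<noteq> L.right_facet (Some e)" using e by (intro facets_neq) auto
  have ex: "\<exists>k. k \<noteq> 0 \<and> on_side (c e) F k" if "lift F \<in> {L.left_facet (Some e), L.right_facet (Some e)}"
    using on_side_exists[OF e F that] by metis
  note sign = on_side_sign[OF e F]
  show "on_side (c e) F 1 \<longleftrightarrow> lift F = L.left_facet (Some e)"
  proof
    assume "lift F = L.left_facet (Some e)"
    then show "on_side (c e) F 1" using ex sign ne by auto
  qed (use sign[of 1] in auto)
  show "on_side (c e) F (- 1) \<longleftrightarrow> lift F = L.right_facet (Some e)"
  proof
    assume "lift F = L.right_facet (Some e)"
    then show "on_side (c e) F (- 1)" using ex sign ne by auto
  qed (use sign[of "- 1"] in auto)
qed

text \<open>\<open>lift\<close> is a bijection between facets and components of the inverted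
  picture, so exactly one facet lies on each side of \<open>e\<close> and the definite descriptions
  are meaningful.\<close>

lemma dual_ends:
  assumes e: "e \<in> E"
  shows "dtail e \<in> components (- barrier)"
    "lift (dtail e) = L.left_facet (Some e)"
    "dhead e \<in> components (- barrier)"
    "lift (dhead e) = L.right_facet (Some e)"
proof -
  have x: "Some e \<in> L.arcs1" using e by auto
  have ex1: "\<exists>!F. F \<in> components (- barrier) \<and> lift F = C" if "C \<in> components (- L.K)" for C
    using lift_surj[OF that] lift_inj by metis
  have tail: "dtail e = (THE F. F \<in> components (- barrier) \<and> lift F = L.left_facet (Some e))"
    unfolding dual_tail_def facets_eq using on_side_iff(1)[OF e] by (metis (no_types, lifting))
  have head: "dhead e = (THE F. F \<in> components (- barrier) \<and> lift F = L.right_facet (Some e))"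
    unfolding dual_head_def facets_eq using on_side_iff(2)[OF e] by (metis (no_types, lifting))
  show "dtail e \<in> components (- barrier)"
    "lift (dtail e) = L.left_facet (Some e)"
    unfolding tail using theI'[OF ex1[OF L.facets_components(1)[OF x]]] by auto
  show "dhead e \<in> components (- barrier)"
    "lift (dhead e) = L.right_facet (Some e)"
    unfolding head using theI'[OF ex1[OF L.facets_components(2)[OF x]]] by auto
qed

text \<open>The outer facets are those along the return arc \<open>R\<close>. As \<open>R\<close>
  belongs to every loop, its left facet is to the left of all paths and its right facet of
  none.\<close>

lemma dual_pair_exists:
  "\<exists>l r side. dual_pair V E (ptail c) (phead c) (facets V E c \<gamma>1 \<gamma>2)
     (dtail) (dhead) l r side"
proof -
  let ?Fac = "components (- barrier)"
  have N: "None \<in> L.arcs1" by simp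
  obtain l where l: "l \<in> ?Fac" "lift l = L.left_facet None"
    using lift_surj[OF L.facets_components(1)[OF N]] .
  obtain r where r: "r \<in> ?Fac" "lift r = L.right_facet None"
    using lift_surj[OF L.facets_components(2)[OF N]] .
  define side where "side p = {F \<in> ?Fac. lift F \<subseteq> L.Left p}" for p
  have right: "\<not> L.right_facet x \<subseteq> L.Left p" if "L.stpath p" "x \<in> L.cyc p" for x p
  proof -
    have "x \<in> L.arcs1" using L.cyc_subset that by blast
    then show ?thesis
      using L.facet_sides(2)[OF that] in_components_nonempty[OF L.facets_components(2)] by blast
  qed
  have "dual_pair V E (ptail c) (phead c) ?Fac
     (dtail) (dhead) l r side"
  proof
    fix e assume e: "e \<in> E"
    show "dtail e \<in> ?Fac" "dhead e \<in> ?Fac"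
      by (rule dual_ends[OF e])+
  next
    show "l \<in> ?Fac" "r \<in> ?Fac" by fact+
  next
    fix p assume p: "stpath p"
    then have Lp: "L.stpath p" by (simp add: L_stpath)
    have N: "None \<in> L.cyc p" by (simp add: L.cyc_def)
    show "l \<in> side p" using l L.facet_sides(1)[OF Lp N] by (simp add: side_def)
    show "r \<notin> side p" using r right[OF Lp N] by (simp add: side_def)
    show "dtail e \<in> side p \<and> dhead e \<notin> side p" if "e \<in> set p" for e
    proof -
      have "e \<in> E" "Some e \<in> L.cyc p" using that p by (auto simp: max_dpath_def dpath_def L.cyc_def)
      then show ?thesis using dual_ends[of e] L.facet_sides(1)[OF Lp] right[OF Lp] by (simp add: side_def)
    qed
    show "dtail e \<in> side p \<longleftrightarrow> dhead e \<in> side p"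
      if "e \<in> E" "e \<notin> set p" for e
    proof -
      have "Some e \<in> L.arcs1" "Some e \<notin> L.cyc p" using that by (auto simp: L.cyc_def)
      then show ?thesis using dual_ends[OF that(1)] L.facet_off_loop[OF Lp] by (simp add: side_def)
    qed
  next
    fix pred and h :: "complex set \<Rightarrow> int" and F F'
    assume pred: "tree pred" and FF: "F \<in> ?Fac" "F' \<in> ?Fac"
      and h: "\<And>e. e \<in> E - tree_edges pred \<Longrightarrow> h (dtail e) = h (dhead e)"
    \<comment> \<open>Transports \<open>h\<close> along the bijection \<open>lift\<close> to the
      components of the inverted picture.\<close>
    define h' where "h' C = h (THE F. F \<in> ?Fac \<and> lift F = C)" for C
    have h': "h' (lift F) = h F" if "F \<in> ?Fac" for F
      unfolding h'_def using that lift_inj by (metis (mono_tags, lifting) the_equality)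
    have Vs: "inv0 ` V - {L.source, L.sink} = inv0 ` (V - {source, sink})"
      unfolding L_ends by auto
    have edges: "(pred \<circ> uninv) ` (inv0 ` V - {L.source, L.sink}) = tree_edges pred"
      unfolding Vs by (simp add: image_image)
    have "h' (lift F) = h' (lift F')"
    proof (rule L.facet_function_constant[where pred = "pred \<circ> uninv"])
      fix v assume "v \<in> inv0 ` V - {L.source, L.sink}"
      then obtain y where "y \<in> V - {source, sink}" "v = inv0 y" unfolding Vs by blast
      then show "(pred \<circ> uninv) v \<in> E \<and> phead cinv ((pred \<circ> uninv) v) = v"
        using pred unfolding tree_def phead_cinv by auto
    next
      fix e assume "e \<in> E - (pred \<circ> uninv) ` (inv0 ` V - {L.source, L.sink})"
      then have e: "e \<in> E - tree_edges pred" unfolding edges .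
      then show "h' (L.left_facet (Some e)) = h' (L.right_facet (Some e))"
        using h[OF e] h' dual_ends[of e] by (metis DiffD1)
    qed (use FF lift_component in auto)
    then show "h F = h F'" using h' FF by simp
  qed
  then show ?thesis unfolding facets_eq by blast
qed

end

theorem theorem4p4:
  fixes VG VH :: "complex set"
    and EG :: "'e set" and EH :: "'f set"
    and cG :: "'e \<Rightarrow> real \<Rightarrow> complex" and cH :: "'f \<Rightarrow> real \<Rightarrow> complex"
    and \<gamma>G1 \<gamma>G2 \<gamma>H1 \<gamma>H2 :: "real \<Rightarrow> complex"
    and \<phi> :: "nat \<Rightarrow> 'e" and \<psi> :: "nat \<Rightarrow> 'f" and n :: nat
    and b :: "'a::ab_group_add" and a :: "nat \<Rightarrow> 'a"
  assumes "upward_bipolar_plane VG EG cG"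
    and "upward_bipolar_plane VH EH cH"
    and "bij_betw \<phi> {1..n} EG"
    and "bij_betw \<psi> {1..n} EH"
    and "is_cut VG EG cG \<gamma>G1 \<gamma>G2"
    and "is_cut VH EH cH \<gamma>H1 \<gamma>H2"
  shows "is_solution VG EG (ptail cG) (phead cG) EH (ptail cH) (phead cH) \<phi> \<psi> n b a
     \<longleftrightarrow> is_solution (facets VH EH cH \<gamma>H1 \<gamma>H2) EH
            (dual_tail VH EH cH \<gamma>H1 \<gamma>H2) (dual_head VH EH cH \<gamma>H1 \<gamma>H2)
            EG (dual_tail VG EG cG \<gamma>G1 \<gamma>G2) (dual_head VG EG cG \<gamma>G1 \<gamma>G2)
            \<psi> \<phi> n b a"
proof -
  have pair: "\<exists>l r side. dual_pair V E (ptail c) (phead c) (facets V E c \<gamma>1 \<gamma>2)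
      (dual_tail V E c \<gamma>1 \<gamma>2) (dual_head V E c \<gamma>1 \<gamma>2) l r side"
    if "upward_bipolar_plane V E c" "is_cut V E c \<gamma>1 \<gamma>2"
    for V and E :: "'g set" and c \<gamma>1 \<gamma>2
  proof -
    interpret cut_graph V E c \<gamma>1 \<gamma>2 using that by unfold_locales
    obtain z0 where z0: "z0 \<notin> barrier" using barrier_proper by blast
    obtain R where R: "arc R" "pathstart R = inversion.inv0 z0 sink" "pathfinish R = inversion.inv0 z0 source"
      "path_image R = insert 0 (inversion.inv0 z0 ` rays)"
      using return_arc_exists[OF z0] by blast
    interpret inverted_graph V E c \<gamma>1 \<gamma>2 z0 R using z0 R by unfold_locales
    show ?thesis by (rule dual_pair_exists)
  qed
  obtain lG rG sideG where G: "dual_pair VG EG (ptail cG) (phead cG) (facets VG EG cG \<gamma>G1 \<gamma>G2)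
      (dual_tail VG EG cG \<gamma>G1 \<gamma>G2) (dual_head VG EG cG \<gamma>G1 \<gamma>G2) lG rG sideG"
    using pair[OF assms(1,5)] by blast
  obtain lH rH sideH where H: "dual_pair VH EH (ptail cH) (phead cH) (facets VH EH cH \<gamma>H1 \<gamma>H2)
      (dual_tail VH EH cH \<gamma>H1 \<gamma>H2) (dual_head VH EH cH \<gamma>H1 \<gamma>H2) lH rH sideH"
    using pair[OF assms(2,6)] by blast
  show ?thesis by (rule dual_solution_iff[OF G H assms(3,4)])
qed

end
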